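(* The graph isomorphism problem restricted to literal-clause graphs with negation connections of 3-SAT formulas is equally hard as graph isomorphism on general graphs: $\mathrm{GI}$ is polynomial-time many-one reducible to $\mathrm{GI}_{\mathrm{SAT}}$, and $\mathrm{GI}_{\mathrm{SAT}}$ is polynomial-time many-one reducible to $\mathrm{GI}$.
   Context: $\mathrm{GI}=\{(G,H): G,H\text{ are isomorphic graphs}\}$. For a CNF formula $f$ on variables $x_1,\dots,x_n$, $\mathrm{LCN}(f)$ is the edge-colored graph with vertices the $2n$ literals $x_i,\neg x_i$ and one vertex per clause, a "literal-clause" colored edge $\{\ell,c\}$ whenever $\ell\in c$, and a differently colored "literal-literal" edge $\{x_i,\neg x_i\}$ for each $i$. A 3-SAT formula is a CNF formula with every clause of at most 3 literals. With $\mathcal G=\{\mathrm{LCN}(f): f\text{ a 3-SAT formula}\}$, $\mathrm{GI}_{\mathrm{SAT}}=\{(G,H): G,H\in\mathcal G\text{ are isomorphic (as edge-colored graphs)}\}$. *)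

theory Defs
  imports Main
begin

text \<open>A machine is (number of states Q, number of tape symbols S, transition function).
  States are 0..<Q, state 0 is the start state, state 1 is the halting state.
  Tape symbols are 0..<S; symbol 0 is the blank, 1 encodes the bit False, 2 the bit True,
  further symbols are work symbols. The transition function maps (state, read symbol)
  to (new state, written symbol, head move in {-1,0,1}).\<close>

type_synonym tm = "nat \<times> nat \<times> (nat \<Rightarrow> nat \<Rightarrow> nat \<times> nat \<times> int)"
type_synonym config = "nat \<times> (int \<Rightarrow> nat) \<times> int"

definition wf_tm :: "tm \<Rightarrow> bool" where
  "wf_tm M = (case M of (Q, S, \<delta>) \<Rightarrow> 2 \<le> Q \<and> 3 \<le> S \<and>
     (\<forall>q<Q. \<forall>a<S. case \<delta> q a of (q', a', d) \<Rightarrow> q' < Q \<and> a' < S \<and> d \<in> {-1, 0, 1}))"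

definition tm_step :: "tm \<Rightarrow> config \<Rightarrow> config" where
  "tm_step M c = (case M of (Q, S, \<delta>) \<Rightarrow> case c of (q, t, h) \<Rightarrow>
     if q = 1 then (q, t, h) else (case \<delta> q (t h) of (q', a, d) \<Rightarrow> (q', t(h := a), h + d)))"

definition bit_sym :: "bool \<Rightarrow> nat" where
  "bit_sym b = (if b then 2 else 1)"

definition tm_init :: "bool list \<Rightarrow> config" where
  "tm_init w = (0, \<lambda>i. if 0 \<le> i \<and> i < int (length w) then bit_sym (w ! nat i) else 0, 0)"

definition tape_output :: "(int \<Rightarrow> nat) \<Rightarrow> int \<Rightarrow> bool list \<Rightarrow> bool" where
  "tape_output t h v = ((\<forall>i<length v. t (h + int i) = bit_sym (v ! i)) \<and> t (h + int (length v)) = 0)"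

definition computes_in_time :: "tm \<Rightarrow> (bool list \<Rightarrow> bool list) \<Rightarrow> (nat \<Rightarrow> nat) \<Rightarrow> bool" where
  "computes_in_time M f T = (\<forall>w. \<exists>k \<le> T (length w).
     (case (tm_step M ^^ k) (tm_init w) of (q, t, h) \<Rightarrow> q = 1 \<and> tape_output t h (f w)))"

definition poly_time_computable :: "(bool list \<Rightarrow> bool list) \<Rightarrow> bool" where
  "poly_time_computable f = (\<exists>M c d. wf_tm M \<and> computes_in_time M f (\<lambda>n. c * n ^ d + c))"

definition poly_reducible :: "bool list set \<Rightarrow> bool list set \<Rightarrow> bool" where
  "poly_reducible A B = (\<exists>f. poly_time_computable f \<and> (\<forall>w. w \<in> A \<longleftrightarrow> f w \<in> B))"

type_synonym graph = "nat \<times> (nat \<Rightarrow> nat \<Rightarrow> bool)"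

definition simple_graph :: "graph \<Rightarrow> bool" where
  "simple_graph G = (case G of (N, E) \<Rightarrow> \<forall>i<N. \<forall>j<N. E i j = E j i \<and> \<not> E i i)"

definition graph_iso :: "graph \<Rightarrow> graph \<Rightarrow> bool" where
  "graph_iso G H = (case G of (N, E) \<Rightarrow> case H of (M, F) \<Rightarrow>
     \<exists>\<pi>. bij_betw \<pi> {0..<N} {0..<M} \<and> (\<forall>i<N. \<forall>j<N. E i j = F (\<pi> i) (\<pi> j)))"

text \<open>An edge-coloured graph on {0..<N}: colour 0 = no edge, colour 1 = literal-clause edge,
  colour 2 = literal-literal edge.\<close>
type_synonym cgraph = "nat \<times> (nat \<Rightarrow> nat \<Rightarrow> nat)"

definition cgraph_iso :: "cgraph \<Rightarrow> cgraph \<Rightarrow> bool" where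
  "cgraph_iso G H = (case G of (N, C) \<Rightarrow> case H of (M, D) \<Rightarrow>
     \<exists>\<pi>. bij_betw \<pi> {0..<N} {0..<M} \<and> (\<forall>i<N. \<forall>j<N. C i j = D (\<pi> i) (\<pi> j)))"

definition enc_graph :: "graph \<Rightarrow> bool list" where
  "enc_graph G = (case G of (N, E) \<Rightarrow>
     replicate N True @ [False] @ concat (map (\<lambda>i. map (\<lambda>j. E i j) [0..<N]) [0..<N]))"

definition enc_color :: "nat \<Rightarrow> bool list" where
  "enc_color c = [c div 2 mod 2 = 1, c mod 2 = 1]"

definition enc_cgraph :: "cgraph \<Rightarrow> bool list" where
  "enc_cgraph G = (case G of (N, C) \<Rightarrow>
     replicate N True @ [False] @ concat (map (\<lambda>i. concat (map (\<lambda>j. enc_color (C i j)) [0..<N])) [0..<N]))"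

definition enc_pair :: "bool list \<Rightarrow> bool list \<Rightarrow> bool list" where
  "enc_pair x y = concat (map (\<lambda>b. [b, b]) x) @ [False, True] @ y"

text \<open>Literal (i, True) is x_i, (i, False) is the negation of x_i; variables are indexed 0..<n.
  A CNF formula is a list of clauses (one LCN vertex per list entry); a clause is a set of literals.\<close>
type_synonym literal = "nat \<times> bool"
type_synonym clause = "literal set"
type_synonym cnf = "clause list"

definition is_3sat :: "nat \<Rightarrow> cnf \<Rightarrow> bool" where
  "is_3sat n F = (\<forall>c \<in> set F. finite c \<and> card c \<le> 3 \<and> (\<forall>(i, b) \<in> c. i < n))"

datatype lcn_vertex = LitV nat bool | ClV nat

definition lcn_vertices :: "nat \<Rightarrow> cnf \<Rightarrow> lcn_vertex set" where
  "lcn_vertices n F = {LitV i b | i b. i < n} \<union> {ClV j | j. j < length F}"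

definition lcn_color :: "nat \<Rightarrow> cnf \<Rightarrow> lcn_vertex \<Rightarrow> lcn_vertex \<Rightarrow> nat" where
  "lcn_color n F u v = (case (u, v) of
      (LitV i b, ClV j) \<Rightarrow> if (i, b) \<in> F ! j then 1 else 0
    | (ClV j, LitV i b) \<Rightarrow> if (i, b) \<in> F ! j then 1 else 0
    | (LitV i b, LitV i' b') \<Rightarrow> if i = i' \<and> b \<noteq> b' then 2 else 0
    | (ClV j, ClV j') \<Rightarrow> 0)"

definition in_LCN_class :: "cgraph \<Rightarrow> bool" where
  "in_LCN_class G = (case G of (N, C) \<Rightarrow> \<exists>n F. is_3sat n F \<and>
     (\<exists>\<pi>. bij_betw \<pi> {0..<N} (lcn_vertices n F) \<and>
          (\<forall>i<N. \<forall>j<N. C i j = lcn_color n F (\<pi> i) (\<pi> j))))"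

definition GI :: "bool list set" where
  "GI = {enc_pair (enc_graph G) (enc_graph H) | G H.
           simple_graph G \<and> simple_graph H \<and> graph_iso G H}"

definition GI_SAT :: "bool list set" where
  "GI_SAT = {enc_pair (enc_cgraph G) (enc_cgraph H) | G H.
           in_LCN_class G \<and> in_LCN_class H \<and> cgraph_iso G H}"

end

theory Submission
  imports Defs
begin

text \<open>
  GI reduces to GI-SAT by the formula with one clause $\{x_a, x_b\}$ per edge: an isomorphism of the
  literal-clause graphs maps complementary pairs of literals to such pairs, hence induces a map of
  the variables, and two variables are adjacent iff a common clause meets both of their pairs.
  Conversely, replacing every vertex $u$ of a literal-clause graph by a path
  $(1, u) - (0, u) - (2, u)$ and drawing the two edge colours in the layers 0 and 2 removes the
  colours, since layer 0 is recognised as the set of neighbours of leaves.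

  Both maps, including the check that the input is well-formed and (for GI-SAT) that the graphs are
  literal-clause graphs, are given by first-order formulas with arithmetic over the positions of the
  input word: a position ranges over polynomially many values, so such a formula is decided, and a
  graph with a definable edge relation is printed, by nested loops over finitely many pointers into
  the input. A Turing machine keeps the pointers as marks on its tape, which costs only a linear
  factor.
\<close>

section \<open>Structured tape programs\<close>

text \<open>Membership in the class of literal-clause graphs quantifies over formulas and
  bijections, so it cannot be tested as stated. It is replaced by conditions on few vertices at a
  time, see \<open>lcn_coloring\<close>: colour 2 is a matching, colour 1 joins a matched to an
  unmatched vertex, and unmatched vertices have at most three neighbours. Words that fail a check
  are sent to the empty word, which lies in neither language.

  The vertices of an output graph are pairs (a, b) with b < N and a below N + 2 or below 3. Their
  number depends on N alone, so no edges have to be counted, and the colour of two vertices is a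
  formula in their coordinates; this is why non-edges receive a clause as well, an empty one.

  An isomorphism of literal-clause graphs may negate some variables and not others, so positive
  literals cannot be told apart from negative ones. In the path that replaces u, the second end
  keeps the middle vertex from being a leaf even when u is isolated.\<close>

datatype 'a tcom = Act "'a \<Rightarrow> 'a" int | TSeq "'a tcom" "'a tcom"
  | TIf "'a \<Rightarrow> bool" "'a tcom" "'a tcom" | TWhile "'a \<Rightarrow> bool" "'a tcom"

text \<open>The state of the machine is the list of programs that remain to be run. Only finitely many
  lists are reachable, see \<open>conts\<close> below; the empty list is the halting state.\<close>

fun tstep :: "'a tcom list \<Rightarrow> 'a \<Rightarrow> 'a tcom list \<times> 'a \<times> int" where
  "tstep [] a = ([], a, 0)"
| "tstep (Act g d # cs) a = (cs, g a, d)"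
| "tstep (TSeq x y # cs) a = (x # y # cs, a, 0)"
| "tstep (TIf P x y # cs) a = ((if P a then x else y) # cs, a, 0)"
| "tstep (TWhile P x # cs) a = (if P a then x # TWhile P x # cs else cs, a, 0)"

definition sstep :: "'a tcom list \<times> (int \<Rightarrow> 'a) \<times> int \<Rightarrow> 'a tcom list \<times> (int \<Rightarrow> 'a) \<times> int" where
  "sstep = (\<lambda>(q, t, h). case tstep q (t h) of (q', a, d) \<Rightarrow> (q', t(h := a), h + d))"

text \<open>One number of steps serves every continuation \<open>cs\<close>; this makes runs compose
  in sequences and loops. A bound \<open>T\<close> instead of an exact count allows costs to be
  rounded up.\<close>

definition runs :: "'a tcom \<Rightarrow> (int \<Rightarrow> 'a) \<times> int \<Rightarrow> nat \<Rightarrow> (int \<Rightarrow> 'a) \<times> int \<Rightarrow> bool" where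
  "runs c s T s' \<longleftrightarrow> (\<exists>k\<le>T. \<forall>cs. (sstep ^^ k) (c # cs, s) = (cs, s'))"

lemma funpow_add_apply: "(f ^^ (m + n)) x = (f ^^ n) ((f ^^ m) x)"
  by (metis add.commute comp_apply funpow_add)

lemma runs_mono: "runs c s T s' \<Longrightarrow> T \<le> T' \<Longrightarrow> runs c s T' s'"
  unfolding runs_def by (meson le_trans)

lemma runs_Act: "runs (Act g d) (t, h) 1 (t(h := g (t h)), h + d)"
  unfolding runs_def by (rule exI[of _ 1]) (simp add: sstep_def)

lemma runs_first_step:
  assumes "\<And>cs. sstep (c # cs, s) = (x # cs, s)" "runs x s i s'"
  shows "runs c s (Suc i) s'"
proof -
  obtain k where "k \<le> i" "\<And>cs. (sstep ^^ k) (x # cs, s) = (cs, s')"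
    using assms(2) unfolding runs_def by blast
  then show ?thesis
    unfolding runs_def using assms(1)
    by (intro exI[of _ "Suc k"]) (simp add: funpow_Suc_right del: funpow.simps)
qed

lemma runs_two:
  assumes "\<And>cs. sstep (c # cs, s) = (x # y # cs, s)" "runs x s i s'" "runs y s' j s''"
  shows "runs c s (Suc (i + j)) s''"
proof -
  obtain k where k: "k \<le> i" "\<And>cs. (sstep ^^ k) (x # cs, s) = (cs, s')"
    using assms(2) unfolding runs_def by blast
  obtain l where l: "l \<le> j" "\<And>cs. (sstep ^^ l) (y # cs, s') = (cs, s'')"
    using assms(3) unfolding runs_def by blast
  have "(sstep ^^ Suc (k + l)) (c # cs, s) = (cs, s'')" for cs
    by (simp only: funpow_Suc_right o_apply assms(1) funpow_add_apply k l)
  then show ?thesis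
    unfolding runs_def using k(1) l(1) by (intro exI[of _ "Suc (k + l)"]) simp
qed

lemma runs_TSeq: "runs x s i s' \<Longrightarrow> runs y s' j s'' \<Longrightarrow> runs (TSeq x y) s (Suc (i + j)) s''"
  by (rule runs_two) (auto simp: sstep_def split: prod.split)

lemma runs_TIf:
  "runs (if P (t h) then x else y) (t, h) i s' \<Longrightarrow> runs (TIf P x y) (t, h) (Suc i) s'"
  by (rule runs_first_step) (auto simp: sstep_def split: prod.split)

lemma runs_TWhile_False: "\<not> P (t h) \<Longrightarrow> runs (TWhile P c) (t, h) 1 (t, h)"
  unfolding runs_def by (rule exI[of _ 1]) (simp add: sstep_def)

lemma runs_TWhile_True:
  "P (t h) \<Longrightarrow> runs c (t, h) i s' \<Longrightarrow> runs (TWhile P c) s' j s'' \<Longrightarrow>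
   runs (TWhile P c) (t, h) (Suc (i + j)) s''"
  by (rule runs_two[where x = c]) (auto simp: sstep_def split: prod.split)

text \<open>The control states in which \<open>c\<close> is still active while \<open>cs\<close>
  waits behind it. A loop body is continued by the loop itself, so the set closes up without
  unfolding loops.\<close>

fun conts :: "'a tcom \<Rightarrow> 'a tcom list \<Rightarrow> 'a tcom list set" where
  "conts (Act g d) cs = {Act g d # cs}"
| "conts (TSeq x y) cs = insert (TSeq x y # cs) (conts x (y # cs) \<union> conts y cs)"
| "conts (TIf P x y) cs = insert (TIf P x y # cs) (conts x cs \<union> conts y cs)"
| "conts (TWhile P x) cs = insert (TWhile P x # cs) (conts x (TWhile P x # cs))"

fun wf_tcom :: "'a set \<Rightarrow> 'a tcom \<Rightarrow> bool" where
  "wf_tcom S (Act g d) \<longleftrightarrow> g ` S \<subseteq> S \<and> d \<in> {-1, 0, 1}"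
| "wf_tcom S (TSeq x y) \<longleftrightarrow> wf_tcom S x \<and> wf_tcom S y"
| "wf_tcom S (TIf P x y) \<longleftrightarrow> wf_tcom S x \<and> wf_tcom S y"
| "wf_tcom S (TWhile P x) \<longleftrightarrow> wf_tcom S x"

lemma finite_conts: "finite (conts c cs)"
  by (induction c arbitrary: cs) auto

lemma self_in_conts: "c # cs \<in> conts c cs"
  by (cases c) auto

lemma conts_closed:
  "q \<in> conts c cs \<Longrightarrow> fst (tstep q a) \<in> insert cs (conts c cs)"
proof (induction c arbitrary: cs)
  case (Act g d)
  then show ?case by simp
next
  case (TSeq x y)
  then show ?case using self_in_conts[of x "y # cs"] self_in_conts[of y cs] by fastforce
next
  case (TIf P x y)
  then show ?case using self_in_conts[of x cs] self_in_conts[of y cs] by (auto split: if_splits)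
next
  case (TWhile P x)
  then show ?case using self_in_conts[of x "TWhile P x # cs"] by fastforce
qed

lemma conts_wf:
  "q \<in> conts c cs \<Longrightarrow> wf_tcom S c \<Longrightarrow> list_all (wf_tcom S) cs \<Longrightarrow> list_all (wf_tcom S) q"
  by (induction c arbitrary: cs) fastforce+

lemma tstep_wf:
  assumes "list_all (wf_tcom S) q" "a \<in> S" "tstep q a = (q', a', d)"
  shows "a' \<in> S \<and> d \<in> {-1, 0, 1}"
  using assms by (cases "(q, a)" rule: tstep.cases) auto

text \<open>The machine model prescribes the numbers of the start state, the halting state, the
  blank and the two bits. Listing these elements first as \<open>xs\<close> gives them exactly those
  numbers.\<close>

lemma obtain_numbering:
  assumes "finite A" "set xs \<subseteq> A" "distinct xs"
  obtains e :: "'b \<Rightarrow> nat" and u :: "nat \<Rightarrow> 'b"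
  where "\<And>x. x \<in> A \<Longrightarrow> u (e x) = x" "\<And>x. x \<in> A \<Longrightarrow> e x < card A"
    "\<And>i. i < card A \<Longrightarrow> u i \<in> A" "\<And>i. i < length xs \<Longrightarrow> e (xs ! i) = i"
proof -
  obtain ys where ys: "set ys = A - set xs" "distinct ys"
    using finite_distinct_list[of "A - set xs"] assms by auto
  define zs where "zs = xs @ ys"
  have zs: "set zs = A" "distinct zs"
    using ys assms by (auto simp: zs_def)
  then have card: "card A = length zs"
    using distinct_card by metis
  define e where "e x = (THE i. i < length zs \<and> zs ! i = x)" for x
  have e: "e (zs ! i) = i" if "i < length zs" for i
    unfolding e_def using that zs(2) by (auto simp: nth_eq_iff_index_eq)
  show thesis
  proof (rule that[of "\<lambda>i. zs ! i" e])
    show "zs ! e x = x" if "x \<in> A" for x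
      using that zs(1) e by (metis in_set_conv_nth)
    show "e x < card A" if "x \<in> A" for x
      using that zs(1) card e by (metis in_set_conv_nth)
    show "zs ! i \<in> A" if "i < card A" for i
      using that zs(1) card by auto
    show "e (xs ! i) = i" if "i < length xs" for i
      using e[of i] that by (simp add: zs_def nth_append)
  qed
qed

definition word_tape :: "'a \<Rightarrow> (bool \<Rightarrow> 'a) \<Rightarrow> bool list \<Rightarrow> int \<Rightarrow> 'a" where
  "word_tape bl sy w i = (if 0 \<le> i \<and> i < int (length w) then sy (w ! nat i) else bl)"

text \<open>One \<open>tstep\<close> becomes one machine transition, with program stacks as states
  and cells as symbols, so the time bound carries over unchanged. Finiteness comes from
  \<open>conts\<close> for the states and from \<open>S\<close> for the symbols.\<close>

lemma poly_time_computable_tcom: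
  fixes c :: "'a tcom" and sy :: "bool \<Rightarrow> 'a"
  assumes fin: "finite S" and S: "bl \<in> S" "sy False \<in> S" "sy True \<in> S"
    and dist: "distinct [bl, sy False, sy True]"
    and wf: "wf_tcom S c"
    and run: "\<And>w. \<exists>t h. runs c (word_tape bl sy w, 0) (C * length w ^ D + C) (t, h) \<and>
                (\<forall>i<length (f w). t (h + int i) = sy (f w ! i)) \<and> t (h + int (length (f w))) = bl"
  shows "poly_time_computable f"
proof -
  define Q where "Q = insert [] (conts c [])"
  have "finite Q" "set [[c], []] \<subseteq> Q" "distinct [[c], []]"
    by (auto simp: Q_def finite_conts self_in_conts)
  then obtain e u where e: "\<And>x. x \<in> Q \<Longrightarrow> u (e x) = x" "\<And>x. x \<in> Q \<Longrightarrow> e x < card Q"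
    "\<And>i. i < card Q \<Longrightarrow> u i \<in> Q" "\<And>i. i < length [[c], []] \<Longrightarrow> e ([[c], []] ! i) = i"
    using obtain_numbering by (metis (no_types, lifting))
  have "set [bl, sy False, sy True] \<subseteq> S" using S by auto
  then obtain b v where b: "\<And>x. x \<in> S \<Longrightarrow> v (b x) = x" "\<And>x. x \<in> S \<Longrightarrow> b x < card S"
    "\<And>i. i < card S \<Longrightarrow> v i \<in> S"
    "\<And>i. i < length [bl, sy False, sy True] \<Longrightarrow> b ([bl, sy False, sy True] ! i) = i"
    using obtain_numbering[OF fin _ dist] by metis
  have e01: "e [c] = 0" "e [] = 1" using e(4)[of 0] e(4)[of 1] by auto
  have b012: "b bl = 0" "b (sy x) = bit_sym x" for x
    using b(4)[of 0] b(4)[of 1] b(4)[of 2] by (auto simp: bit_sym_def)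
  \<comment> \<open>The machine stops exactly in state 1, so no stack but the empty one may have
    this number.\<close>
  have e1: "e q = 1 \<longleftrightarrow> q = []" if "q \<in> Q" for q
    using e(1)[OF that] e(1)[of "[]"] e01 by (auto simp: Q_def)
  define \<delta> where "\<delta> q a = (case tstep (u q) (v a) of (q', a', d) \<Rightarrow> (e q', b a', d))" for q a
  define M where "M = (card Q, card S, \<delta>)"
  have transQ: "q' \<in> Q \<and> a' \<in> S \<and> d \<in> {-1, 0, 1}"
    if "q \<in> Q" "a \<in> S" "tstep q a = (q', a', d)" for q a q' a' d
  proof -
    have "q' \<in> Q"
      using that conts_closed[of q c "[]" a] by (auto simp: Q_def)
    moreover have "list_all (wf_tcom S) q"
      using that conts_wf[of q c "[]" S] wf by (auto simp: Q_def)
    ultimately show ?thesis using tstep_wf that by metis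
  qed
  have "card {[c], []} \<le> card Q"
    by (rule card_mono) (use \<open>finite Q\<close> \<open>set [[c], []] \<subseteq> Q\<close> in auto)
  moreover have "card {bl, sy False, sy True} \<le> card S"
    by (rule card_mono) (use fin S in auto)
  ultimately have card: "2 \<le> card Q" "3 \<le> card S"
    using dist by auto
  have "wf_tm M"
    unfolding wf_tm_def M_def
    using card transQ[OF e(3) b(3)] e(2) b(2) by (fastforce simp: \<delta>_def split: prod.splits)
  moreover have "computes_in_time M f (\<lambda>n. C * n ^ D + C)"
    unfolding computes_in_time_def
  proof
    fix w
    obtain t h k where k: "k \<le> C * length w ^ D + C"
      "(sstep ^^ k) ([c], word_tape bl sy w, 0) = ([], t, h)"
      and out: "\<forall>i<length (f w). t (h + int i) = sy (f w ! i)" "t (h + int (length (f w))) = bl"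
      using run[of w] unfolding runs_def by blast
    define nm where "nm = (\<lambda>(q, t, h). (e q, \<lambda>i. b (t i), h) :: config)"
    \<comment> \<open>The simulation is in lockstep even after halting: \<open>tstep\<close> on the
      empty stack changes nothing, like the machine in state 1.\<close>
    have sim: "(tm_step M ^^ j) (nm (q, t, h)) = nm ((sstep ^^ j) (q, t, h))"
      if "q \<in> Q" "range t \<subseteq> S" for j q t h
      using that
    proof (induction j arbitrary: q t h)
      case (Suc j)
      obtain q' a d where qa: "tstep q (t h) = (q', a, d)" by (metis prod_cases3)
      have th: "t h \<in> S" using Suc.prems by auto
      have *: "q' \<in> Q" "a \<in> S" using transQ[OF Suc.prems(1) th qa] by auto
      have "tm_step M (nm (q, t, h)) = nm (q', t(h := a), h + d)"
      proof (cases "q = []")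
        case True
        then show ?thesis using qa e01 by (auto simp: tm_step_def M_def nm_def)
      next
        case False
        then show ?thesis
          using qa e1[OF Suc.prems(1)] e(1)[OF Suc.prems(1)] b(1)[OF th]
          by (auto simp: tm_step_def M_def nm_def \<delta>_def)
      qed
      moreover have "sstep (q, t, h) = (q', t(h := a), h + d)"
        by (simp add: sstep_def qa)
      moreover have "range (t(h := a)) \<subseteq> S" using Suc.prems(2) * by auto
      ultimately show ?case
        using Suc.IH[of q' "t(h := a)" "h + d"] *
        by (simp only: funpow_Suc_right o_apply)
    qed simp
    have "nm ([c], word_tape bl sy w, 0) = tm_init w"
      by (auto simp: nm_def tm_init_def e01 b012 word_tape_def)
    moreover have "range (word_tape bl sy w) \<subseteq> S"
      using S by (auto simp: word_tape_def) (metis (full_types))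
    ultimately have "(tm_step M ^^ k) (tm_init w) = (1, \<lambda>i. b (t i), h)"
      using sim[of "[c]" "word_tape bl sy w" k 0] k(2) \<open>set [[c], []] \<subseteq> Q\<close>
      by (simp add: nm_def e01)
    moreover have "tape_output (\<lambda>i. b (t i)) h (f w)"
      using out by (simp add: tape_output_def b012)
    ultimately show "\<exists>k\<le>C * length w ^ D + C. case (tm_step M ^^ k) (tm_init w) of
        (q, t, h) \<Rightarrow> q = 1 \<and> tape_output t h (f w)"
      using k(1) by auto
  qed
  ultimately show ?thesis unfolding poly_time_computable_def by blast
qed

section \<open>Pointer programs\<close>

text \<open>The only loop runs once per input position, so termination and a polynomial number of
  operations hold by construction. Tests communicate through a single flag.\<close>

datatype com = Emit bool | Inc nat | Zero nat | SetF bool | TestBit nat | TestLess nat nat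
  | Seq com com | IfF com com | For nat com

type_synonym pstate = "(nat \<Rightarrow> nat) \<times> bool \<times> bool list"

text \<open>\<open>Inc\<close> saturates because a mark cannot pass the end cell, and after
  \<open>For r c\<close> the pointer \<open>r\<close> stands on the end cell, where the loop of the
  machine leaves it.\<close>

primrec exec :: "bool list \<Rightarrow> com \<Rightarrow> pstate \<Rightarrow> pstate" where
  "exec w (Emit b) = (\<lambda>(p, f, out). (p, f, out @ [b]))"
| "exec w (Inc r) = (\<lambda>(p, f, out). (p(r := min (length w) (Suc (p r))), f, out))"
| "exec w (Zero r) = (\<lambda>(p, f, out). (p(r := 0), f, out))"
| "exec w (SetF b) = (\<lambda>(p, f, out). (p, b, out))"
| "exec w (TestBit r) = (\<lambda>(p, f, out). (p, p r < length w \<and> w ! p r, out))"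
| "exec w (TestLess r s) = (\<lambda>(p, f, out). (p, p r < p s, out))"
| "exec w (Seq a b) = (\<lambda>s. exec w b (exec w a s))"
| "exec w (IfF a b) = (\<lambda>s. if fst (snd s) then exec w a s else exec w b s)"
| "exec w (For r c) = (\<lambda>s. case fold (\<lambda>i (p, f, out). exec w c (p(r := i), f, out)) [0..<length w] s of
     (p, f, out) \<Rightarrow> (p(r := length w), f, out))"

primrec modified :: "com \<Rightarrow> nat set" where
  "modified (Emit b) = {}"
| "modified (Inc r) = {r}"
| "modified (Zero r) = {r}"
| "modified (SetF b) = {}"
| "modified (TestBit r) = {}"
| "modified (TestLess r s) = {}"
| "modified (Seq a b) = modified a \<union> modified b"
| "modified (IfF a b) = modified a \<union> modified b"
| "modified (For r c) = insert r (modified c)"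

text \<open>Pointers 0 and 1 are read-only, since they mark the ends between which the head
  navigates. The body of \<open>For r\<close> must not modify \<open>r\<close>: the machine uses the
  mark of \<open>r\<close> as its loop counter, whereas \<open>exec\<close> sets it anew in each
  round.\<close>

primrec wf_com :: "nat \<Rightarrow> com \<Rightarrow> bool" where
  "wf_com K (Emit b) \<longleftrightarrow> True"
| "wf_com K (Inc r) \<longleftrightarrow> 2 \<le> r \<and> r < K"
| "wf_com K (Zero r) \<longleftrightarrow> 2 \<le> r \<and> r < K"
| "wf_com K (SetF b) \<longleftrightarrow> True"
| "wf_com K (TestBit r) \<longleftrightarrow> r < K"
| "wf_com K (TestLess r s) \<longleftrightarrow> r < K \<and> s < K"
| "wf_com K (Seq a b) \<longleftrightarrow> wf_com K a \<and> wf_com K b"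
| "wf_com K (IfF a b) \<longleftrightarrow> wf_com K a \<and> wf_com K b"
| "wf_com K (For r c) \<longleftrightarrow> 2 \<le> r \<and> r < K \<and> r \<notin> modified c \<and> wf_com K c"

text \<open>Counts sweeps of the head up to a constant factor. In a loop, 3 pays for resetting the
  counter, finding it and returning; the extra 1 per round pays for visiting and advancing it. As an
  emitted bit costs a unit, this also bounds the growth of the output.\<close>

primrec units :: "nat \<Rightarrow> com \<Rightarrow> nat" where
  "units n (Emit b) = 1"
| "units n (Inc r) = 1"
| "units n (Zero r) = 1"
| "units n (SetF b) = 1"
| "units n (TestBit r) = 1"
| "units n (TestLess r s) = 1"
| "units n (Seq a b) = 1 + units n a + units n b"
| "units n (IfF a b) = 1 + units n a + units n b"
| "units n (For r c) = 3 + n * (units n c + 1)"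

lemma exec_unmodified:
  "r \<notin> modified c \<Longrightarrow> fst (exec w c s) r = fst s r"
proof (induction c arbitrary: s)
  case (For x c)
  let ?F = "\<lambda>i (p, f, out). exec w c (p(x := i), f, out)"
  have F: "fst (?F i s) r = fst s r" for i s
    using For by (cases s) simp
  have "fst (fold ?F is s) r = fst s r" for "is"
    by (induction "is" arbitrary: s) (simp_all only: fold_simps F)
  from this[of "[0..<length w]"] For.prems show ?case by (auto split: prod.splits)
qed (auto split: prod.splits)

lemma fold_measure_le:
  fixes g :: "'s \<Rightarrow> nat"
  shows "(\<And>i s. g (F i s) \<le> g s + k) \<Longrightarrow> g (fold F is s) \<le> g s + length is * k"
proof (induction "is" arbitrary: s)
  case (Cons i "is")
  show ?case using Cons.IH[OF Cons.prems, of "F i s"] Cons.prems[of i s] by simp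
qed simp

lemma exec_output_length:
  "length (snd (snd (exec w c s))) \<le> length (snd (snd s)) + units (length w) c"
proof (induction c arbitrary: s)
  case (Seq a b)
  show ?case using Seq(1)[of s] Seq(2)[of "exec w a s"] by simp
next
  case (IfF a b)
  show ?case using IfF(1)[of s] IfF(2)[of s] by simp
next
  case (For x c)
  let ?F = "\<lambda>i (p, f, out). exec w c (p(x := i), f, out)"
  have F: "length (snd (snd (?F i s))) \<le> length (snd (snd s)) + units (length w) c" for i s
    using For[of "((fst s)(x := i), snd s)"] by (cases s) simp
  have "length (snd (snd (fold ?F is s))) \<le> length (snd (snd s)) + length is * units (length w) c" for "is"
    using F by (rule fold_measure_le)
  from this[of "[0..<length w]"] show ?case
    by (auto split: prod.splits)
qed (auto split: prod.splits)

text \<open>A cell carries an input or output bit together with the pointers standing on it.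
  Pointer 0 never leaves the first cell, pointer 1 never leaves the first cell after the input,
  and \<^term>\<open>K\<close>, which is not a pointer, marks the first cell iff the flag is set.
  The output is written behind pointer 1.\<close>

type_synonym cell = "bool option \<times> nat set"

definition ptape :: "nat \<Rightarrow> bool list \<Rightarrow> pstate \<Rightarrow> int \<Rightarrow> cell" where
  "ptape K w = (\<lambda>(p, f, out) i.
     if 0 \<le> i \<and> i \<le> int (length w)
     then (if i < int (length w) then Some (w ! nat i) else None,
           {r. r < K \<and> int (p r) = i} \<union> (if f \<and> i = 0 then {K} else {}))
     else if int (length w) < i \<and> i \<le> int (length w) + int (length out)
     then (Some (out ! nat (i - int (length w) - 1)), {})
     else (None, {}))"

definition pinv :: "nat \<Rightarrow> bool list \<Rightarrow> (nat \<Rightarrow> nat) \<Rightarrow> bool" where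
  "pinv K w p \<longleftrightarrow> p 0 = 0 \<and> p 1 = length w \<and> (\<forall>r<K. p r \<le> length w)"

definition unmark :: "nat \<Rightarrow> cell \<Rightarrow> cell" where "unmark r = (\<lambda>(x, S). (x, S - {r}))"
definition mark :: "nat \<Rightarrow> cell \<Rightarrow> cell" where "mark r = (\<lambda>(x, S). (x, insert r S))"

definition seek :: "nat set \<Rightarrow> cell tcom" where
  "seek R = TWhile (\<lambda>a. R \<inter> snd a = {}) (Act (\<lambda>a. a) 1)"
definition home :: "cell tcom" where
  "home = TWhile (\<lambda>a. 0 \<notin> snd a) (Act (\<lambda>a. a) (-1))"
definition put_flag :: "nat \<Rightarrow> bool \<Rightarrow> cell tcom" where
  "put_flag K b = Act (if b then mark K else unmark K) 0"

text \<open>Every command starts and ends with the head on cell 0, where also the flag is kept.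
  \<open>TestLess r s\<close> runs to the first cell with either pointer: p r < p s iff
  \<open>s\<close> is not there. The loop test is made on the mark of \<open>r\<close> and asks
  whether pointer 1 stands on the same cell.\<close>

primrec compile :: "nat \<Rightarrow> com \<Rightarrow> cell tcom" where
  "compile K (Emit b) = TSeq (seek {1}) (TSeq (Act (\<lambda>a. a) 1) (TSeq
     (TWhile (\<lambda>a. a \<noteq> (None, {})) (Act (\<lambda>a. a) 1)) (TSeq (Act (\<lambda>_. (Some b, {})) (-1)) home)))"
| "compile K (Inc r) = TSeq (seek {r}) (TSeq
     (TIf (\<lambda>a. 1 \<in> snd a) (Act (\<lambda>a. a) 0) (TSeq (Act (unmark r) 1) (Act (mark r) 0))) home)"
| "compile K (Zero r) = TSeq (seek {r}) (TSeq (Act (unmark r) 0) (TSeq home (Act (mark r) 0)))"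
| "compile K (SetF b) = put_flag K b"
| "compile K (TestBit r) = TSeq (seek {r}) (TIf (\<lambda>a. fst a = Some True)
     (TSeq home (put_flag K True)) (TSeq home (put_flag K False)))"
| "compile K (TestLess r s) = TSeq (seek {r, s}) (TIf (\<lambda>a. s \<notin> snd a)
     (TSeq home (put_flag K True)) (TSeq home (put_flag K False)))"
| "compile K (Seq a b) = TSeq (compile K a) (compile K b)"
| "compile K (IfF a b) = TIf (\<lambda>a. K \<in> snd a) (compile K a) (compile K b)"
| "compile K (For r c) = TSeq (TSeq (seek {r}) (TSeq (Act (unmark r) 0) (TSeq home (Act (mark r) 0))))
     (TSeq (seek {r}) (TSeq (TWhile (\<lambda>a. 1 \<notin> snd a) (TSeq home (TSeq (compile K c)
       (TSeq (seek {r}) (TSeq (Act (unmark r) 1) (Act (mark r) 0)))))) home))"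

text \<open>Each cell passed costs a test and a move, and the final failing test adds one
  step.\<close>

lemma runs_scan_right:
  "(\<And>j. j < k \<Longrightarrow> P (t (h + int j))) \<Longrightarrow> \<not> P (t (h + int k)) \<Longrightarrow>
   runs (TWhile P (Act (\<lambda>a. a) 1)) (t, h) (2 * k + 1) (t, h + int k)"
proof (induction k arbitrary: h)
  case 0
  then show ?case using runs_TWhile_False[of P t h] by simp
next
  case (Suc k)
  have 1: "P (t h)" using Suc.prems(1)[of 0] by simp
  have 2: "runs (Act (\<lambda>a. a) 1) (t, h) 1 (t, h + 1)" using runs_Act[of "\<lambda>a. a" 1 t h] by simp
  have 3: "runs (TWhile P (Act (\<lambda>a. a) 1)) (t, h + 1) (2 * k + 1) (t, h + 1 + int k)"
    using Suc.prems(2) Suc.prems(1)[of "Suc _"] by (intro Suc.IH) (auto simp: algebra_simps)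
  from runs_TWhile_True[OF 1 2 3] show ?case by (simp add: algebra_simps)
qed

lemma runs_scan_left:
  "(\<And>j. j < k \<Longrightarrow> P (t (h - int j))) \<Longrightarrow> \<not> P (t (h - int k)) \<Longrightarrow>
   runs (TWhile P (Act (\<lambda>a. a) (-1))) (t, h) (2 * k + 1) (t, h - int k)"
proof (induction k arbitrary: h)
  case 0
  then show ?case using runs_TWhile_False[of P t h] by simp
next
  case (Suc k)
  have 1: "P (t h)" using Suc.prems(1)[of 0] by simp
  have 2: "runs (Act (\<lambda>a. a) (-1)) (t, h) 1 (t, h - 1)" using runs_Act[of "\<lambda>a. a" "-1" t h] by simp
  have 3: "runs (TWhile P (Act (\<lambda>a. a) (-1))) (t, h - 1) (2 * k + 1) (t, h - 1 - int k)"
    using Suc.prems(2) Suc.prems(1)[of "Suc _"] by (intro Suc.IH) (auto simp: algebra_simps)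
  from runs_TWhile_True[OF 1 2 3] show ?case by (simp add: algebra_simps)
qed

lemma runs_seek:
  assumes "pinv K w p" "R \<noteq> {}" "R \<subseteq> {..<K}" "k = Min (p ` R)"
  shows "runs (seek R) (ptape K w (p, f, out), 0) (2 * length w + 1) (ptape K w (p, f, out), int k)"
proof -
  have fin: "finite R" using assms(3) finite_subset by blast
  then have k: "k \<in> p ` R" "\<And>r. r \<in> R \<Longrightarrow> k \<le> p r"
    using assms(2,4) by auto
  then have "k \<le> length w" using assms(1,3) by (auto simp: pinv_def)
  moreover have "runs (seek R) (ptape K w (p, f, out), 0) (2 * k + 1) (ptape K w (p, f, out), 0 + int k)"
    unfolding seek_def
  proof (rule runs_scan_right)
    show "R \<inter> snd (ptape K w (p, f, out) (0 + int j)) = {}" if "j < k" for j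
    proof -
      have "p r \<noteq> j" "r \<noteq> K" if "r \<in> R" for r
        using k(2)[OF that] \<open>j < k\<close> that assms(3) by auto
      then show ?thesis
        by (auto simp: ptape_def)
    qed
    show "\<not> R \<inter> snd (ptape K w (p, f, out) (0 + int k)) = {}"
      using k(1) assms(3) \<open>k \<le> length w\<close> by (auto simp: ptape_def)
  qed
  ultimately show ?thesis by (auto intro: runs_mono)
qed

lemma runs_home:
  assumes "t = ptape K w (p, f, out)" "p 0 = 0" "0 < K"
  shows "runs home (t, int k) (2 * k + 1) (t, 0)"
  using runs_scan_left[of k "\<lambda>a. 0 \<notin> snd a" "ptape K w (p, f, out)" "int k"] assms
  by (auto simp: home_def ptape_def)

lemma runs_home':
  assumes "t = ptape K w (p, f, out)" "p 0 = 0" "0 < K" "k \<le> int m" "0 \<le> k"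
  shows "runs home (t, k) (2 * m + 1) (t, 0)"
  using runs_home[OF assms(1-3), of "nat k"] assms(4,5) by (auto intro: runs_mono)

lemma runs_put_flag:
  assumes "t = ptape K w (p, f, out)" "p 0 = 0"
  shows "runs (put_flag K b) (t, 0) 1 (ptape K w (p, b, out), 0)"
proof -
  have "t(0 := (if b then mark K else unmark K) (t 0)) = ptape K w (p, b, out)"
    by (auto simp: assms ptape_def mark_def unmark_def fun_eq_iff)
  then show ?thesis
    using runs_Act[of "if b then mark K else unmark K" 0 t 0] by (simp add: put_flag_def)
qed

lemma ptape_advance:
  assumes "p r < length w" "r < K" "t = ptape K w (p, f, out)"
  shows "runs (TSeq (Act (unmark r) 1) (Act (mark r) 0)) (t, int (p r)) 3
    (ptape K w (p(r := Suc (p r)), f, out), int (Suc (p r)))"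
proof -
  let ?t1 = "t(int (p r) := unmark r (t (int (p r))))"
  have "?t1(int (p r) + 1 := mark r (?t1 (int (p r) + 1))) = ptape K w (p(r := Suc (p r)), f, out)"
    using assms by (auto simp: ptape_def mark_def unmark_def fun_eq_iff)
  then show ?thesis
    using runs_TSeq[OF runs_Act[of "unmark r" 1 t "int (p r)"]
        runs_Act[of "mark r" 0 ?t1 "int (p r) + 1"]]
    by (simp add: algebra_simps numeral_3_eq_3)
qed

lemma runs_Zero:
  assumes "pinv K w p" "2 \<le> r" "r < K"
  shows "runs (TSeq (seek {r}) (TSeq (Act (unmark r) 0) (TSeq home (Act (mark r) 0))))
    (ptape K w (p, f, out), 0) (4 * length w + 7) (ptape K w (p(r := 0), f, out), 0)"
proof -
  let ?t = "ptape K w (p, f, out)"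
  let ?t1 = "?t(int (p r) := unmark r (?t (int (p r))))"
  have pr: "p r \<le> length w" "p 0 = 0" using assms by (auto simp: pinv_def)
  have a: "runs (seek {r}) (?t, 0) (2 * length w + 1) (?t, int (p r))"
    by (rule runs_seek) (use assms in auto)
  have b: "runs (Act (unmark r) 0) (?t, int (p r)) 1 (?t1, int (p r))"
    using runs_Act[of "unmark r" 0 ?t "int (p r)"] by simp
  \<comment> \<open>While \<open>r\<close> is off the tape, \<open>?t1\<close> is no
    \<open>ptape\<close>, so the scan is done by hand instead of by
    \<open>runs_home\<close>.\<close>
  have c: "runs home (?t1, int (p r)) (2 * p r + 1) (?t1, 0)"
    using runs_scan_left[of "p r" "\<lambda>a. 0 \<notin> snd a" ?t1 "int (p r)"] assms pr
    by (auto simp: home_def ptape_def unmark_def)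
  have "?t1(0 := mark r (?t1 0)) = ptape K w (p(r := 0), f, out)"
    using pr assms by (auto simp: ptape_def mark_def unmark_def fun_eq_iff)
  then have d: "runs (Act (mark r) 0) (?t1, 0) 1 (ptape K w (p(r := 0), f, out), 0)"
    using runs_Act[of "mark r" 0 ?t1 0] by simp
  show ?thesis
    by (rule runs_mono[OF runs_TSeq[OF a runs_TSeq[OF b runs_TSeq[OF c d]]]]) (use pr in simp)
qed

text \<open>\<open>B\<close> bounds the used part of the tape throughout the run: the output grows
  by at most \<open>units\<close>, and \<open>exec_output_length\<close> passes the bound on to
  later subprograms. Each unit then consists of a few sweeps over at most \<open>B\<close> cells,
  which 8 B + 30 steps cover.\<close>

lemma runs_compile:
  assumes "wf_com K c" "2 \<le> K" "pinv K w p" "length w + length out + units (length w) c \<le> B"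
    "exec w c (p, f, out) = (p', f', out')"
  shows "pinv K w p' \<and> runs (compile K c) (ptape K w (p, f, out), 0)
    (units (length w) c * (8 * B + 30)) (ptape K w (p', f', out'), 0)"
  using assms
proof (induction c arbitrary: p f out p' f' out')
  case (Emit b)
  let ?t = "ptape K w (p, f, out)" and ?n = "length w"
  have inv: "p 0 = 0" "p 1 = ?n" using Emit.prems by (auto simp: pinv_def)
  have a: "runs (seek {1}) (?t, 0) (2 * ?n + 1) (?t, int ?n)"
    by (rule runs_seek) (use Emit.prems in \<open>auto simp: pinv_def\<close>)
  have b: "runs (Act (\<lambda>a. a) 1) (?t, int ?n) 1 (?t, int ?n + 1)"
    using runs_Act[of "\<lambda>a. a" 1 ?t "int ?n"] by simp
  have c: "runs (TWhile (\<lambda>a. a \<noteq> (None, {})) (Act (\<lambda>a. a) 1)) (?t, int ?n + 1) (2 * length out + 1)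
     (?t, int ?n + 1 + int (length out))"
    by (rule runs_scan_right) (auto simp: ptape_def)
  have "?t(int ?n + 1 + int (length out) := (Some b, {})) = ptape K w (p, f, out @ [b])"
    by (auto simp: ptape_def fun_eq_iff nth_append nat_eq_iff)
  then have d: "runs (Act (\<lambda>_. (Some b, {})) (-1)) (?t, int ?n + 1 + int (length out)) 1
      (ptape K w (p, f, out @ [b]), int ?n + int (length out))"
    using runs_Act[of "\<lambda>_. (Some b, {})" "-1" ?t "int ?n + 1 + int (length out)"] by simp
  have e: "runs home (ptape K w (p, f, out @ [b]), int ?n + int (length out))
      (2 * (?n + length out) + 1) (ptape K w (p, f, out @ [b]), 0)"
    by (rule runs_home'[OF refl]) (use inv Emit.prems in auto)
  show ?case
    using Emit.prems runs_mono[OF runs_TSeq[OF a runs_TSeq[OF b runs_TSeq[OF c runs_TSeq[OF d e]]]], of "8 * B + 30"]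
    by auto
next
  case (Inc r)
  let ?t = "ptape K w (p, f, out)" and ?n = "length w"
  have inv: "p 0 = 0" "p 1 = ?n" "p r \<le> ?n" using Inc.prems by (auto simp: pinv_def)
  have p': "p' = p(r := min ?n (Suc (p r)))" "f' = f" "out' = out" using Inc.prems by auto
  have pinv: "pinv K w p'" using Inc.prems p' by (auto simp: pinv_def)
  have a: "runs (seek {r}) (?t, 0) (2 * ?n + 1) (?t, int (p r))"
    by (rule runs_seek) (use Inc.prems in auto)
  have one: "1 \<in> snd (?t (int (p r))) \<longleftrightarrow> p r = ?n"
    using inv Inc.prems by (auto simp: ptape_def)
  have b: "runs (if 1 \<in> snd (?t (int (p r))) then Act (\<lambda>a. a) 0 else TSeq (Act (unmark r) 1) (Act (mark r) 0))
     (?t, int (p r)) 3 (ptape K w (p', f', out'), int (p' r))"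
  proof (cases "p r = ?n")
    case True
    then have "p' = p" using p' by auto
    with True one show ?thesis
      using runs_mono[OF runs_Act[of "\<lambda>a. a" 0 ?t "int (p r)"], of 3] p' by auto
  next
    case False
    then have "p' = p(r := Suc (p r))" using p' inv by auto
    with False one show ?thesis
      using ptape_advance[of p r w K ?t f out] Inc.prems inv p' by auto
  qed
  have c: "runs home (ptape K w (p', f', out'), int (p' r)) (2 * ?n + 1) (ptape K w (p', f', out'), 0)"
    by (rule runs_home'[OF refl]) (use pinv Inc.prems in \<open>auto simp: pinv_def\<close>)
  show ?case
    using pinv runs_mono[OF runs_TSeq[OF a runs_TSeq[OF runs_TIf[where P = "\<lambda>a. 1 \<in> snd a", OF b] c]], of "8 * B + 30"] Inc.prems
    by auto
next
  case (Zero r)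
  then show ?case
    using runs_mono[OF runs_Zero[of K w p r f out], of "8 * B + 30"] by (auto simp: pinv_def)
next
  case (SetF b)
  then show ?case
    using runs_mono[OF runs_put_flag[OF refl, where p = p and K = K and w = w and f = f and out = out and b = b], of "8 * B + 30"]
    by (auto simp: pinv_def)
next
  case (TestBit r)
  let ?t = "ptape K w (p, f, out)" and ?n = "length w"
  have inv: "p 0 = 0" "p 1 = ?n" "p r \<le> ?n" using TestBit.prems by (auto simp: pinv_def)
  have a: "runs (seek {r}) (?t, 0) (2 * ?n + 1) (?t, int (p r))"
    by (rule runs_seek) (use TestBit.prems in auto)
  have b: "runs home (?t, int (p r)) (2 * ?n + 1) (?t, 0)"
    by (rule runs_home'[OF refl]) (use inv TestBit.prems in auto)
  have "fst (?t (int (p r))) = Some True \<longleftrightarrow> f'"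
    using TestBit.prems inv by (auto simp: ptape_def)
  then have c: "runs (if fst (?t (int (p r))) = Some True
        then TSeq home (put_flag K True) else TSeq home (put_flag K False))
     (?t, int (p r)) (2 * ?n + 3) (ptape K w (p, f', out), 0)"
    using runs_TSeq[OF b runs_put_flag[where p = p and K = K and w = w and f = f and out = out and b = f', OF refl inv(1)]]
    by (cases f') (auto simp: numeral_3_eq_3)
  show ?case
    using TestBit.prems runs_mono[OF runs_TSeq[OF a runs_TIf[where P = "\<lambda>a. fst a = Some True", OF c]], of "8 * B + 30"]
    by auto
next
  case (TestLess r s)
  let ?t = "ptape K w (p, f, out)" and ?n = "length w"
  have inv: "p 0 = 0" "p 1 = ?n" "p r \<le> ?n" "p s \<le> ?n" using TestLess.prems by (auto simp: pinv_def)
  have a: "runs (seek {r, s}) (?t, 0) (2 * ?n + 1) (?t, int (min (p r) (p s)))"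
    by (rule runs_seek) (use TestLess.prems in auto)
  have b: "runs home (?t, int (min (p r) (p s))) (2 * ?n + 1) (?t, 0)"
    by (rule runs_home'[OF refl]) (use inv TestLess.prems in auto)
  have "s \<notin> snd (?t (int (min (p r) (p s)))) \<longleftrightarrow> f'"
    using TestLess.prems inv by (auto simp: ptape_def)
  then have c: "runs (if s \<notin> snd (?t (int (min (p r) (p s))))
        then TSeq home (put_flag K True) else TSeq home (put_flag K False))
     (?t, int (min (p r) (p s))) (2 * ?n + 3) (ptape K w (p, f', out), 0)"
    using runs_TSeq[OF b runs_put_flag[where p = p and K = K and w = w and f = f and out = out and b = f', OF refl inv(1)]]
    by (cases f') (auto simp: numeral_3_eq_3)
  show ?case
    using TestLess.prems runs_mono[OF runs_TSeq[OF a runs_TIf[where P = "\<lambda>a. s \<notin> snd a", OF c]], of "8 * B + 30"]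
    by auto
next
  case (Seq a b)
  obtain p1 f1 o1 where 1: "exec w a (p, f, out) = (p1, f1, o1)" by (metis prod_cases3)
  have 2: "pinv K w p1 \<and> runs (compile K a) (ptape K w (p, f, out), 0)
      (units (length w) a * (8 * B + 30)) (ptape K w (p1, f1, o1), 0)"
    using Seq.prems 1 by (intro Seq.IH(1)) auto
  have 3: "pinv K w p' \<and> runs (compile K b) (ptape K w (p1, f1, o1), 0)
      (units (length w) b * (8 * B + 30)) (ptape K w (p', f', out'), 0)"
    using Seq.prems 1 2 exec_output_length[of w a "(p, f, out)"] by (intro Seq.IH(2)) auto
  show ?case
    unfolding compile.simps using 3
    by (intro conjI runs_mono[OF runs_TSeq[OF conjunct2[OF 2] conjunct2[OF 3]]])
      (simp_all add: algebra_simps)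
next
  case (IfF a b)
  let ?t = "ptape K w (p, f, out)" and ?c = "if f then a else b"
  have K: "K \<in> snd (?t 0) \<longleftrightarrow> f"
    using IfF.prems by (auto simp: ptape_def)
  have "pinv K w p' \<and> runs (compile K ?c) (?t, 0) (units (length w) ?c * (8 * B + 30))
      (ptape K w (p', f', out'), 0)"
    using IfF.prems IfF.IH(1)[of p out f p' f' out'] IfF.IH(2)[of p out f p' f' out']
    by (cases f) simp_all
  then have "runs (if K \<in> snd (?t 0) then compile K a else compile K b) (?t, 0)
      ((units (length w) a + units (length w) b) * (8 * B + 30)) (ptape K w (p', f', out'), 0)"
    "pinv K w p'"
    using K by (cases f; simp add: runs_mono)+
  then show ?case
    unfolding compile.simps
    by (intro conjI runs_mono[OF runs_TIf[where P = "\<lambda>a. K \<in> snd a"]])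
      (simp_all only: units.simps add_mult_distrib mult_1, linarith)
next
  case (For r c)
  let ?n = "length w" and ?F = "\<lambda>i (p, f, out). exec w c (p(r := i), f, out)"
  let ?body = "TSeq home (TSeq (compile K c) (TSeq (seek {r}) (TSeq (Act (unmark r) 1) (Act (mark r) 0))))"
  let ?loop = "TWhile (\<lambda>a. 1 \<notin> snd a) ?body"
  let ?k = "units ?n c + 1"
  have r: "2 \<le> r" "r < K" "r \<notin> modified c" "wf_com K c" using For.prems by auto
  \<comment> \<open>Induction on the number \<open>m\<close> of rounds left, with the head on the
    counter at position n - m. The tape shows \<open>r\<close> overwritten, because each round of
    \<open>exec\<close> discards the value of \<open>r\<close> in its state.\<close>
  have loop: "pinv K w p' \<and> runs ?loop (ptape K w (p(r := ?n - m), f, out), int (?n - m))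
      (1 + m * (?k * (8 * B + 30))) (ptape K w (p'(r := ?n), f', out'), int ?n)"
    if "m \<le> ?n" "fold ?F [?n - m..<?n] (p, f, out) = (p', f', out')"
      "pinv K w p" "?n + length out + m * units ?n c \<le> B"
    for m p f out p' f' out'
    using that
  proof (induction m arbitrary: p f out)
    case 0
    have "\<not> 1 \<notin> snd (ptape K w (p(r := ?n), f, out) (int ?n))"
      using 0 r by (auto simp: ptape_def pinv_def)
    moreover have "p' = p" "f' = f" "out' = out" using 0 by auto
    ultimately show ?case
      unfolding diff_zero mult_0 add_0_right using 0(3) by (blast intro: runs_TWhile_False)
  next
    case (Suc m)
    define i where "i = ?n - Suc m"
    have i: "i < ?n" "Suc i = ?n - m" using Suc.prems(1) by (auto simp: i_def)
    let ?p = "p(r := i)"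
    let ?t = "ptape K w (?p, f, out)"
    obtain p1 f1 o1 where 1: "exec w c (?p, f, out) = (p1, f1, o1)" by (metis prod_cases3)
    have inv: "pinv K w ?p" using Suc.prems(3) r i by (auto simp: pinv_def)
    have "[i..<?n] = i # [Suc i..<?n]" using i by (simp add: upt_conv_Cons)
    then have f1: "fold ?F [?n - m..<?n] (p1, f1, o1) = (p', f', out')"
      using Suc.prems(2) unfolding i_def[symmetric] i(2)[symmetric]
      by (simp only: fold_simps prod.case 1)
    have step: "pinv K w p1 \<and> runs (compile K c) (?t, 0) (units ?n c * (8 * B + 30))
        (ptape K w (p1, f1, o1), 0)"
      by (rule For.IH[OF r(4) \<open>2 \<le> K\<close> inv _ 1]) (use Suc.prems(4) in simp)
    \<comment> \<open>Since the body leaves \<open>r\<close> alone, its mark is still at position i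
      and can be advanced to the value that \<open>exec\<close> prescribes.\<close>
    have p1r: "p1 r = i" using exec_unmodified[OF r(3), of w "(?p, f, out)"] 1 by simp
    have IH: "pinv K w p' \<and> runs ?loop (ptape K w (p1(r := Suc i), f1, o1), int (Suc i))
      (1 + m * (?k * (8 * B + 30))) (ptape K w (p'(r := ?n), f', out'), int ?n)"
      unfolding i(2)
      by (rule Suc.IH[OF _ f1 conjunct1[OF step]]) (use Suc.prems(1,4) exec_output_length[of w c "(?p, f, out)"] 1 in auto)
    have a: "runs home (?t, int i) (2 * ?n + 1) (?t, 0)"
      by (rule runs_home'[OF refl]) (use inv r i in \<open>auto simp: pinv_def\<close>)
    have b: "runs (seek {r}) (ptape K w (p1, f1, o1), 0) (2 * ?n + 1) (ptape K w (p1, f1, o1), int i)"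
      by (rule runs_seek) (use step r p1r in auto)
    have c: "runs (TSeq (Act (unmark r) 1) (Act (mark r) 0)) (ptape K w (p1, f1, o1), int i) 3
        (ptape K w (p1(r := Suc i), f1, o1), int (Suc i))"
      using ptape_advance[of p1 r w K _ f1 o1, OF _ _ refl] p1r i r by simp
    have d: "runs ?body (?t, int i) (units ?n c * (8 * B + 30) + 4 * ?n + 8)
        (ptape K w (p1(r := Suc i), f1, o1), int (Suc i))"
      by (rule runs_mono[OF runs_TSeq[OF a runs_TSeq[OF conjunct2[OF step] runs_TSeq[OF b c]]]]) simp
    have "1 \<notin> snd (?t (int i))"
      using inv r i by (auto simp: ptape_def pinv_def)
    from runs_TWhile_True[where P = "\<lambda>a. 1 \<notin> snd a", OF this d conjunct2[OF IH]]
    have "runs ?loop (?t, int i) (1 + Suc m * (?k * (8 * B + 30))) (ptape K w (p'(r := ?n), f', out'), int ?n)"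
      by (rule runs_mono) (use Suc.prems(4) in \<open>simp add: algebra_simps\<close>)
    then show ?case using IH unfolding i_def by blast
  qed
  obtain p1 where 1: "fold ?F [0..<?n] (p, f, out) = (p1, f', out')" "p' = p1(r := ?n)"
    using For.prems(5) by (auto split: prod.splits)
  have l: "pinv K w p1 \<and> runs ?loop (ptape K w (p(r := 0), f, out), 0)
      (1 + ?n * (?k * (8 * B + 30))) (ptape K w (p', f', out'), int ?n)"
    using loop[of ?n p f out p1 f' out'] 1 For.prems(3,4) by (simp add: algebra_simps)
  have inv: "pinv K w p'" using l 1 r by (auto simp: pinv_def)
  have s: "runs (seek {r}) (ptape K w (p(r := 0), f, out), 0) (2 * ?n + 1) (ptape K w (p(r := 0), f, out), int 0)"
    by (rule runs_seek) (use For.prems(3) r in \<open>auto simp: pinv_def\<close>)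
  have h: "runs home (ptape K w (p', f', out'), int ?n) (2 * ?n + 1) (ptape K w (p', f', out'), 0)"
    by (rule runs_home'[OF refl]) (use inv r in \<open>auto simp: pinv_def\<close>)
  have "runs (compile K (For r c)) (ptape K w (p, f, out), 0)
    (units (length w) (For r c) * (8 * B + 30)) (ptape K w (p', f', out'), 0)"
    unfolding compile.simps
    by (rule runs_mono[OF runs_TSeq[OF runs_Zero[OF For.prems(3) r(1,2)]
          runs_TSeq[OF s[simplified] runs_TSeq[OF conjunct2[OF l] h]]]])
      (use For.prems(4) in \<open>simp add: algebra_simps\<close>)
  with inv show ?case by blast
qed

section \<open>Polynomially bounded functions\<close>

definition poly_bounded :: "(nat \<Rightarrow> nat) \<Rightarrow> bool" where
  "poly_bounded f \<longleftrightarrow> (\<exists>c d. \<forall>n. f n \<le> c * (n + 1) ^ d)"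

lemma poly_bounded_const: "poly_bounded (\<lambda>n. c)"
  unfolding poly_bounded_def by (rule exI[of _ c], rule exI[of _ 0]) simp

lemma poly_bounded_id: "poly_bounded (\<lambda>n. n)"
  unfolding poly_bounded_def by (rule exI[of _ 1], rule exI[of _ 1]) simp

lemma poly_bounded_add:
  assumes "poly_bounded f" "poly_bounded g"
  shows "poly_bounded (\<lambda>n. f n + g n)"
proof -
  obtain c d c' d' where 1: "\<And>n. f n \<le> c * (n + 1) ^ d" "\<And>n. g n \<le> c' * (n + 1) ^ d'"
    using assms unfolding poly_bounded_def by blast
  have "f n + g n \<le> (c + c') * (n + 1) ^ (d + d')" for n
  proof -
    have "c * (n + 1) ^ d \<le> c * (n + 1) ^ (d + d')" "c' * (n + 1) ^ d' \<le> c' * (n + 1) ^ (d + d')"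
      by (intro mult_le_mono2 power_increasing; simp)+
    with 1[of n] show ?thesis by (simp only: add_mult_distrib)
  qed
  then show ?thesis unfolding poly_bounded_def by blast
qed

lemma poly_bounded_mult:
  assumes "poly_bounded f" "poly_bounded g"
  shows "poly_bounded (\<lambda>n. f n * g n)"
proof -
  obtain c d c' d' where 1: "\<And>n. f n \<le> c * (n + 1) ^ d" "\<And>n. g n \<le> c' * (n + 1) ^ d'"
    using assms unfolding poly_bounded_def by blast
  have "f n * g n \<le> (c * c') * (n + 1) ^ (d + d')" for n
    using mult_le_mono[OF 1(1)[of n] 1(2)[of n]] by (simp only: power_add ac_simps)
  then show ?thesis unfolding poly_bounded_def by blast
qed

lemmas poly_bounded_intros = poly_bounded_const poly_bounded_id poly_bounded_add poly_bounded_mult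

text \<open>The form with n + 1 is closed under sums and products. For n > 0 it passes to the
  required form by (n + 1)^d \<le> 2^d n^d; the additive constant covers n = 0.\<close>

lemma poly_boundedD:
  assumes "poly_bounded f"
  shows "\<exists>c d. \<forall>n. f n \<le> c * n ^ d + c"
proof -
  obtain c d where f: "\<And>n. f n \<le> c * (n + 1) ^ d"
    using assms unfolding poly_bounded_def by blast
  have "f n \<le> (c * 2 ^ d) * n ^ d + c * 2 ^ d" for n
  proof (cases "n = 0")
    case True
    then show ?thesis using f[of 0] by (simp add: le_trans trans_le_add2)
  next
    case False
    then have "(n + 1) ^ d \<le> (2 * n) ^ d" by (intro power_mono) auto
    then have "c * (n + 1) ^ d \<le> (c * 2 ^ d) * n ^ d" by (simp add: power_mult_distrib)
    with f[of n] show ?thesis by linarith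
  qed
  then show ?thesis by blast
qed

lemma poly_bounded_units: "poly_bounded (\<lambda>n. units n c)"
  by (induction c) (simp_all only: units.simps poly_bounded_intros)

lemma wf_tcom_compile:
  "wf_com K c \<Longrightarrow> 2 \<le> K \<Longrightarrow> wf_tcom (UNIV \<times> Pow {..K}) (compile K c)"
  by (induction c) (auto simp: seek_def home_def put_flag_def mark_def unmark_def)

theorem poly_time_computable_com:
  assumes wf: "wf_com K c" "2 \<le> K"
    and f: "\<And>w. f w = snd (snd (exec w c (\<lambda>r. if r = 1 then length w else 0, False, [])))"
  shows "poly_time_computable f"
proof -
  define S :: "cell set" where "S = UNIV \<times> Pow {..K}"
  \<comment> \<open>All pointers but 1 start on cell 0, and leaving out \<open>K\<close> makes the
    flag False. The first blank cell is the end of the input and receives pointer 1.\<close>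
  define start :: "cell tcom" where "start =
    TSeq (Act (\<lambda>(x, S). (x, {..<K} - {1})) 0) (TSeq (TWhile (\<lambda>a. fst a \<noteq> None) (Act (\<lambda>a. a) 1))
      (TSeq (Act (mark 1) 0) home))"
  define finish :: "cell tcom" where "finish = TSeq (seek {1}) (Act (\<lambda>a. a) 1)"
  define prog where "prog = TSeq start (TSeq (compile K c) finish)"
  \<comment> \<open>As the output starts empty, \<open>runs_compile\<close> is applied with B = n +
    units n c. The linear rest pays for \<open>start\<close> and \<open>finish\<close>.\<close>
  define cost where "cost n = units n c * (8 * (n + units n c) + 30) + 6 * n + 20" for n
  have "poly_bounded cost"
    unfolding cost_def by (intro poly_bounded_intros poly_bounded_units)
  then obtain C D where CD: "\<And>n. cost n \<le> C * n ^ D + C"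
    using poly_boundedD by blast
  have S: "finite S" "(None, {}) \<in> S" "\<And>b. (Some b, {}) \<in> S"
    by (auto simp: S_def finite_UNIV)
  have "wf_tcom S start" "wf_tcom S finish"
    using wf(2) by (auto simp: S_def start_def finish_def home_def seek_def mark_def)
  then have "wf_tcom S prog"
    using wf_tcom_compile[OF wf] by (simp add: prog_def S_def)
  moreover have "\<exists>t h. runs prog (word_tape (None, {}) (\<lambda>b. (Some b, {})) w, 0) (C * length w ^ D + C) (t, h) \<and>
        (\<forall>i<length (f w). t (h + int i) = (Some (f w ! i), {})) \<and> t (h + int (length (f w))) = (None, {})"
    for w
  proof -
    let ?n = "length w"
    let ?p = "\<lambda>r. if r = 1 then ?n else 0"
    obtain p' f' out where ex: "exec w c (?p, False, []) = (p', f', out)" by (metis prod_cases3)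
    let ?start = "word_tape (None, {}) (\<lambda>b. (Some b, {})) w :: int \<Rightarrow> cell"
    let ?t1 = "?start(0 := (fst (?start 0), {..<K} - {1}))"
    let ?t2 = "?t1(int ?n := mark 1 (?t1 (int ?n)))"
    have inv: "pinv K w ?p" by (simp add: pinv_def)
    have a: "runs (Act (\<lambda>(x, S). (x, {..<K} - {1})) 0) (?start, 0) 1 (?t1, 0)"
      using runs_Act[of "\<lambda>(x, S). (x, {..<K} - {1})" 0 ?start 0] by (simp add: case_prod_unfold)
    have b: "runs (TWhile (\<lambda>a. fst a \<noteq> None) (Act (\<lambda>a. a) 1)) (?t1, 0) (2 * ?n + 1) (?t1, 0 + int ?n)"
      by (rule runs_scan_right) (auto simp: word_tape_def)
    have c: "runs (Act (mark 1) 0) (?t1, 0 + int ?n) 1 (?t2, int ?n)"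
      using runs_Act[of "mark 1" 0 ?t1 "int ?n"] by simp
    have t2: "?t2 = ptape K w (?p, False, [])"
      using wf(2) by (auto simp: ptape_def word_tape_def mark_def fun_eq_iff)
    have d: "runs home (?t2, int ?n) (2 * ?n + 1) (?t2, 0)"
      by (rule runs_home[OF t2]) (use wf(2) in auto)
    have start: "runs start (?start, 0) (4 * ?n + 7) (ptape K w (?p, False, []), 0)"
      unfolding start_def t2[symmetric]
      by (rule runs_mono[OF runs_TSeq[OF a runs_TSeq[OF b runs_TSeq[OF c d]]]]) simp
    have main: "pinv K w p' \<and> runs (compile K c) (ptape K w (?p, False, []), 0)
        (units ?n c * (8 * (?n + units ?n c) + 30)) (ptape K w (p', f', out), 0)"
      by (rule runs_compile) (use wf inv ex in auto)
    let ?t = "ptape K w (p', f', out)"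
    have e: "runs (seek {1}) (?t, 0) (2 * ?n + 1) (?t, int ?n)"
      by (rule runs_seek) (use main wf(2) in \<open>auto simp: pinv_def\<close>)
    have finish: "runs finish (?t, 0) (2 * ?n + 3) (?t, int ?n + 1)"
      unfolding finish_def
      using runs_mono[OF runs_TSeq[OF e runs_Act[of "\<lambda>a. a" 1]], of "2 * ?n + 3"] by simp
    have "runs prog (?start, 0) (C * ?n ^ D + C) (?t, int ?n + 1)"
      unfolding prog_def
      by (rule runs_mono[OF runs_TSeq[OF start runs_TSeq[OF conjunct2[OF main] finish]]])
        (use CD[of ?n] in \<open>simp add: cost_def\<close>)
    moreover have "f w = out" using f[of w] ex by simp
    moreover have "?t (int ?n + 1 + int i) = (Some (out ! i), {})" if "i < length out" for i
      using that by (auto simp: ptape_def)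
    moreover have "?t (int ?n + 1 + int (length out)) = (None, {})"
      by (auto simp: ptape_def)
    ultimately show ?thesis by blast
  qed
  ultimately show ?thesis
    using S by (intro poly_time_computable_tcom[where S = S and c = prog and bl = "(None, {})"
        and sy = "\<lambda>b. (Some b, {})"]) auto
qed

section \<open>First-order queries over the input word\<close>

lemma exec_For_invariant:
  assumes "I 0 s"
    and "\<And>i p f out. i < length w \<Longrightarrow> I i (p, f, out) \<Longrightarrow> I (Suc i) (exec w c (p(r := i), f, out))"
    and "\<And>p f out. I (length w) (p, f, out) \<Longrightarrow> Q (p(r := length w), f, out)"
  shows "Q (exec w (For r c) s)"
proof -
  let ?F = "\<lambda>i (p, f, out). exec w c (p(r := i), f, out)"
  have "I m (fold ?F [0..<m] s)" if "m \<le> length w" for m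
    using that
  proof (induction m)
    case (Suc m)
    obtain p f out where 1: "fold ?F [0..<m] s = (p, f, out)" by (metis prod_cases3)
    have "fold ?F [0..<Suc m] s = exec w c (p(r := m), f, out)"
      by (simp only: upt_Suc_append[OF le0] fold_append fold_simps o_apply 1 prod.case)
    then show ?case using Suc.IH Suc.prems assms(2)[of m p f out] unfolding 1 by (simp only:)
  qed (simp add: assms(1))
  then have I: "I (length w) (fold ?F [0..<length w] s)" by blast
  obtain p f out where 1: "fold ?F [0..<length w] s = (p, f, out)" by (metis prod_cases3)
  then have "exec w (For r c) s = (p(r := length w), f, out)"
    by (simp only: exec.simps prod.case)
  then show ?thesis
    using assms(3) I unfolding 1 by (simp only:)
qed

datatype trm = V nat | C nat | Plus trm trm | Times trm trm
datatype fm = Lt trm trm | Bit trm | Neg fm | And fm fm | Ex nat fm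
datatype prg = Empty | Out bool | Cat prg prg | If fm prg prg | Loop nat prg

primrec tval :: "(nat \<Rightarrow> nat) \<Rightarrow> trm \<Rightarrow> nat" where
  "tval p (V r) = p r"
| "tval p (C k) = k"
| "tval p (Plus s t) = tval p s + tval p t"
| "tval p (Times s t) = tval p s * tval p t"

text \<open>Pointers are bounded by the length of the input, so the machine computes
  \<^term>\<open>min (length w) (tval p t)\<close> instead of \<^term>\<open>tval p t\<close>; the side conditions in the
  first two clauses are what remains decidable after this truncation.\<close>

primrec holds :: "bool list \<Rightarrow> (nat \<Rightarrow> nat) \<Rightarrow> fm \<Rightarrow> bool" where
  "holds w p (Lt s t) \<longleftrightarrow> tval p s < tval p t \<and> tval p s < length w"
| "holds w p (Bit t) \<longleftrightarrow> tval p t < length w \<and> w ! tval p t"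
| "holds w p (Neg A) \<longleftrightarrow> \<not> holds w p A"
| "holds w p (And A B) \<longleftrightarrow> holds w p A \<and> holds w p B"
| "holds w p (Ex r A) \<longleftrightarrow> (\<exists>i<length w. holds w (p(r := i)) A)"

primrec prints :: "bool list \<Rightarrow> (nat \<Rightarrow> nat) \<Rightarrow> prg \<Rightarrow> bool list" where
  "prints w p Empty = []"
| "prints w p (Out b) = [b]"
| "prints w p (Cat c1 c2) = prints w p c1 @ prints w p c2"
| "prints w p (If A c1 c2) = (if holds w p A then prints w p c1 else prints w p c2)"
| "prints w p (Loop r c) = concat (map (\<lambda>i. prints w (p(r := i)) c) [0..<length w])"

text \<open>Bound variables are de Bruijn levels: below \<^term>\<open>d\<close> binders the next one must be
  called \<^term>\<open>d\<close>, so that all pointers from \<^term>\<open>d\<close> on are free for intermediate results.\<close>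

primrec wf_trm :: "nat \<Rightarrow> trm \<Rightarrow> bool" where
  "wf_trm d (V r) \<longleftrightarrow> r < d"
| "wf_trm d (C k) \<longleftrightarrow> True"
| "wf_trm d (Plus s t) \<longleftrightarrow> wf_trm d s \<and> wf_trm d t"
| "wf_trm d (Times s t) \<longleftrightarrow> wf_trm d s \<and> wf_trm d t"

primrec wf_fm :: "nat \<Rightarrow> fm \<Rightarrow> bool" where
  "wf_fm d (Lt s t) \<longleftrightarrow> wf_trm d s \<and> wf_trm d t"
| "wf_fm d (Bit t) \<longleftrightarrow> wf_trm d t"
| "wf_fm d (Neg A) \<longleftrightarrow> wf_fm d A"
| "wf_fm d (And A B) \<longleftrightarrow> wf_fm d A \<and> wf_fm d B"
| "wf_fm d (Ex r A) \<longleftrightarrow> r = d \<and> wf_fm (Suc d) A"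

primrec wf_prg :: "nat \<Rightarrow> prg \<Rightarrow> bool" where
  "wf_prg d Empty \<longleftrightarrow> True"
| "wf_prg d (Out b) \<longleftrightarrow> True"
| "wf_prg d (Cat c1 c2) \<longleftrightarrow> wf_prg d c1 \<and> wf_prg d c2"
| "wf_prg d (If A c1 c2) \<longleftrightarrow> wf_fm d A \<and> wf_prg d c1 \<and> wf_prg d c2"
| "wf_prg d (Loop r c) \<longleftrightarrow> r = d \<and> wf_prg (Suc d) c"

text \<open>\<open>For\<close> always makes \<open>length w\<close> rounds, so a smaller bound is
  imposed by a guard; \<open>SetF False\<close> is the idle branch.\<close>

definition repeat_below :: "nat \<Rightarrow> nat \<Rightarrow> com \<Rightarrow> com" where
  "repeat_below x r c = For x (Seq (TestLess x r) (IfF c (SetF False)))"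

text \<open>The value is left in pointer \<open>d\<close>, and scratch values use the pointers above
  it. In \<open>C k\<close> the command \<open>SetF False\<close> stands for an empty program to
  which \<open>k\<close> increments are appended.\<close>

primrec cterm :: "nat \<Rightarrow> trm \<Rightarrow> com" where
  "cterm d (V r) = Seq (Zero d) (repeat_below (d + 1) r (Inc d))"
| "cterm d (C k) = Seq (Zero d) (((\<lambda>c. Seq c (Inc d)) ^^ k) (SetF False))"
| "cterm d (Plus s t) = Seq (cterm d s) (Seq (cterm (d + 1) t) (repeat_below (d + 2) (d + 1) (Inc d)))"
| "cterm d (Times s t) = Seq (cterm (d + 1) s) (Seq (cterm (d + 2) t) (Seq (Zero d)
     (repeat_below (d + 3) (d + 1) (repeat_below (d + 4) (d + 2) (Inc d)))))"

text \<open>The truth value is left in the flag. For \<open>Ex\<close> the flag accumulates the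
  disjunction: once it is True, the remaining rounds skip the formula.\<close>

primrec cform :: "nat \<Rightarrow> fm \<Rightarrow> com" where
  "cform d (Lt s t) = Seq (cterm d s) (Seq (cterm (d + 1) t) (TestLess d (d + 1)))"
| "cform d (Bit t) = Seq (cterm d t) (TestBit d)"
| "cform d (Neg A) = Seq (cform d A) (IfF (SetF False) (SetF True))"
| "cform d (And A B) = Seq (cform d A) (IfF (cform d B) (SetF False))"
| "cform d (Ex r A) = Seq (SetF False) (For r (IfF (SetF True) (cform (r + 1) A)))"

primrec cprg :: "nat \<Rightarrow> prg \<Rightarrow> com" where
  "cprg d Empty = SetF False"
| "cprg d (Out b) = Emit b"
| "cprg d (Cat c1 c2) = Seq (cprg d c1) (cprg d c2)"
| "cprg d (If A c1 c2) = Seq (cform d A) (IfF (cprg d c1) (cprg d c2))"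
| "cprg d (Loop r c) = For r (cprg (r + 1) c)"

lemma wf_trm_mono: "wf_trm d t \<Longrightarrow> d \<le> d' \<Longrightarrow> wf_trm d' t"
  by (induction t) auto

lemma tval_cong: "wf_trm d t \<Longrightarrow> \<forall>r<d. p r = q r \<Longrightarrow> tval p t = tval q t"
  by (induction t) auto

lemma holds_cong: "wf_fm d A \<Longrightarrow> \<forall>r<d. p r = q r \<Longrightarrow> holds w p A = holds w q A"
proof (induction A arbitrary: d p q)
  case (Lt s t)
  have "tval p s = tval q s" "tval p t = tval q t"
    using Lt tval_cong by auto
  then show ?case by simp
next
  case (Bit t)
  have "tval p t = tval q t"
    using Bit tval_cong by auto
  then show ?case by simp
next
  case (Neg A)
  have "holds w p A = holds w q A" using Neg.prems by (intro Neg.IH[of d]) auto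
  then show ?case by simp
next
  case (And A B)
  have "holds w p A = holds w q A" "holds w p B = holds w q B"
    using And.prems by (intro And.IH[of d]; simp)+
  then show ?case by simp
next
  case (Ex r A)
  have "holds w (p(r := i)) A = holds w (q(r := i)) A" for i
    using Ex.prems by (intro Ex.IH[of "Suc d"]) (auto simp: less_Suc_eq)
  then show ?case by simp
qed

lemma prints_cong: "wf_prg d c \<Longrightarrow> \<forall>r<d. p r = q r \<Longrightarrow> prints w p c = prints w q c"
proof (induction c arbitrary: d p q)
  case (Cat c1 c2)
  have "prints w p c1 = prints w q c1" "prints w p c2 = prints w q c2"
    using Cat.prems by (intro Cat.IH[of d]; simp)+
  then show ?case by simp
next
  case (If A c1 c2)
  have "prints w p c1 = prints w q c1" "prints w p c2 = prints w q c2"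
    using If.prems by (intro If.IH[of d]; simp)+
  moreover have "holds w p A = holds w q A" using If.prems by (intro holds_cong[of d]) auto
  ultimately show ?case by simp
next
  case (Loop r c)
  have "prints w (p(r := i)) c = prints w (q(r := i)) c" for i
    using Loop.prems by (intro Loop.IH[of "Suc d"]) (auto simp: less_Suc_eq)
  then show ?case by simp
qed simp_all

text \<open>\<open>I i\<close> describes the state after i effective rounds. Idle rounds change only
  \<open>x\<close> and the flag, to which \<open>I\<close> has to be insensitive, so the state at
  the end is that after min (length w) (p r) rounds.\<close>

lemma exec_repeat_below:
  assumes "x \<noteq> r"
    and "I 0 (p, f, out)"
    and "\<And>i q g out'. i < p r \<Longrightarrow> i < length w \<Longrightarrow> q r = p r \<Longrightarrow> I i (q, g, out') \<Longrightarrow>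
      I (Suc i) (exec w c (q(x := i), True, out'))"
    and "\<And>i q g out' y g'. I i (q, g, out') \<Longrightarrow> I i (q(x := y), g', out')"
    and "r \<notin> modified c"
  shows "I (min (length w) (p r)) (exec w (repeat_below x r c) (p, f, out))"
  unfolding repeat_below_def
proof (rule exec_For_invariant[where I = "\<lambda>i s. fst s r = p r \<and> I (min i (p r)) s"])
  fix i q g out'
  assume "i < length w" and I: "fst (q, g, out') r = p r \<and> I (min i (p r)) (q, g, out')"
  have "I (Suc i) (exec w c (q(x := i), True, out'))" if "i < p r"
    using that I \<open>i < length w\<close> by (intro assms(3)[of i q g out']) (simp_all add: min_def)
  moreover have "I (p r) (q(x := i), False, out')" if "\<not> i < p r"
    using that I assms(4)[of "p r" q g out' i False] by (simp add: min_def split: if_splits)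
  ultimately show "fst (exec w (Seq (TestLess x r) (IfF c (SetF False))) (q(x := i), g, out')) r = p r \<and>
      I (min (Suc i) (p r)) (exec w (Seq (TestLess x r) (IfF c (SetF False))) (q(x := i), g, out'))"
    using I assms(1) exec_unmodified[OF assms(5), of w "(q(x := i), True, out')"]
    by (simp add: min_def)
qed (use assms in auto)

lemma exec_add_loop:
  assumes "distinct [d, x, r]" "exec w (repeat_below x r (Inc d)) (p, f, out) = (p', f', out')"
    "p d \<le> length w"
  shows "p' d = min (length w) (p d + p r) \<and> out' = out \<and> (\<forall>y. y \<noteq> d \<longrightarrow> y \<noteq> x \<longrightarrow> p' y = p y)"
proof -
  let ?I = "\<lambda>i (q, g :: bool, o1). q d = min (length w) (p d + i) \<and> o1 = out \<and>
    (\<forall>y. y \<noteq> d \<longrightarrow> y \<noteq> x \<longrightarrow> q y = p y)"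
  have "?I (min (length w) (p r)) (exec w (repeat_below x r (Inc d)) (p, f, out))"
    by (rule exec_repeat_below[where I = ?I]) (use assms(1,3) in auto)
  then show ?thesis using assms(2) by auto
qed

lemma exec_mult_loop:
  assumes "distinct [d, x, y, r, s]" "p d = 0" "p r \<le> length w"
    "exec w (repeat_below x r (repeat_below y s (Inc d))) (p, f, out) = (p', f', out')"
  shows "p' d = min (length w) (p r * p s) \<and> out' = out \<and>
    (\<forall>z. z \<noteq> d \<longrightarrow> z \<noteq> x \<longrightarrow> z \<noteq> y \<longrightarrow> p' z = p z)"
proof -
  let ?I = "\<lambda>i (q, g :: bool, o1). q d = min (length w) (i * p s) \<and> o1 = out \<and>
    (\<forall>z. z \<noteq> d \<longrightarrow> z \<noteq> x \<longrightarrow> z \<noteq> y \<longrightarrow> q z = p z)"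
  have "?I (min (length w) (p r)) (exec w (repeat_below x r (repeat_below y s (Inc d))) (p, f, out))"
  proof (rule exec_repeat_below[where I = ?I])
    fix i q and g :: bool and out'
    assume I: "?I i (q, g, out')"
    obtain q1 g1 o1 where 1: "exec w (repeat_below y s (Inc d)) (q(x := i), True, out') = (q1, g1, o1)"
      by (metis prod_cases3)
    show "?I (Suc i) (exec w (repeat_below y s (Inc d)) (q(x := i), True, out'))"
      using exec_add_loop[OF _ 1] I assms(1) unfolding 1 by (auto simp: min_def)
  qed (use assms(1,2) in \<open>auto simp: repeat_below_def\<close>)
  then show ?thesis using assms(3,4) by (auto simp: min_absorb2)
qed

lemma exec_const:
  "exec w (((\<lambda>c. Seq c (Inc d)) ^^ k) (SetF False)) (p, f, out) =
     (p(d := if k = 0 then p d else min (length w) (p d + k)), False, out)"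
  by (induction k) (auto simp: fun_eq_iff min_def)

lemma exec_cterm:
  "wf_trm d t \<Longrightarrow> exec w (cterm d t) (p, f, out) = (p', f', out') \<Longrightarrow>
   p' d = min (length w) (tval p t) \<and> out' = out \<and> (\<forall>r<d. p' r = p r)"
proof (induction t arbitrary: d p f out p' f' out')
  case (V r)
  then show ?case
    using exec_add_loop[of d "d + 1" r w "p(d := 0)" f out p' f' out'] by auto
next
  case (C k)
  then show ?case by (auto simp: exec_const)
next
  case (Plus s t)
  obtain p1 f1 o1 where 1: "exec w (cterm d s) (p, f, out) = (p1, f1, o1)" by (metis prod_cases3)
  obtain p2 f2 o2 where 2: "exec w (cterm (d + 1) t) (p1, f1, o1) = (p2, f2, o2)" by (metis prod_cases3)
  have I1: "p1 d = min (length w) (tval p s)" "o1 = out" "\<forall>r<d. p1 r = p r"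
    using Plus.IH(1)[OF _ 1] Plus.prems by auto
  have "wf_trm (d + 1) t" "tval p1 t = tval p t"
    using Plus.prems I1 tval_cong[of d t p1 p] by (auto intro: wf_trm_mono[of d])
  then have I2: "p2 (d + 1) = min (length w) (tval p t)" "o2 = out" "\<forall>r<d + 1. p2 r = p1 r"
    using Plus.IH(2)[OF _ 2] I1 by auto
  have "exec w (repeat_below (d + 2) (d + 1) (Inc d)) (p2, f2, o2) = (p', f', out')"
    using Plus.prems(2) 1 2 by simp
  from exec_add_loop[OF _ this] show ?case
    using I1 I2 by (auto simp: min_def)
next
  case (Times s t)
  obtain p1 f1 o1 where 1: "exec w (cterm (d + 1) s) (p, f, out) = (p1, f1, o1)" by (metis prod_cases3)
  obtain p2 f2 o2 where 2: "exec w (cterm (d + 2) t) (p1, f1, o1) = (p2, f2, o2)" by (metis prod_cases3)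
  have "wf_trm (d + 1) s" using Times.prems by (auto intro: wf_trm_mono[of d])
  then have I1: "p1 (d + 1) = min (length w) (tval p s)" "o1 = out" "\<forall>r<d + 1. p1 r = p r"
    using Times.IH(1)[OF _ 1] by auto
  have "wf_trm (d + 2) t" "tval p1 t = tval p t"
    using Times.prems I1 tval_cong[of d t p1 p] by (auto intro: wf_trm_mono[of d])
  then have I2: "p2 (d + 2) = min (length w) (tval p t)" "o2 = out" "\<forall>r<d + 2. p2 r = p1 r"
    using Times.IH(2)[OF _ 2] I1 by auto
  have 3: "exec w (repeat_below (d + 3) (d + 1) (repeat_below (d + 4) (d + 2) (Inc d)))
      (p2(d := 0), f2, o2) = (p', f', out')"
    using Times.prems(2) 1 2 by simp
  \<comment> \<open>Truncating the factors first is harmless: if one factor reaches n and the other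
    is not 0, both products reach n.\<close>
  have m: "min n (min n a * min n b) = min n (a * b)" for n a b :: nat
  proof (cases "a \<le> n \<and> b \<le> n \<or> a = 0 \<or> b = 0 \<or> n = 0")
    case False
    then have "n \<le> min n a * min n b" "n \<le> a * b"
      using mult_le_mono[of n "min n a" 1 "min n b"] mult_le_mono[of 1 "min n a" n "min n b"]
        mult_le_mono[of n a 1 b] mult_le_mono[of 1 a n b]
      by (auto simp: min_def split: if_splits)
    then show ?thesis by (simp add: min_absorb1)
  qed auto
  show ?case
    using exec_mult_loop[OF _ _ _ 3] I1 I2 m[of "length w" "tval p s" "tval p t"] by simp
qed

lemma exec_cform:
  "wf_fm d A \<Longrightarrow> exec w (cform d A) (p, f, out) = (p', f', out') \<Longrightarrow>
   f' = holds w p A \<and> out' = out \<and> (\<forall>r<d. p' r = p r)"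
proof (induction A arbitrary: d p f out p' f' out')
  case (Lt s t)
  obtain p1 f1 o1 where 1: "exec w (cterm d s) (p, f, out) = (p1, f1, o1)" by (metis prod_cases3)
  obtain p2 f2 o2 where 2: "exec w (cterm (d + 1) t) (p1, f1, o1) = (p2, f2, o2)" by (metis prod_cases3)
  have I1: "p1 d = min (length w) (tval p s)" "o1 = out" "\<forall>r<d. p1 r = p r"
    using exec_cterm[OF _ 1] Lt.prems by auto
  have "wf_trm (d + 1) t" "tval p1 t = tval p t"
    using Lt.prems I1 tval_cong[of d t p1 p] by (auto intro: wf_trm_mono[of d])
  then have I2: "p2 (d + 1) = min (length w) (tval p t)" "o2 = out" "\<forall>r<d + 1. p2 r = p1 r"
    using exec_cterm[OF _ 2] I1 by auto
  then show ?case using Lt.prems(2) 1 2 I1 I2 by auto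
next
  case (Bit t)
  obtain p1 f1 o1 where 1: "exec w (cterm d t) (p, f, out) = (p1, f1, o1)" by (metis prod_cases3)
  then show ?case using exec_cterm[OF _ 1] Bit.prems by auto
next
  case (Neg A)
  obtain p1 f1 o1 where 1: "exec w (cform d A) (p, f, out) = (p1, f1, o1)" by (metis prod_cases3)
  then show ?case using Neg.IH[OF _ 1] Neg.prems by (auto split: if_splits)
next
  case (And A B)
  obtain p1 f1 o1 where 1: "exec w (cform d A) (p, f, out) = (p1, f1, o1)" by (metis prod_cases3)
  have I1: "f1 = holds w p A" "o1 = out" "\<forall>r<d. p1 r = p r"
    using And.IH(1)[OF _ 1] And.prems by auto
  have "holds w p1 B = holds w p B"
    using And.prems I1 holds_cong[of d B p1 p] by auto
  then show ?case
    using And.IH(2)[of d p1 f1 o1 p' f' out'] And.prems 1 I1 by (auto split: if_splits)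
next
  case (Ex r A)
  let ?I = "\<lambda>i (q, g, o1). g = (\<exists>j<i. holds w (p(r := j)) A) \<and> o1 = out \<and> (\<forall>y<d. q y = p y)"
  have "?I (length w) (exec w (For r (IfF (SetF True) (cform (r + 1) A))) (p, False, out))"
  proof (rule exec_For_invariant[where I = ?I and Q = "?I (length w)"])
    fix i q g o1
    assume I: "?I i (q, g, o1)"
    obtain q1 g1 o2 where 1: "exec w (cform (r + 1) A) (q(r := i), g, o1) = (q1, g1, o2)"
      by (metis prod_cases3)
    have "holds w (q(r := i)) A = holds w (p(r := i)) A"
      using Ex.prems I by (intro holds_cong[of "Suc d"]) (auto simp: less_Suc_eq)
    moreover have "g1 = holds w (q(r := i)) A \<and> o2 = o1 \<and> (\<forall>y<r + 1. q1 y = (q(r := i)) y)"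
      by (rule Ex.IH[OF _ 1]) (use Ex.prems in simp)
    ultimately have "g1 = holds w (p(r := i)) A" "o2 = out" "\<forall>y<d. q1 y = p y"
      using I Ex.prems(1) by (auto simp: less_Suc_eq)
    with I 1 Ex.prems(1) show "?I (Suc i) (exec w (IfF (SetF True) (cform (r + 1) A)) (q(r := i), g, o1))"
      by (auto simp: less_Suc_eq)
  qed (use Ex.prems in auto)
  moreover have "exec w (For r (IfF (SetF True) (cform (r + 1) A))) (p, False, out) = (p', f', out')"
    using Ex.prems(2) by (simp only: cform.simps exec.simps(4,7) prod.case)
  ultimately show ?case by (simp only: prod.case holds.simps simp_thms) blast
qed

lemma exec_cprg:
  "wf_prg d c \<Longrightarrow> exec w (cprg d c) (p, f, out) = (p', f', out') \<Longrightarrow>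
   out' = out @ prints w p c \<and> (\<forall>r<d. p' r = p r)"
proof (induction c arbitrary: d p f out p' f' out')
  case (Cat c1 c2)
  obtain p1 f1 o1 where 1: "exec w (cprg d c1) (p, f, out) = (p1, f1, o1)" by (metis prod_cases3)
  have I1: "o1 = out @ prints w p c1" "\<forall>r<d. p1 r = p r"
    using Cat.IH(1)[OF _ 1] Cat.prems by auto
  have "prints w p1 c2 = prints w p c2"
    using Cat.prems I1 prints_cong[of d c2 p1 p] by auto
  moreover have "exec w (cprg d c2) (p1, f1, o1) = (p', f', out')"
    using Cat.prems(2) 1 by simp
  then have "out' = o1 @ prints w p1 c2 \<and> (\<forall>r<d. p' r = p1 r)"
    by (rule Cat.IH(2)[rotated]) (use Cat.prems in simp)
  ultimately show ?case using I1 by simp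
next
  case (If A c1 c2)
  obtain p1 f1 o1 where 1: "exec w (cform d A) (p, f, out) = (p1, f1, o1)" by (metis prod_cases3)
  have I1: "f1 = holds w p A" "o1 = out" "\<forall>r<d. p1 r = p r"
    using exec_cform[OF _ 1] If.prems by auto
  have "prints w p1 c1 = prints w p c1" "prints w p1 c2 = prints w p c2"
    using If.prems I1 prints_cong[of d c1 p1 p] prints_cong[of d c2 p1 p] by auto
  moreover have "out' = o1 @ prints w p1 c1 \<and> (\<forall>r<d. p' r = p1 r)" if f1
    by (rule If.IH(1)[of d]) (use If.prems 1 that in simp_all)
  moreover have "out' = o1 @ prints w p1 c2 \<and> (\<forall>r<d. p' r = p1 r)" if "\<not> f1"
    by (rule If.IH(2)[of d]) (use If.prems 1 that in simp_all)
  ultimately show ?case using I1 by auto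
next
  case (Loop r c)
  let ?I = "\<lambda>i (q, g :: bool, o1). o1 = out @ concat (map (\<lambda>i. prints w (p(r := i)) c) [0..<i]) \<and>
    (\<forall>y<d. q y = p y)"
  have "?I (length w) (exec w (For r (cprg (r + 1) c)) (p, f, out))"
  proof (rule exec_For_invariant[where I = ?I and Q = "?I (length w)"])
    fix i q and g :: bool and o1
    assume I: "?I i (q, g, o1)"
    obtain q1 g1 o2 where 1: "exec w (cprg (r + 1) c) (q(r := i), g, o1) = (q1, g1, o2)"
      by (metis prod_cases3)
    have "prints w (q(r := i)) c = prints w (p(r := i)) c"
      using Loop.prems I by (intro prints_cong[of "Suc d"]) (auto simp: less_Suc_eq)
    moreover have "o2 = o1 @ prints w (q(r := i)) c \<and> (\<forall>y<r + 1. q1 y = (q(r := i)) y)"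
      by (rule Loop.IH[OF _ 1]) (use Loop.prems in simp)
    ultimately have "o2 = o1 @ prints w (p(r := i)) c" "\<forall>y<d. q1 y = p y"
      using I Loop.prems(1) by (auto simp: less_Suc_eq)
    with I show "?I (Suc i) (exec w (cprg (r + 1) c) (q(r := i), g, o1))"
      unfolding 1 by simp
  qed (use Loop.prems in auto)
  moreover have "exec w (For r (cprg (r + 1) c)) (p, f, out) = (p', f', out')"
    using Loop.prems(2) by (simp only: cprg.simps)
  ultimately show ?case by (simp only: prod.case prints.simps simp_thms) blast
qed auto

section \<open>Compiled queries respect the pointer discipline\<close>

lemma modified_cterm: "modified (cterm d t) \<subseteq> {d..}"
proof (induction t arbitrary: d)
  case (C k)
  then show ?case by (induction k) auto
next
  case (Plus s t)
  from this(1)[of d] this(2)[of "d + 1"] show ?case by (auto simp: repeat_below_def)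
next
  case (Times s t)
  from this(1)[of "d + 1"] this(2)[of "d + 2"] show ?case by (auto simp: repeat_below_def)
qed (auto simp: repeat_below_def)

lemma modified_cform: "wf_fm d A \<Longrightarrow> modified (cform d A) \<subseteq> {d..}"
proof (induction A arbitrary: d)
  case (Lt s t)
  then show ?case using modified_cterm[of d s] modified_cterm[of "d + 1" t] by auto
next
  case (Bit t)
  then show ?case using modified_cterm[of d t] by auto
next
  case (Ex r A)
  then have "modified (cform (Suc d) A) \<subseteq> {Suc d..}" by (intro Ex.IH) simp
  then show ?case using Ex.prems by auto
qed auto

lemma modified_cprg: "wf_prg d c \<Longrightarrow> modified (cprg d c) \<subseteq> {d..}"
proof (induction c arbitrary: d)
  case (If A c1 c2)
  then show ?case using modified_cform[of d A] by auto
next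
  case (Loop r c)
  then have "modified (cprg (Suc d) c) \<subseteq> {Suc d..}" by (intro Loop.IH) simp
  then show ?case using Loop.prems by auto
qed auto

lemma wf_com_mono: "wf_com K c \<Longrightarrow> K \<le> K' \<Longrightarrow> wf_com K' c"
  by (induction c) auto

text \<open>The number of pointers is never computed; since \<open>wf_com\<close> is monotone in
  \<open>K\<close>, the bounds of the parts are merged by \<open>max\<close>.\<close>

lemma ex_wf_com_Seq:
  "\<exists>K. wf_com K a \<Longrightarrow> \<exists>K. wf_com K b \<Longrightarrow> \<exists>K. wf_com K (Seq a b)"
  "\<exists>K. wf_com K a \<Longrightarrow> \<exists>K. wf_com K b \<Longrightarrow> \<exists>K. wf_com K (IfF a b)"
  by (metis wf_com.simps(7,8) wf_com_mono max.cobounded1 max.cobounded2)+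

lemma ex_wf_com_For:
  "\<exists>K. wf_com K c \<Longrightarrow> 2 \<le> r \<Longrightarrow> r \<notin> modified c \<Longrightarrow> \<exists>K. wf_com K (For r c)"
  using wf_com_mono[OF _ max.cobounded1[of _ "Suc r"]]
  by (metis Suc_le_eq max.cobounded2 wf_com.simps(9))

lemma ex_wf_com_atom:
  "2 \<le> r \<Longrightarrow> \<exists>K. wf_com K (Inc r)" "2 \<le> r \<Longrightarrow> \<exists>K. wf_com K (Zero r)"
  "\<exists>K. wf_com K (SetF b)" "\<exists>K. wf_com K (Emit b)" "\<exists>K. wf_com K (TestBit r)"
  "\<exists>K. wf_com K (TestLess r s)"
  by (auto intro: exI[of _ "Suc r"] exI[of _ "Suc (max r s)"])

lemmas ex_wf_com = ex_wf_com_Seq ex_wf_com_For ex_wf_com_atom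

lemma ex_wf_com_cterm: "2 \<le> d \<Longrightarrow> wf_trm d t \<Longrightarrow> \<exists>K. wf_com K (cterm d t)"
proof (induction t arbitrary: d)
  case (V r)
  then show ?case by (auto simp: repeat_below_def simp del: wf_com.simps intro!: ex_wf_com)
next
  case (C k)
  then have "\<exists>K. wf_com K (((\<lambda>c. Seq c (Inc d)) ^^ k) (SetF False))"
    by (induction k) (auto simp del: wf_com.simps intro!: ex_wf_com)
  then show ?case using C by (auto simp del: wf_com.simps intro!: ex_wf_com)
next
  case (Plus s t)
  then show ?case using wf_trm_mono[of d t "d + 1"]
    by (auto simp: repeat_below_def simp del: wf_com.simps intro!: ex_wf_com)
next
  case (Times s t)
  then show ?case using wf_trm_mono[of d s "d + 1"] wf_trm_mono[of d t "d + 2"]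
    by (auto simp: repeat_below_def simp del: wf_com.simps intro!: ex_wf_com)
qed

lemma ex_wf_com_cform: "2 \<le> d \<Longrightarrow> wf_fm d A \<Longrightarrow> \<exists>K. wf_com K (cform d A)"
proof (induction A arbitrary: d)
  case (Lt s t)
  then show ?case using wf_trm_mono[of d t "d + 1"]
    by (auto simp del: wf_com.simps intro!: ex_wf_com ex_wf_com_cterm)
next
  case (Bit t)
  then show ?case by (auto simp del: wf_com.simps intro!: ex_wf_com ex_wf_com_cterm)
next
  case (Ex r A)
  then show ?case using modified_cform[of "Suc d" A]
    by (fastforce simp del: wf_com.simps intro!: ex_wf_com)
qed (auto simp del: wf_com.simps intro!: ex_wf_com)

lemma ex_wf_com_cprg: "2 \<le> d \<Longrightarrow> wf_prg d c \<Longrightarrow> \<exists>K. wf_com K (cprg d c)"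
proof (induction c arbitrary: d)
  case (Loop r c)
  then show ?case using modified_cprg[of "Suc d" c]
    by (fastforce simp del: wf_com.simps intro!: ex_wf_com)
qed (auto simp del: wf_com.simps intro!: ex_wf_com ex_wf_com_cform)

definition run_prg :: "prg \<Rightarrow> bool list \<Rightarrow> bool list" where
  "run_prg c w = prints w (\<lambda>r. if r = 1 then length w else 0) c"

theorem poly_time_computable_run_prg:
  assumes "wf_prg 2 c"
  shows "poly_time_computable (run_prg c)"
proof -
  obtain K where "wf_com K (cprg 2 c)" using ex_wf_com_cprg[OF _ assms] by blast
  then have "wf_com (max K 2) (cprg 2 c)" by (rule wf_com_mono) simp
  moreover have "run_prg c w = snd (snd (exec w (cprg 2 c) (\<lambda>r. if r = 1 then length w else 0, False, [])))"
    for w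
  proof -
    obtain p' f' out' where "exec w (cprg 2 c) (\<lambda>r. if r = 1 then length w else 0, False, []) = (p', f', out')"
      by (metis prod_cases3)
    with exec_cprg[OF assms this] show ?thesis by (simp add: run_prg_def)
  qed
  ultimately show ?thesis by (intro poly_time_computable_com[of "max K 2" "cprg 2 c"]) auto
qed

section \<open>Parsing and printing pairs of graphs\<close>

definition Or :: "fm \<Rightarrow> fm \<Rightarrow> fm" where "Or A B = Neg (And (Neg A) (Neg B))"
definition Imp :: "fm \<Rightarrow> fm \<Rightarrow> fm" where "Imp A B = Neg (And A (Neg B))"
definition Iff :: "fm \<Rightarrow> fm \<Rightarrow> fm" where "Iff A B = And (Imp A B) (Imp B A)"
text \<open>Equality after truncation: two values that both reach \<open>length w\<close> count as
  equal, whence the side condition of \<open>holds_Eq\<close>.\<close>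

definition Eq :: "trm \<Rightarrow> trm \<Rightarrow> fm" where "Eq s t = And (Neg (Lt s t)) (Neg (Lt t s))"
definition Exb :: "nat \<Rightarrow> trm \<Rightarrow> fm \<Rightarrow> fm" where "Exb r t A = Ex r (And (Lt (V r) t) A)"
definition Allb :: "nat \<Rightarrow> trm \<Rightarrow> fm \<Rightarrow> fm" where "Allb r t A = Neg (Exb r t (Neg A))"
definition Loopb :: "nat \<Rightarrow> trm \<Rightarrow> prg \<Rightarrow> prg" where "Loopb r t c = Loop r (If (Lt (V r) t) c Empty)"

lemma holds_connectives [simp]:
  "holds w p (Or A B) \<longleftrightarrow> holds w p A \<or> holds w p B"
  "holds w p (Imp A B) \<longleftrightarrow> (holds w p A \<longrightarrow> holds w p B)"
  "holds w p (Iff A B) \<longleftrightarrow> (holds w p A \<longleftrightarrow> holds w p B)"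
  by (auto simp: Or_def Imp_def Iff_def)

lemma holds_Eq: "tval p s < length w \<Longrightarrow> holds w p (Eq s t) \<longleftrightarrow> tval p s = tval p t"
  by (auto simp: Eq_def)

text \<open>\<open>wf_trm r t\<close> keeps \<open>r\<close> out of its own bound. The size
  condition is there because \<open>Ex\<close> ranges only below \<open>length w\<close>.\<close>

lemma holds_Exb:
  "wf_trm r t \<Longrightarrow> tval p t \<le> length w \<Longrightarrow>
   holds w p (Exb r t A) \<longleftrightarrow> (\<exists>i<tval p t. holds w (p(r := i)) A)"
proof -
  assume t: "wf_trm r t" "tval p t \<le> length w"
  have "tval (p(r := i)) t = tval p t" for i
    by (rule tval_cong[OF t(1)]) auto
  then show ?thesis using t(2) by (auto simp: Exb_def intro: less_le_trans)
qed

lemma holds_Allb: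
  "wf_trm r t \<Longrightarrow> tval p t \<le> length w \<Longrightarrow>
   holds w p (Allb r t A) \<longleftrightarrow> (\<forall>i<tval p t. holds w (p(r := i)) A)"
  by (simp add: Allb_def holds_Exb)

lemma concat_map_if_less:
  "m \<le> n \<Longrightarrow> concat (map (\<lambda>i. if i < m then f i else []) [0..<n]) = concat (map f [0..<m])"
proof (induction n)
  case (Suc n)
  show ?case
  proof (cases "m = Suc n")
    case True
    then show ?thesis by (auto intro!: arg_cong[of _ _ concat])
  next
    case False
    with Suc show ?thesis by simp
  qed
qed simp

lemma prints_Loopb:
  assumes "wf_trm r t" "tval p t \<le> length w"
  shows "prints w p (Loopb r t c) = concat (map (\<lambda>i. prints w (p(r := i)) c) [0..<tval p t])"
proof -
  have "tval (p(r := i)) t = tval p t" for i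
    by (rule tval_cong[OF assms(1)]) auto
  then have "prints w p (Loopb r t c) =
    concat (map (\<lambda>i. if i < tval p t then prints w (p(r := i)) c else []) [0..<length w])"
    by (auto simp: Loopb_def intro!: arg_cong[of _ _ concat])
  then show ?thesis using concat_map_if_less[OF assms(2)] by simp
qed

lemma wf_connectives [simp]:
  "wf_fm d (Or A B) \<longleftrightarrow> wf_fm d A \<and> wf_fm d B"
  "wf_fm d (Imp A B) \<longleftrightarrow> wf_fm d A \<and> wf_fm d B"
  "wf_fm d (Iff A B) \<longleftrightarrow> wf_fm d A \<and> wf_fm d B"
  "wf_fm d (Eq s t) \<longleftrightarrow> wf_trm d s \<and> wf_trm d t"
  "wf_fm d (Exb r t A) \<longleftrightarrow> r = d \<and> wf_trm (Suc d) t \<and> wf_fm (Suc d) A"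
  "wf_fm d (Allb r t A) \<longleftrightarrow> r = d \<and> wf_trm (Suc d) t \<and> wf_fm (Suc d) A"
  "wf_prg d (Loopb r t c) \<longleftrightarrow> r = d \<and> wf_trm (Suc d) t \<and> wf_prg (Suc d) c"
  by (auto simp: Or_def Imp_def Iff_def Eq_def Exb_def Allb_def Loopb_def)

definition pack :: "nat \<Rightarrow> bool list \<Rightarrow> bool list" where
  "pack N z = replicate N True @ [False] @ z"

lemma length_pack [simp]: "length (pack N z) = N + 1 + length z"
  by (simp add: pack_def)

lemma nth_pack:
  "i < N \<Longrightarrow> pack N z ! i" "\<not> pack N z ! N" "pack N z ! (N + 1 + i) = z ! i"
  by (auto simp: pack_def nth_append)

text \<open>The unary prefix delimits itself: N is the position of the first False.\<close>

lemma pack_inject: "pack N z = pack N' z' \<longleftrightarrow> N = N' \<and> z = z'"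
proof
  assume eq: "pack N z = pack N' z'"
  have "\<not> N < N'" "\<not> N' < N" using nth_pack eq by metis+
  then have "N = N'" by simp
  with eq show "N = N' \<and> z = z'" by (simp add: pack_def)
qed simp

lemma length_enc_pair [simp]: "length (enc_pair x y) = 2 * length x + 2 + length y"
  by (induction x) (auto simp: enc_pair_def)

lemma nth_double: "i < 2 * length x \<Longrightarrow> concat (map (\<lambda>b. [b, b]) x) ! i = x ! (i div 2)"
proof (induction x arbitrary: i)
  case (Cons a x)
  consider "i = 0" | "i = 1" | j where "i = j + 2" by (metis One_nat_def add_2_eq_Suc' not0_implies_Suc)
  then show ?case using Cons by cases auto
qed simp

lemma length_double: "length (concat (map (\<lambda>b. [b, b]) x)) = 2 * length x"
  by (induction x) auto

lemma nth_enc_pair: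
  "i < length x \<Longrightarrow> enc_pair x y ! (2 * i) = x ! i"
  "i < length x \<Longrightarrow> enc_pair x y ! (2 * i + 1) = x ! i"
  "\<not> enc_pair x y ! (2 * length x)"
  "enc_pair x y ! (2 * length x + 1)"
  "enc_pair x y ! (2 * length x + 2 + i) = y ! i"
  by (auto simp: enc_pair_def nth_append length_double nth_double)

text \<open>The separator is the first block of two unequal bits. If x were shorter than x', its
  separator would fall into the doubled part of the other word, where the two bits of a block
  agree.\<close>

lemma enc_pair_inject: "enc_pair x y = enc_pair x' y' \<longleftrightarrow> x = x' \<and> y = y'"
proof
  assume eq: "enc_pair x y = enc_pair x' y'"
  have *: "\<not> length x < length x'" if "enc_pair x y = enc_pair x' y'" for x y x' y'
  proof
    assume "length x < length x'"
    then have "enc_pair x y ! (2 * length x) = enc_pair x y ! (2 * length x + 1)"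
      unfolding that by (simp only: nth_enc_pair)
    then show False using nth_enc_pair(3,4) by metis
  qed
  have len: "length x = length x'" using *[OF eq] *[OF eq[symmetric]] by simp
  have "x = x'"
    by (rule nth_equalityI[OF len]) (metis eq len nth_enc_pair(1))
  with eq show "x = x' \<and> y = y'" by (simp add: enc_pair_def)
qed simp

lemma enc_pair_eqI:
  assumes "length w = 2 * length x + 2 + length y"
    and "\<And>i. i < length x \<Longrightarrow> w ! (2 * i) = x ! i \<and> w ! (2 * i + 1) = x ! i"
    and "\<not> w ! (2 * length x)" "w ! (2 * length x + 1)"
    and "\<And>i. i < length y \<Longrightarrow> w ! (2 * length x + 2 + i) = y ! i"
  shows "w = enc_pair x y"
proof (rule nth_equalityI)
  show "length w = length (enc_pair x y)" using assms(1) by simp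
  fix i assume i: "i < length w"
  consider j where "i = 2 * j" "j < length x" | j where "i = 2 * j + 1" "j < length x"
    | "i = 2 * length x" | "i = 2 * length x + 1"
    | j where "i = 2 * length x + 2 + j" "j < length y"
  proof -
    have "(\<exists>j. i = 2 * j \<and> j < length x) \<or> (\<exists>j. i = 2 * j + 1 \<and> j < length x) \<or>
      i = 2 * length x \<or> i = 2 * length x + 1 \<or> (\<exists>j. i = 2 * length x + 2 + j \<and> j < length y)"
      using i assms(1) by presburger
    then show thesis using that by blast
  qed
  then show "w ! i = enc_pair x y ! i"
    by cases (use assms nth_enc_pair in \<open>simp_all only: not_False_eq_True simp_thms\<close>)
qed

text \<open>Pointers 2 and 3 hold the numbers of vertices of the two input graphs.\<close>

abbreviation input_size :: "bool \<Rightarrow> trm" where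
  "input_size first \<equiv> V (if first then 2 else 3)"

text \<open>Here \<open>k\<close> is the number of bits per matrix entry: 1 for graphs, 2 for
  edge-coloured graphs.\<close>

definition first_len :: "nat \<Rightarrow> trm" where
  "first_len k = Plus (Plus (V 2) (C 1)) (Times (C k) (Times (V 2) (V 2)))"

definition second_at :: "nat \<Rightarrow> trm \<Rightarrow> trm" where
  "second_at k t = Plus (Plus (Times (C 2) (first_len k)) (C 2)) t"

text \<open>The first two conjuncts fix the length exactly. \<open>Eq\<close> could not, as it
  identifies all values from \<open>length w\<close> on; instead the last position must lie below
  the length and its successor must not. The rest checks the doubling, the separator and the two
  unary prefixes with their end bits.\<close>

definition frame :: "nat \<Rightarrow> fm" where
  "frame k = And (Lt (second_at k (Plus (V 3) (Times (C k) (Times (V 3) (V 3))))) (V 1))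
    (And (Neg (Lt (second_at k (Plus (Plus (V 3) (C 1)) (Times (C k) (Times (V 3) (V 3))))) (V 1)))
    (And (Allb 4 (first_len k) (Iff (Bit (Times (C 2) (V 4))) (Bit (Plus (Times (C 2) (V 4)) (C 1)))))
    (And (Neg (Bit (Times (C 2) (first_len k))))
    (And (Bit (Plus (Times (C 2) (first_len k)) (C 1)))
    (And (Allb 4 (V 2) (Bit (Times (C 2) (V 4))))
    (And (Neg (Bit (Times (C 2) (V 2))))
    (And (Allb 4 (V 3) (Bit (second_at k (V 4))))
    (Neg (Bit (second_at k (V 3)))))))))))"

definition zbit :: "nat \<Rightarrow> bool \<Rightarrow> trm \<Rightarrow> fm" where
  "zbit k first t = Bit (if first then Times (C 2) (Plus (Plus (V 2) (C 1)) t)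
     else second_at k (Plus (Plus (V 3) (C 1)) t))"

lemma wf_frame: "wf_fm 4 (frame k)"
  by (simp add: frame_def first_len_def second_at_def)

lemma wf_zbit: "4 \<le> d \<Longrightarrow> wf_trm d t \<Longrightarrow> wf_fm d (zbit k first t)"
  by (simp add: zbit_def first_len_def second_at_def)

definition framed :: "nat \<Rightarrow> bool list \<Rightarrow> nat \<Rightarrow> bool list \<Rightarrow> nat \<Rightarrow> bool list \<Rightarrow> bool" where
  "framed k w N z M y \<longleftrightarrow> length z = k * (N * N) \<and> length y = k * (M * M) \<and>
     w = enc_pair (pack N z) (pack M y)"

lemma framed_size: "framed k w N z M y \<Longrightarrow> 2 * N + M + 5 \<le> length w"
  by (auto simp: framed_def)

lemma framed_unique:
  "framed k w N z M y \<Longrightarrow> framed k w N' z' M' y' \<Longrightarrow> N' = N \<and> z' = z \<and> M' = M \<and> y' = y"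
  by (auto simp: framed_def enc_pair_inject pack_inject)

lemma holds_frame_iff:
  fixes p k defines "L \<equiv> p 2 + 1 + k * (p 2 * p 2)"
  assumes p: "p 1 = length w"
  shows "holds w p (frame k) \<longleftrightarrow> length w = 2 * L + 2 + (p 3 + 1 + k * (p 3 * p 3)) \<and>
    (\<forall>i<L. w ! (2 * i) = w ! (2 * i + 1)) \<and> \<not> w ! (2 * L) \<and> w ! (2 * L + 1) \<and>
    (\<forall>i<p 2. w ! (2 * i)) \<and> \<not> w ! (2 * p 2) \<and>
    (\<forall>i<p 3. w ! (2 * L + 2 + i)) \<and> \<not> w ! (2 * L + 2 + p 3)"
\<comment> \<open>With the exact length all inspected positions lie inside the word, so the guards
  in \<open>holds\<close> disappear. With any other length one of the first two conjuncts
  fails.\<close>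
proof (cases "length w = 2 * L + 2 + (p 3 + 1 + k * (p 3 * p 3))")
  case True
  have L: "tval p (first_len k) = L" "wf_trm 4 (first_len k)" "tval (p(4 := i)) (first_len k) = L" for i
    by (simp_all add: first_len_def L_def)
  have "2 * (p 2) < length w" using True by (simp add: L_def)
  have "holds w p (Allb 4 (first_len k) A) \<longleftrightarrow> (\<forall>i<L. holds w (p(4 := i)) A)"
    "holds w p (Allb 4 (V 2) A) \<longleftrightarrow> (\<forall>i<p 2. holds w (p(4 := i)) A)"
    "holds w p (Allb 4 (V 3) A) \<longleftrightarrow> (\<forall>i<p 3. holds w (p(4 := i)) A)" for A
    using True L \<open>2 * (p 2) < length w\<close> by (subst holds_Allb; simp)+
  note all = this
  have a: "holds w p (Allb 4 (first_len k) (Iff (Bit (Times (C 2) (V 4))) (Bit (Plus (Times (C 2) (V 4)) (C 1)))))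
      \<longleftrightarrow> (\<forall>i<L. w ! (2 * i) = w ! (2 * i + 1))"
    unfolding all using True by auto
  have b: "holds w p (Allb 4 (V 2) (Bit (Times (C 2) (V 4)))) \<longleftrightarrow> (\<forall>i<p 2. w ! (2 * i))"
    unfolding all using \<open>2 * (p 2) < length w\<close> by auto
  have c: "holds w p (Allb 4 (V 3) (Bit (second_at k (V 4)))) \<longleftrightarrow> (\<forall>i<p 3. w ! (2 * L + 2 + i))"
    unfolding all using True by (auto simp: second_at_def L)
  have d: "holds w p (Bit (Times (C 2) (first_len k))) \<longleftrightarrow> w ! (2 * L)"
    "holds w p (Bit (Plus (Times (C 2) (first_len k)) (C 1))) \<longleftrightarrow> w ! (2 * L + 1)"
    "holds w p (Bit (Times (C 2) (V 2))) \<longleftrightarrow> w ! (2 * p 2)"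
    "holds w p (Bit (second_at k (V 3))) \<longleftrightarrow> w ! (2 * L + 2 + p 3)"
    using True \<open>2 * (p 2) < length w\<close> by (simp_all add: second_at_def L)
  have e: "holds w p (Lt (second_at k (Plus (V 3) (Times (C k) (Times (V 3) (V 3))))) (V 1))"
    "\<not> holds w p (Lt (second_at k (Plus (Plus (V 3) (C 1)) (Times (C k) (Times (V 3) (V 3))))) (V 1))"
    using True p by (simp_all add: second_at_def L)
  show ?thesis
    unfolding frame_def holds.simps(3,4) a b c d using e True by (simp only: simp_thms)
next
  case False
  then show ?thesis
    using p by (auto simp: frame_def second_at_def first_len_def L_def)
qed

lemma holds_frame:
  assumes p: "p 1 = length w"
  shows "holds w p (frame k) \<longleftrightarrow> (\<exists>z y. framed k w (p 2) z (p 3) y)"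
proof
  let ?N = "p 2" and ?M = "p 3"
  let ?L = "?N + 1 + k * (?N * ?N)"
  let ?R = "2 * ?L + 2"
  assume "holds w p (frame k)"
  then have len: "length w = ?R + (?M + 1 + k * (?M * ?M))"
    and 1: "\<And>i. i < ?L \<Longrightarrow> w ! (2 * i) = w ! (2 * i + 1)" "\<not> w ! (2 * ?L)" "w ! (2 * ?L + 1)"
    "\<And>i. i < ?N \<Longrightarrow> w ! (2 * i)" "\<not> w ! (2 * ?N)"
    "\<And>i. i < ?M \<Longrightarrow> w ! (?R + i)" "\<not> w ! (?R + ?M)"
    unfolding holds_frame_iff[of p w k, OF p] by blast+
  define z where "z = map (\<lambda>i. w ! (2 * (?N + 1 + i))) [0..<k * (?N * ?N)]"
  define y where "y = map (\<lambda>i. w ! (?R + (?M + 1 + i))) [0..<k * (?M * ?M)]"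
  have px: "length (pack ?N z) = ?L" "length (pack ?M y) = ?M + 1 + k * (?M * ?M)"
    by (simp_all add: z_def y_def)
  have split: thesis if "i < m + 1 + l" "i < m \<Longrightarrow> thesis" "i = m \<Longrightarrow> thesis"
    "\<And>j. i = m + 1 + j \<Longrightarrow> j < l \<Longrightarrow> thesis" for i m l :: nat and thesis
    using that(1) that(2,3) that(4)[of "i - (m + 1)"] by fastforce
  have zn: "z ! j = w ! (2 * (?N + 1 + j))" if "j < k * (?N * ?N)" for j
    using that by (simp add: z_def)
  have yn: "y ! j = w ! (?R + (?M + 1 + j))" if "j < k * (?M * ?M)" for j
    using that by (simp add: y_def)
  have "w ! (2 * i) = pack ?N z ! i" if "i < ?L" for i
    using that
  proof (rule split)
    assume "i < ?N" then show ?thesis using 1(4) nth_pack(1) by blast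
  next
    assume "i = ?N" then show ?thesis using 1(5) nth_pack(2) by blast
  next
    fix j assume "i = ?N + 1 + j" "j < k * (?N * ?N)"
    then show ?thesis by (simp only: nth_pack(3) zn)
  qed
  moreover have "w ! (?R + i) = pack ?M y ! i" if "i < ?M + 1 + k * (?M * ?M)" for i
    using that
  proof (rule split)
    assume "i < ?M" then show ?thesis using 1(6) nth_pack(1) by blast
  next
    assume "i = ?M" then show ?thesis using 1(7) nth_pack(2) by blast
  next
    fix j assume "i = ?M + 1 + j" "j < k * (?M * ?M)"
    then show ?thesis by (simp only: nth_pack(3) yn)
  qed
  ultimately have "w = enc_pair (pack ?N z) (pack ?M y)"
    using 1 len by (intro enc_pair_eqI) (simp_all only: px not_False_eq_True)
  then show "\<exists>z y. framed k w ?N z ?M y"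
    by (intro exI[of _ z] exI[of _ y]) (simp add: framed_def z_def y_def)
next
  let ?N = "p 2" and ?M = "p 3"
  let ?L = "?N + 1 + k * (?N * ?N)"
  assume "\<exists>z y. framed k w (p 2) z (p 3) y"
  then obtain z y where zy: "length z = k * (?N * ?N)" "length y = k * (?M * ?M)"
    and w: "w = enc_pair (pack ?N z) (pack ?M y)"
    by (auto simp: framed_def)
  have px: "length (pack ?N z) = ?L" by (simp add: zy)
  have len: "length w = 2 * ?L + 2 + (?M + 1 + k * (?M * ?M))"
    by (simp add: w zy)
  note e = nth_enc_pair[where x = "pack ?N z" and y = "pack ?M y", unfolded px, folded w]
  show "holds w p (frame k)"
    unfolding holds_frame_iff[of p w k, OF p]
  proof (intro conjI allI impI)
    fix i assume "i < ?N"
    then show "w ! (2 * i)" using e(1)[of i] nth_pack(1) by simp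
  next
    show "\<not> w ! (2 * ?N)" using e(1)[of ?N] nth_pack(2) by simp
  qed (use e len nth_pack in \<open>simp_all only: not_False_eq_True simp_thms\<close>)
qed

lemma holds_zbit:
  assumes "framed k w (p 2) z (p 3) y" "tval p t < length (if first then z else y)"
  shows "holds w p (zbit k first t) \<longleftrightarrow> (if first then z else y) ! tval p t"
proof -
  let ?L = "p 2 + 1 + k * (p 2 * p 2)"
  have w: "w = enc_pair (pack (p 2) z) (pack (p 3) y)"
    and len: "length z = k * (p 2 * p 2)" "length y = k * (p 3 * p 3)"
    using assms(1) by (auto simp: framed_def)
  have px: "length (pack (p 2) z) = ?L" by (simp add: len)
  have lw: "length w = 2 * ?L + 2 + (p 3 + 1 + k * (p 3 * p 3))" by (simp add: w len)
  note e = nth_enc_pair[where x = "pack (p 2) z" and y = "pack (p 3) y", unfolded px, folded w]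
  show ?thesis
  proof (cases first)
    case True
    have "w ! (2 * (p 2 + 1 + tval p t)) = z ! tval p t"
      using e(1)[of "p 2 + 1 + tval p t"] assms(2) True len nth_pack(3) by simp
    then show ?thesis using True assms(2) len lw by (simp add: zbit_def)
  next
    case False
    have "w ! (2 * ?L + 2 + (p 3 + 1 + tval p t)) = y ! tval p t"
      using e(5)[of "p 3 + 1 + tval p t"] nth_pack(3) by simp
    then show ?thesis using False assms(2) len lw
      by (simp add: zbit_def second_at_def first_len_def)
  qed
qed

text \<open>The two sizes are found by trying all pairs. By \<open>framed_unique\<close> at most one
  pair passes, so \<open>c\<close> prints at most once, and an ill-formed word gives the empty
  output.\<close>

definition framed_prg :: "nat \<Rightarrow> fm \<Rightarrow> prg \<Rightarrow> prg" where
  "framed_prg k A c = Loop 2 (Loop 3 (If (And (frame k) A) c Empty))"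

definition start_env :: "bool list \<Rightarrow> nat \<Rightarrow> nat \<Rightarrow> nat \<Rightarrow> nat" where
  "start_env w N M = (\<lambda>r. if r = 1 then length w else 0)(2 := N, 3 := M)"

lemma start_env_simps [simp]:
  "start_env w N M 2 = N" "start_env w N M 3 = M" "start_env w N M 1 = length w"
  "start_env w N M (Suc 0) = length w"
  by (auto simp: start_env_def)

lemma concat_map_single:
  "concat (map (\<lambda>i. if i = m then f i else []) [0..<n]) = (if m < n then f m else [])"
  by (induction n) auto

lemma run_framed_prg_eq:
  "run_prg (framed_prg k A c) w = concat (map (\<lambda>i. concat (map (\<lambda>j.
     if (\<exists>z y. framed k w i z j y) \<and> holds w (start_env w i j) A
     then prints w (start_env w i j) c else []) [0..<length w])) [0..<length w])"
  using holds_frame[of "start_env w i j" w k for i j]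
  by (simp only: run_prg_def framed_prg_def start_env_def[symmetric] prints.simps holds.simps
      start_env_simps simp_thms)

lemma run_framed_prg:
  assumes "framed k w N z M y"
  shows "run_prg (framed_prg k A c) w =
    (if holds w (start_env w N M) A then prints w (start_env w N M) c else [])"
proof -
  have *: "(\<exists>z y. framed k w i z j y) \<longleftrightarrow> i = N \<and> j = M" for i j
    using framed_unique[OF assms] assms by blast
  have "run_prg (framed_prg k A c) w = concat (map (\<lambda>i. if i = N then concat (map (\<lambda>j. if j = M then
      (if holds w (start_env w i j) A then prints w (start_env w i j) c else []) else [])
      [0..<length w]) else []) [0..<length w])"
    unfolding run_framed_prg_eq * by (intro arg_cong[of _ _ concat] map_cong refl) (auto intro!: arg_cong[of _ _ concat])
  also have "\<dots> = (if holds w (start_env w N M) A then prints w (start_env w N M) c else [])"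
    using framed_size[OF assms] by (simp only: concat_map_single) simp
  finally show ?thesis .
qed

lemma run_framed_prg_unframed:
  assumes "\<And>N z M y. \<not> framed k w N z M y"
  shows "run_prg (framed_prg k A c) w = []"
  by (simp add: run_framed_prg_eq assms)

text \<open>\<open>enc_pair\<close> doubles the bits of its first component only; with this switch
  one printing program serves both components.\<close>

definition dbl :: "bool \<Rightarrow> bool list \<Rightarrow> bool list" where
  "dbl first xs = (if first then concat (map (\<lambda>b. [b, b]) xs) else xs)"

lemma dbl_Nil: "dbl f [] = []"
  and dbl_append: "dbl f (xs @ ys) = dbl f xs @ dbl f ys"
  by (auto simp: dbl_def)

lemma dbl_concat: "dbl f (concat xss) = concat (map (dbl f) xss)"
  by (induction xss) (auto simp: dbl_Nil dbl_append)

lemma dbl_Cons: "dbl f (x # xs) = dbl f [x] @ dbl f xs"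
  using dbl_append[of f "[x]" xs] by simp

definition put :: "bool \<Rightarrow> fm \<Rightarrow> prg" where
  "put first A = If A (if first then Cat (Out True) (Out True) else Out True)
     (if first then Cat (Out False) (Out False) else Out False)"

lemma prints_put: "prints w p (put f A) = dbl f [holds w p A]"
  by (simp add: put_def dbl_def)

lemma wf_put: "wf_prg d (put f A) \<longleftrightarrow> wf_fm d A"
  by (simp add: put_def)

primrec puts :: "bool \<Rightarrow> fm list \<Rightarrow> prg" where
  "puts f [] = Empty"
| "puts f (A # As) = Cat (put f A) (puts f As)"

lemma prints_puts: "prints w p (puts f As) = dbl f (map (holds w p) As)"
proof (induction As)
  case (Cons A As)
  then show ?case using dbl_Cons[of f "holds w p A" "map (holds w p) As"] by (simp add: prints_put)
qed (simp add: dbl_Nil)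

lemma wf_puts: "wf_prg d (puts f As) \<longleftrightarrow> (\<forall>A\<in>set As. wf_fm d A)"
  by (induction As) (auto simp: wf_put)

text \<open>Prints a graph whose vertices are the pairs $(a, b)$ with $a < L$ and $b < N$, where
  $N$ is the number of vertices of an input graph; the pair $(a, b)$ has number $a N + b$.
  The pointers 4, 5 and 6, 7 hold the two vertices.\<close>

definition print_graph :: "bool \<Rightarrow> trm \<Rightarrow> fm list \<Rightarrow> prg" where
  "print_graph f L As = Cat (Loopb 4 L (Loopb 5 (input_size f) (put f (Lt (C 0) (V 1)))))
     (Cat (put f (Lt (C 0) (C 0)))
     (Loopb 4 L (Loopb 5 (input_size f) (Loopb 6 L (Loopb 7 (input_size f) (puts f As))))))"

lemma concat_map_mult:
  "concat (map h [0..<L * N]) = concat (map (\<lambda>a. concat (map (\<lambda>b. h (a * N + b)) [0..<N])) [0..<L])"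
proof (induction L)
  case (Suc L)
  have "[0..<Suc L * N] = [0..<L * N] @ map (\<lambda>b. b + L * N) [0..<N]"
    unfolding map_add_upt using upt_add_eq_append[of 0 "L * N" N] by (simp add: add.commute)
  then have "concat (map h [0..<Suc L * N]) = concat (map h [0..<L * N]) @ concat (map (\<lambda>b. h (L * N + b)) [0..<N])"
    by (simp only: map_append concat_append map_map o_def add.commute)
  then show ?case by (simp add: Suc)
qed simp

lemma replicate_eq_concat: "replicate n x = concat (map (\<lambda>_. [x]) [0..<n])"
  by (simp add: map_replicate_const)

lemma concat_map_cong:
  "(\<And>i. i < n \<Longrightarrow> f i = g i) \<Longrightarrow> concat (map f [0..<n]) = concat (map g [0..<n])"
  by (auto intro!: arg_cong[of _ _ concat])

text \<open>\<open>Lt (C 0) (V 1)\<close> and \<open>Lt (C 0) (C 0)\<close> act as truth and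
  falsity, the former because the input is nonempty. Looping over coordinates rather than vertex
  numbers avoids division, which terms do not have; \<open>concat_map_mult\<close> turns the nested
  loops back into a loop over numbers.\<close>

lemma prints_print_graph:
  assumes N: "p (if f then 2 else 3) = N" "N \<le> length w" and L: "tval p L = l" "l \<le> length w" "wf_trm 4 L"
    and "p 1 = length w" "0 < length w"
    and As: "\<And>a b c d. a < l \<Longrightarrow> b < N \<Longrightarrow> c < l \<Longrightarrow> d < N \<Longrightarrow>
      map (holds w (p(4 := a, 5 := b, 6 := c, 7 := d))) As = g (a * N + b) (c * N + d)"
  shows "prints w p (print_graph f L As) = dbl f (pack (l * N)
    (concat (map (\<lambda>i. concat (map (\<lambda>j. g i j) [0..<l * N])) [0..<l * N])))"
proof -
  have cong: "tval q L = l" if "\<forall>r<4. q r = p r" for q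
    using tval_cong[OF L(3) that] L(1) by simp
  have wfL: "wf_trm 6 L" using wf_trm_mono[OF L(3)] by simp
  have n: "(if f then 2 else 3 :: nat) < 4" by simp
  have loop: "prints w q (Loopb 4 L c) = concat (map (\<lambda>i. prints w (q(4 := i)) c) [0..<l])"
    "prints w q (Loopb 6 L c) = concat (map (\<lambda>i. prints w (q(6 := i)) c) [0..<l])"
    "prints w q (Loopb 5 (input_size f) c) = concat (map (\<lambda>i. prints w (q(5 := i)) c) [0..<N])"
    "prints w q (Loopb 7 (input_size f) c) = concat (map (\<lambda>i. prints w (q(7 := i)) c) [0..<N])"
    if "\<forall>r<4. q r = p r" for q c
    using that L wfL N n cong[OF that] by (subst prints_Loopb; simp)+
  have 1: "prints w p (Loopb 4 L (Loopb 5 (input_size f) (put f (Lt (C 0) (V 1))))) = dbl f (replicate (l * N) True)"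
  proof -
    have "dbl f (replicate (l * N) True) = concat (map (\<lambda>a. concat (map (\<lambda>b. dbl f [True]) [0..<N])) [0..<l])"
      unfolding replicate_eq_concat concat_map_mult dbl_concat map_map o_def ..
    then show ?thesis using assms(6,7) by (simp add: loop prints_put)
  qed
  have "prints w p (Loopb 4 L (Loopb 5 (input_size f) (Loopb 6 L (Loopb 7 (input_size f) (puts f As))))) =
    concat (map (\<lambda>a. concat (map (\<lambda>b. concat (map (\<lambda>c. concat (map (\<lambda>d.
      dbl f (map (holds w (p(4 := a, 5 := b, 6 := c, 7 := d))) As)) [0..<N])) [0..<l])) [0..<N])) [0..<l])"
    by (simp add: loop prints_puts)
  also have "\<dots> = concat (map (\<lambda>a. concat (map (\<lambda>b. concat (map (\<lambda>c. concat (map (\<lambda>d.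
      dbl f (g (a * N + b) (c * N + d))) [0..<N])) [0..<l])) [0..<N])) [0..<l])"
    by (intro concat_map_cong) (simp add: As)
  also have "\<dots> = dbl f (concat (map (\<lambda>i. concat (map (\<lambda>j. g i j) [0..<l * N])) [0..<l * N]))"
    by (simp add: concat_map_mult dbl_concat o_def)
  finally have 2: "prints w p (Loopb 4 L (Loopb 5 (input_size f) (Loopb 6 L (Loopb 7 (input_size f) (puts f As))))) = \<dots>" .
  show ?thesis
    unfolding print_graph_def prints.simps(3) 1 2
    by (simp only: prints_put pack_def dbl_append holds.simps(1) tval.simps(2) less_irrefl simp_thms)
qed

lemma wf_print_graph:
  "wf_trm 4 L \<Longrightarrow> \<forall>A\<in>set As. wf_fm 8 A \<Longrightarrow> wf_prg 4 (print_graph f L As)"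
  using wf_trm_mono[of 4 L 5] wf_trm_mono[of 4 L 7] by (simp add: print_graph_def wf_put wf_puts)

section \<open>From graphs to literal-clause graphs\<close>

definition clause_color :: "nat \<Rightarrow> (nat \<Rightarrow> nat \<Rightarrow> bool) \<Rightarrow> nat \<Rightarrow> nat \<Rightarrow> nat \<Rightarrow> nat \<Rightarrow> nat" where
  "clause_color N E a b c d =
     (if a < N \<and> E a b \<and> c = N \<and> (d = a \<or> d = b) \<or> c < N \<and> E c d \<and> a = N \<and> (b = c \<or> b = d) then 1
      else if b = d \<and> (a = N \<and> c = N + 1 \<or> a = N + 1 \<and> c = N) then 2 else 0)"

text \<open>The graph of the formula with a clause $\{x_a, x_b\}$ for every edge and an empty clause
  for every other pair $(a, b)$. Clause $(a, b)$ has number $a N + b$, the literals $x_b$ and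
  $\neg x_b$ have the numbers $N^2 + b$ and $(N + 1) N + b$.\<close>

definition clause_graph :: "graph \<Rightarrow> cgraph" where
  "clause_graph G = (case G of (N, E) \<Rightarrow>
     ((N + 2) * N, \<lambda>i j. clause_color N E (i div N) (i mod N) (j div N) (j mod N)))"

lemma bij_betw_endo:
  assumes "f ` {0..<n :: nat} \<subseteq> {0..<n}" "inj_on f {0..<n}"
  shows "bij_betw f {0..<n} {0..<n}"
  using endo_inj_surj[OF _ assms] assms(2) by (simp add: bij_betw_def)

lemma div_mod_less:
  assumes "i < k * (N :: nat)"
  shows "i div N < k" "i mod N < N" "i = (i div N) * N + i mod N"
  using assms by (simp_all add: less_mult_imp_div_less) (metis mod_less_divisor mult_0_right not_gr0 not_less0)

lemma pair_index:
  assumes "b < (N :: nat)"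
  shows "(a * N + b) div N = a" "(a * N + b) mod N = b" "a < k \<Longrightarrow> a * N + b < k * N"
proof -
  show "a * N + b < k * N" if "a < k"
  proof -
    have "a * N + b < Suc a * N" using assms by simp
    also have "\<dots> \<le> k * N" using that by (intro mult_le_mono1) simp
    finally show ?thesis .
  qed
qed (use assms in auto)

lemma clause_graph_in_LCN_class: "in_LCN_class (clause_graph (N, E))"
proof -
  define F where "F = map (\<lambda>i. if E (i div N) (i mod N) then {(i div N, True), (i mod N, True)} else {}) [0..<N * N]"
  define \<pi> where "\<pi> i = (if i div N < N then ClV i else LitV (i mod N) (i div N = N))" for i
  define \<tau> where "\<tau> v = (case v of ClV j \<Rightarrow> j | LitV i b \<Rightarrow> (if b then N else N + 1) * N + i)" for v
  have len: "length F = N * N" by (simp add: F_def)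
  have "is_3sat N F"
    by (auto simp: is_3sat_def F_def card_insert_if less_mult_imp_div_less dest: div_mod_less(2))
  moreover have "bij_betw \<pi> {0..<(N + 2) * N} (lcn_vertices N F)"
  proof (rule bij_betw_byWitness[where f' = \<tau>])
    show "\<forall>i\<in>{0..<(N + 2) * N}. \<tau> (\<pi> i) = i"
    proof
      fix i assume "i \<in> {0..<(N + 2) * N}"
      then have "i div N < N + 2" and i: "i = (i div N) * N + i mod N"
        using div_mod_less[of i "N + 2" N] by auto
      then consider "i div N < N" | "i div N = N" | "i div N = N + 1" by linarith
      then show "\<tau> (\<pi> i) = i"
        by cases (use i in \<open>simp_all add: \<tau>_def \<pi>_def\<close>)
    qed
    show "\<forall>v\<in>lcn_vertices N F. \<pi> (\<tau> v) = v"
    proof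
      fix v assume "v \<in> lcn_vertices N F"
      then consider j where "v = ClV j" "j < N * N" | i b where "v = LitV i b" "i < N"
        by (auto simp: lcn_vertices_def len)
      then show "\<pi> (\<tau> v) = v"
      proof cases
        case 1
        then show ?thesis by (simp add: \<pi>_def \<tau>_def less_mult_imp_div_less)
      next
        case 2
        then show ?thesis
          using pair_index(1,2)[OF 2(2), of "if b then N else N + 1"] by (auto simp: \<pi>_def \<tau>_def)
      qed
    qed
    show "\<pi> ` {0..<(N + 2) * N} \<subseteq> lcn_vertices N F"
    proof
      fix v assume "v \<in> \<pi> ` {0..<(N + 2) * N}"
      then obtain i where i: "v = \<pi> i" "i < (N + 2) * N" by auto
      show "v \<in> lcn_vertices N F"
        using i(1) div_mod_less[OF i(2)] pair_index(3)[of "i mod N" N "i div N" N]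
        by (auto simp: lcn_vertices_def \<pi>_def len)
    qed
    show "\<tau> ` lcn_vertices N F \<subseteq> {0..<(N + 2) * N}"
    proof
      fix i assume "i \<in> \<tau> ` lcn_vertices N F"
      then consider "i < N * N" | j b where "i = (if b then N else N + 1) * N + j" "j < N"
        by (auto simp: lcn_vertices_def \<tau>_def len)
      then show "i \<in> {0..<(N + 2) * N}"
      proof cases
        case 1
        then show ?thesis by (simp add: trans_less_add1)
      next
        case 2
        then show ?thesis using pair_index(3)[OF 2(2), of "if b then N else N + 1" "N + 2"] by auto
      qed
    qed
  qed
  moreover have "clause_color N E (i div N) (i mod N) (j div N) (j mod N) = lcn_color N F (\<pi> i) (\<pi> j)"
    if "i < (N + 2) * N" "j < (N + 2) * N" for i j
  proof -
    have F: "F ! k = (if E (k div N) (k mod N) then {(k div N, True), (k mod N, True)} else {})"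
      if "k div N < N" for k
    proof -
      have "0 < N" using that by linarith
      then have "k < N * N" using that div_less_iff_less_mult by blast
      then show ?thesis by (simp add: F_def)
    qed
    have "i div N < N + 2" "j div N < N + 2"
      using div_mod_less that by blast+
    then have "i div N < N \<or> i div N = N \<or> i div N = N + 1" "j div N < N \<or> j div N = N \<or> j div N = N + 1"
      by linarith+
    then show ?thesis
      by (elim disjE) (simp_all add: F clause_color_def lcn_color_def \<pi>_def)
  qed
  ultimately show ?thesis
    unfolding in_LCN_class_def clause_graph_def prod.case by blast
qed

lemma graph_iso_imp_clause_graph_iso:
  assumes "graph_iso (N, E) (M, F)"
  shows "cgraph_iso (clause_graph (N, E)) (clause_graph (M, F))"
proof -
  obtain \<pi> where \<pi>: "bij_betw \<pi> {0..<N} {0..<M}" "\<And>i j. i < N \<Longrightarrow> j < N \<Longrightarrow> E i j = F (\<pi> i) (\<pi> j)"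
    using assms unfolding graph_iso_def by auto
  have M: "M = N" using bij_betw_same_card[OF \<pi>(1)] by simp
  have less: "\<pi> b < N" if "b < N" for b
    using that \<pi>(1) M by (auto simp: bij_betw_def)
  have inj: "\<pi> a = \<pi> b \<longleftrightarrow> a = b" if "a < N" "b < N" for a b
    using that \<pi>(1) by (auto simp: bij_betw_def inj_on_def)
  \<comment> \<open>Rows of clauses are permuted like the vertices, while the two rows of literals
    stay in place, so signs are preserved.\<close>
  define h where "h a = (if a < N then \<pi> a else a)" for a
  define \<rho> where "\<rho> i = h (i div N) * N + \<pi> (i mod N)" for i
  have h: "h a < N + 2" "h a < N \<longleftrightarrow> a < N" "h a = N \<longleftrightarrow> a = N" "h a = N + 1 \<longleftrightarrow> a = N + 1"
    if "a < N + 2" for a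
    using that less[of a] by (auto simp: h_def)
  have h_inj: "h a = h b \<longleftrightarrow> a = b" for a b
    using less[of a] less[of b] inj[of a b] by (auto simp: h_def)
  have \<rho>: "\<rho> i div N = h (i div N)" "\<rho> i mod N = \<pi> (i mod N)" "\<rho> i < (N + 2) * N"
    if "i < (N + 2) * N" for i
    unfolding \<rho>_def
    by (rule pair_index[OF less[OF div_mod_less(2)[OF that]]] h(1)[OF div_mod_less(1)[OF that]])+
  have "inj_on \<rho> {0..<(N + 2) * N}"
  proof (rule inj_onI)
    fix i j assume ij: "i \<in> {0..<(N + 2) * N}" "j \<in> {0..<(N + 2) * N}" "\<rho> i = \<rho> j"
    then have "h (i div N) = h (j div N)" "\<pi> (i mod N) = \<pi> (j mod N)"
      using \<rho> by (metis atLeastLessThan_iff)+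
    then have "i div N = j div N" "i mod N = j mod N"
      using h_inj inj div_mod_less(2)[of i "N + 2" N] div_mod_less(2)[of j "N + 2" N] ij by auto
    then show "i = j" by (metis div_mult_mod_eq)
  qed
  then have bij: "bij_betw \<rho> {0..<(N + 2) * N} {0..<(N + 2) * N}"
    using \<rho>(3) by (intro bij_betw_endo) auto
  have "clause_color N E a b c d = clause_color N F (h a) (\<pi> b) (h c) (\<pi> d)"
    if "a < N + 2" "b < N" "c < N + 2" "d < N" for a b c d
  proof -
    have "a < N \<Longrightarrow> E a b = F (h a) (\<pi> b)" "c < N \<Longrightarrow> E c d = F (h c) (\<pi> d)"
      using that \<pi>(2) by (auto simp: h_def)
    moreover have "a < N \<Longrightarrow> \<pi> d = h a \<longleftrightarrow> d = a" "c < N \<Longrightarrow> \<pi> b = h c \<longleftrightarrow> b = c"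
      using that inj by (auto simp: h_def)
    ultimately show ?thesis
      using h(2-4)[OF that(1)] h(2-4)[OF that(3)] inj[OF that(2,4)] inj[OF that(4,2)]
      unfolding clause_color_def by (auto simp: eq_commute)
  qed
  moreover have "i div N < N + 2 \<and> i mod N < N" if "i < (N + 2) * N" for i
    using div_mod_less that by blast
  ultimately have "\<forall>i<(N + 2) * N. \<forall>j<(N + 2) * N.
      clause_color N E (i div N) (i mod N) (j div N) (j mod N) =
      clause_color N F (\<rho> i div N) (\<rho> i mod N) (\<rho> j div N) (\<rho> j mod N)"
    by (simp add: \<rho>(1,2) del: add_2_eq_Suc' mult_Suc)
  with bij show ?thesis
    unfolding cgraph_iso_def clause_graph_def M prod.case by blast
qed

lemma ex_less_bij:
  assumes "bij_betw \<rho> {0..<W} {0..<W}"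
  shows "(\<exists>k<W :: nat. P k) \<longleftrightarrow> (\<exists>k<W. P (\<rho> k))"
proof
  assume "\<exists>k<W. P k"
  then obtain k where k: "k < W" "P k" by auto
  then have "k \<in> \<rho> ` {0..<W}" using assms by (simp add: bij_betw_def)
  with k show "\<exists>k<W. P (\<rho> k)" by auto
next
  assume "\<exists>k<W. P (\<rho> k)"
  then obtain k where k: "k < W" "P (\<rho> k)" by auto
  then have "\<rho> k < W" using assms by (auto simp: bij_betw_def)
  with k show "\<exists>k<W. P k" by auto
qed

text \<open>\<open>lit\<close>, \<open>same\<close> and \<open>adj\<close> are expressed by colours
  alone, so \<rho> transports them. Evaluated in either graph they mean: being a literal, belonging
  to the same variable, and adjacency of the two variables.\<close>

lemma clause_graph_iso_imp_graph_iso: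
  assumes simple: "simple_graph (N, E)" "simple_graph (M, F)"
    and iso: "cgraph_iso (clause_graph (N, E)) (clause_graph (M, F))"
  shows "graph_iso (N, E) (M, F)"
proof -
  define col where "col E i j = clause_color N E (i div N) (i mod N) (j div N) (j mod N)" for E i j
  define W where "W = (N + 2) * N"
  obtain \<rho> where \<rho>0: "bij_betw \<rho> {0..<(N + 2) * N} {0..<(M + 2) * M}"
    and "\<forall>i<(N + 2) * N. \<forall>j<(N + 2) * N.
      clause_color N E (i div N) (i mod N) (j div N) (j mod N) =
      clause_color M F (\<rho> i div M) (\<rho> i mod M) (\<rho> j div M) (\<rho> j mod M)"
    using iso unfolding cgraph_iso_def clause_graph_def by auto
  have "(N + 2) * N = (M + 2) * M" using bij_betw_same_card[OF \<rho>0] by simp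
  moreover have mono: "(k + 2) * k < (l + 2) * l" if "k < l" for k l :: nat
    by (rule mult_strict_mono) (use that in auto)
  ultimately have M: "M = N"
    using mono[of M N] mono[of N M] by (cases M N rule: linorder_cases) simp_all
  have \<rho>: "bij_betw \<rho> {0..<W} {0..<W}" "\<And>i j. i < W \<Longrightarrow> j < W \<Longrightarrow> col E i j = col F (\<rho> i) (\<rho> j)"
    using \<rho>0 \<open>\<forall>i<(N + 2) * N. _ i\<close> by (auto simp: M W_def col_def)
  have \<rho>W: "\<rho> i < W" if "i < W" for i using \<rho>(1) that by (auto simp: bij_betw_def)
  have dm: "i div N < N + 2" "i mod N < N" if "i < W" for i
    using div_mod_less that unfolding W_def by blast+
  define lit where "lit E i \<longleftrightarrow> (\<exists>j<W. col E i j = 2)" for E i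
  define same where "same E i j \<longleftrightarrow> i = j \<or> col E i j = 2" for E i j
  \<comment> \<open>The detour through \<open>same\<close> is needed because clauses contain
    positive literals only, while the image of a positive literal may be negative. As i = j is
    allowed, a variable occurring in some clause is \<open>adj\<close> to itself; the diagonal is
    therefore treated separately, by the absence of loops.\<close>
  define adj where "adj E p q \<longleftrightarrow> (\<exists>k<W. \<exists>i<W. \<exists>j<W. \<not> lit E k \<and> same E i p \<and> same E j q \<and>
    col E k i = 1 \<and> col E k j = 1)" for E p q
  have lit: "lit E i \<longleftrightarrow> N \<le> i div N" if "i < W" for E i
  proof
    show "lit E i \<Longrightarrow> N \<le> i div N"
      by (auto simp: lit_def col_def clause_color_def split: if_splits)
    assume *: "N \<le> i div N"
    have i: "i div N < N + 2" "i mod N < N" using dm that by blast+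
    let ?a = "if i div N = N then N + 1 else N"
    have "?a * N + i mod N < W" "col E i (?a * N + i mod N) = 2"
      using pair_index(1,2)[OF i(2), of ?a] pair_index(3)[OF i(2), of ?a "N + 2"] i *
      by (auto simp: W_def col_def clause_color_def)
    then show "lit E i" unfolding lit_def by blast
  qed
  have same: "same E i j \<longleftrightarrow> i mod N = j mod N" if "i < W" "j < W" "lit E i" "lit E j" for E i j
  proof -
    have "N \<le> i div N" "N \<le> j div N" using that lit by blast+
    with dm(1)[OF that(1)] dm(1)[OF that(2)]
    have "i div N = N \<or> i div N = N + 1" "j div N = N \<or> j div N = N + 1" by linarith+
    then have "col E i j = 2 \<longleftrightarrow> i div N \<noteq> j div N \<and> i mod N = j mod N"
      by (elim disjE) (simp_all add: col_def clause_color_def)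
    moreover have "i = j \<longleftrightarrow> i div N = j div N \<and> i mod N = j mod N" by (metis div_mult_mod_eq)
    ultimately show ?thesis unfolding same_def by blast
  qed
  have same_lit: "lit E i" if "same E i j" "lit E j" "i < W" "j < W" for E i j
    using that unfolding same_def lit_def by blast
  have adj: "adj E p q \<longleftrightarrow> E (p mod N) (q mod N)"
    if "p < W" "q < W" "lit E p" "lit E q" "p mod N \<noteq> q mod N" "simple_graph (N, E)" for E p q
  proof
    have pq: "p mod N < N" "q mod N < N" using dm(2) that(1,2) by blast+
    assume "adj E p q"
    then obtain k i j where k: "k < W" "i < W" "j < W" "\<not> lit E k" "same E i p" "same E j q"
      "col E k i = 1" "col E k j = 1"
      unfolding adj_def by blast
    have l: "lit E i" "lit E j" using k that same_lit by blast+
    have ends: "E (k div N) (k mod N) \<and> (i mod N = k div N \<or> i mod N = k mod N)"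
      if "col E k i = 1" "k div N < N" "N \<le> i div N" for i
      using that unfolding col_def clause_color_def by (simp split: if_splits)
    have "k div N < N" "N \<le> i div N" "N \<le> j div N"
      using lit[OF k(1), of E] lit[OF k(2), of E] lit[OF k(3), of E] k(4) l by auto
    with ends k(7,8) have "E (k div N) (k mod N)" "i mod N = k div N \<or> i mod N = k mod N"
      "j mod N = k div N \<or> j mod N = k mod N" by blast+
    moreover have "i mod N = p mod N" "j mod N = q mod N"
      using same[of i p E] same[of j q E] k l that by blast+
    moreover have "E (k div N) (k mod N) = E (k mod N) (k div N)"
      using that(6) dm(2)[OF k(1)] \<open>k div N < N\<close> unfolding simple_graph_def by blast
    ultimately show "E (p mod N) (q mod N)"
      using that(5) by metis
  next
    have pq: "p mod N < N" "q mod N < N" using dm(2) that(1,2) by blast+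
    assume E: "E (p mod N) (q mod N)"
    let ?k = "(p mod N) * N + q mod N" and ?i = "N * N + p mod N" and ?j = "N * N + q mod N"
    have "?k < W" unfolding W_def by (rule pair_index(3)[OF pq(2)]) (use pq(1) in simp)
    moreover have "?i < W" unfolding W_def by (rule pair_index(3)[OF pq(1)]) simp
    moreover have "?j < W" unfolding W_def by (rule pair_index(3)[OF pq(2)]) simp
    ultimately have k: "?k < W" "?i < W" "?j < W" by blast+
    have "lit E ?i" "lit E ?j" "\<not> lit E ?k"
      using lit[OF k(1), of E] lit[OF k(2), of E] lit[OF k(3), of E]
      unfolding pair_index(1)[OF pq(1)] pair_index(1)[OF pq(2)] using pq(1) by auto
    moreover from this have "same E ?i p" "same E ?j q"
      using same[OF k(2) that(1), of E] same[OF k(3) that(2), of E] that(3,4)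
      unfolding pair_index(2)[OF pq(1)] pair_index(2)[OF pq(2)] by blast+
    moreover have "col E ?k ?i = 1" "col E ?k ?j = 1"
      unfolding col_def pair_index(1,2)[OF pq(1)] pair_index(1,2)[OF pq(2)]
      using E pq by (simp_all add: clause_color_def)
    ultimately show "adj E p q" using k unfolding adj_def by blast
  qed
  have lit\<rho>: "lit F (\<rho> i) \<longleftrightarrow> lit E i" if "i < W" for i
    unfolding lit_def using ex_less_bij[OF \<rho>(1), of "\<lambda>j. col F (\<rho> i) j = 2"] \<rho>(2)[OF that] by auto
  have same\<rho>: "same F (\<rho> i) (\<rho> j) \<longleftrightarrow> same E i j" if "i < W" "j < W" for i j
    using \<rho> that by (auto simp: same_def bij_betw_def inj_on_def)
  have adj\<rho>: "adj F (\<rho> p) (\<rho> q) \<longleftrightarrow> adj E p q" if "p < W" "q < W" for p q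
  proof -
    have "adj F (\<rho> p) (\<rho> q) \<longleftrightarrow> (\<exists>k<W. \<exists>i<W. \<exists>j<W. \<not> lit F (\<rho> k) \<and> same F (\<rho> i) (\<rho> p) \<and>
        same F (\<rho> j) (\<rho> q) \<and> col F (\<rho> k) (\<rho> i) = 1 \<and> col F (\<rho> k) (\<rho> j) = 1)"
      unfolding adj_def
      by (subst ex_less_bij[OF \<rho>(1)], subst (2) ex_less_bij[OF \<rho>(1)], subst (3) ex_less_bij[OF \<rho>(1)]) (rule refl)
    also have "\<dots> \<longleftrightarrow> adj E p q"
      unfolding adj_def using lit\<rho> same\<rho> \<rho>(2) that by (auto cong: conj_cong)
    finally show ?thesis .
  qed
  define x where "x b = N * N + b" for b
  have x: "x b < W" "lit E (x b)" "x b mod N = b" if "b < N" for b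
    using lit[of "x b" E] pair_index(1,2)[OF that, of N] pair_index(3)[OF that, of N "N + 2"] by (auto simp: x_def W_def)
  \<comment> \<open>Reduction modulo N forgets whether the image is a positive or a negative
    literal.\<close>
  define \<sigma> where "\<sigma> b = \<rho> (x b) mod N" for b
  have litx: "\<rho> (x b) < W" "lit F (\<rho> (x b))" if "b < N" for b
    using x[OF that] lit\<rho> \<rho>W by auto
  have inj: "a = b" if "\<sigma> a = \<sigma> b" "a < N" "b < N" for a b
  proof -
    have "same F (\<rho> (x a)) (\<rho> (x b))"
      using same litx that by (simp add: \<sigma>_def)
    then have "same E (x a) (x b)" using same\<rho> x that by simp
    then show ?thesis using same x that by metis
  qed
  have "bij_betw \<sigma> {0..<N} {0..<N}"
  proof (rule bij_betw_endo)
    show "\<sigma> ` {0..<N} \<subseteq> {0..<N}" by (auto simp: \<sigma>_def)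
    show "inj_on \<sigma> {0..<N}" using inj by (auto simp: inj_on_def)
  qed
  moreover have "E a b = F (\<sigma> a) (\<sigma> b)" if ab: "a < N" "b < N" for a b
  proof (cases "a = b")
    case True
    have "\<sigma> b < N" using ab by (auto simp: \<sigma>_def)
    then show ?thesis using True simple ab by (auto simp: simple_graph_def M)
  next
    case False
    have "E a b \<longleftrightarrow> adj E (x a) (x b)"
      using adj[of "x a" "x b" E] x ab False simple by simp
    also have "\<dots> \<longleftrightarrow> adj F (\<rho> (x a)) (\<rho> (x b))" using adj\<rho> x ab by simp
    also have "\<dots> \<longleftrightarrow> F (\<sigma> a) (\<sigma> b)"
      using adj[of "\<rho> (x a)" "\<rho> (x b)" F] litx ab False simple inj[of a b] by (auto simp: \<sigma>_def M)
    finally show ?thesis .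
  qed
  ultimately show ?thesis unfolding graph_iso_def M by auto
qed

section \<open>From literal-clause graphs to graphs\<close>

definition layer_edge :: "(nat \<Rightarrow> nat \<Rightarrow> nat) \<Rightarrow> nat \<Rightarrow> nat \<Rightarrow> nat \<Rightarrow> nat \<Rightarrow> bool" where
  "layer_edge col a u b v \<longleftrightarrow> a = 0 \<and> b = 0 \<and> col u v = 1 \<or> a = 2 \<and> b = 2 \<and> col u v = 2 \<or>
     u = v \<and> (a = 0) \<noteq> (b = 0)"

text \<open>Vertex $u$ becomes the path $(1, u) - (0, u) - (2, u)$, where $(a, u)$ has number $a N + u$.
  Edges of colour 1 are drawn between the middle vertices, edges of colour 2 between the vertices
  $(2, u)$. The vertices $(1, u)$ stay leaves, so the middle vertices are those with a leaf as
  neighbour.\<close>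

definition layered_graph :: "cgraph \<Rightarrow> graph" where
  "layered_graph G = (case G of (N, col) \<Rightarrow>
     (3 * N, \<lambda>i j. layer_edge col (i div N) (i mod N) (j div N) (j mod N)))"

text \<open>Symmetry and the zero diagonal make the layered graph simple. The bound excludes colour
  3, which two bits can express but the layers would not show.\<close>

definition valid_coloring :: "nat \<Rightarrow> (nat \<Rightarrow> nat \<Rightarrow> nat) \<Rightarrow> bool" where
  "valid_coloring N col \<longleftrightarrow> (\<forall>a<N. col a a = 0 \<and> (\<forall>b<N. col a b \<le> 2 \<and> col a b = col b a))"

lemma simple_layered_graph:
  assumes "valid_coloring N col"
  shows "simple_graph (layered_graph (N, col))"
proof -
  have "layer_edge col a u b v = layer_edge col b v a u \<and> \<not> layer_edge col a u a u"
    if "u < N" "v < N" for a b u v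
    using assms that unfolding valid_coloring_def layer_edge_def by auto
  then show ?thesis
    using div_mod_less(2)[of _ 3 N] unfolding simple_graph_def layered_graph_def prod.case by blast
qed

lemma cgraph_iso_imp_layered_graph_iso:
  assumes "cgraph_iso (N, col) (M, col')"
  shows "graph_iso (layered_graph (N, col)) (layered_graph (M, col'))"
proof -
  obtain \<pi> where \<pi>: "bij_betw \<pi> {0..<N} {0..<M}" "\<And>i j. i < N \<Longrightarrow> j < N \<Longrightarrow> col i j = col' (\<pi> i) (\<pi> j)"
    using assms unfolding cgraph_iso_def by auto
  have M: "M = N" using bij_betw_same_card[OF \<pi>(1)] by simp
  have less: "\<pi> b < N" if "b < N" for b
    using that \<pi>(1) M by (auto simp: bij_betw_def)
  have inj: "\<pi> a = \<pi> b \<longleftrightarrow> a = b" if "a < N" "b < N" for a b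
    using that \<pi>(1) by (auto simp: bij_betw_def inj_on_def)
  define \<rho> where "\<rho> i = (i div N) * N + \<pi> (i mod N)" for i
  have \<rho>: "\<rho> i div N = i div N" "\<rho> i mod N = \<pi> (i mod N)" "\<rho> i < 3 * N"
    if "i < 3 * N" for i
    unfolding \<rho>_def
    by (rule pair_index[OF less[OF div_mod_less(2)[OF that]]] div_mod_less(1)[OF that])+
  have "inj_on \<rho> {0..<3 * N}"
  proof (rule inj_onI)
    fix i j assume ij: "i \<in> {0..<3 * N}" "j \<in> {0..<3 * N}" "\<rho> i = \<rho> j"
    then have "i div N = j div N" "\<pi> (i mod N) = \<pi> (j mod N)"
      using \<rho>[of i] \<rho>[of j] by auto
    moreover have "i mod N < N" "j mod N < N" using ij div_mod_less(2)[of _ 3 N] by auto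
    ultimately have "i div N = j div N" "i mod N = j mod N"
      using inj by blast+
    then show "i = j" by (metis div_mult_mod_eq)
  qed
  then have bij: "bij_betw \<rho> {0..<3 * N} {0..<3 * N}"
    using \<rho>(3) by (intro bij_betw_endo) auto
  have "layer_edge col a u b v = layer_edge col' a (\<pi> u) b (\<pi> v)" if "u < N" "v < N" for a b u v
    using that inj[OF that] \<pi>(2)[OF that] by (simp add: layer_edge_def)
  moreover have "i mod N < N" if "i < 3 * N" for i
    using div_mod_less(2) that by blast
  ultimately have "\<forall>i<3 * N. \<forall>j<3 * N. layer_edge col (i div N) (i mod N) (j div N) (j mod N) =
      layer_edge col' (\<rho> i div N) (\<rho> i mod N) (\<rho> j div N) (\<rho> j mod N)"
    by (simp add: \<rho>(1,2))
  with bij show ?thesis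
    unfolding graph_iso_def layered_graph_def M prod.case by blast
qed

lemma all_less_bij:
  assumes "bij_betw \<rho> {0..<W} {0..<W}"
  shows "(\<forall>k<W :: nat. P k) \<longleftrightarrow> (\<forall>k<W. P (\<rho> k))"
  using ex_less_bij[OF assms, of "\<lambda>k. \<not> P k"] by blast

text \<open>Between hubs, colour 1 is adjacency, and colour 2 is the existence of a walk of length
  three whose inner vertices are not hubs. Both descriptions mention edges only, hence they are
  invariant under \<rho>.\<close>

lemma layered_graph_iso_imp_cgraph_iso:
  assumes valid: "valid_coloring N col" "valid_coloring M col'"
    and iso: "graph_iso (layered_graph (N, col)) (layered_graph (M, col'))"
  shows "cgraph_iso (N, col) (M, col')"
proof -
  define edge where "edge col i j = layer_edge col (i div N) (i mod N) (j div N) (j mod N)"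
    for col :: "nat \<Rightarrow> nat \<Rightarrow> nat" and i j
  define W where "W = 3 * N"
  obtain \<rho> where \<rho>0: "bij_betw \<rho> {0..<3 * N} {0..<3 * M}"
    and col\<rho>: "\<forall>i<3 * N. \<forall>j<3 * N.
      layer_edge col (i div N) (i mod N) (j div N) (j mod N) =
      layer_edge col' (\<rho> i div M) (\<rho> i mod M) (\<rho> j div M) (\<rho> j mod M)"
    using iso unfolding graph_iso_def layered_graph_def by auto
  have M: "M = N" using bij_betw_same_card[OF \<rho>0] by simp
  have \<rho>: "bij_betw \<rho> {0..<W} {0..<W}" "\<And>i j. i < W \<Longrightarrow> j < W \<Longrightarrow> edge col' (\<rho> i) (\<rho> j) = edge col i j"
    using \<rho>0 col\<rho> by (simp_all add: M W_def edge_def)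
  have \<rho>W: "\<rho> i < W" if "i < W" for i using \<rho>(1) that by (auto simp: bij_betw_def)
  define leaf where "leaf c x \<longleftrightarrow> (\<exists>y<W. edge c x y \<and> (\<forall>z<W. edge c x z \<longrightarrow> z = y))" for c x
  define hub where "hub c p \<longleftrightarrow> (\<exists>x<W. edge c p x \<and> leaf c x)" for c p
  define two where "two c p q \<longleftrightarrow> (\<exists>x<W. \<exists>y<W. \<not> hub c x \<and> \<not> hub c y \<and> edge c p x \<and> edge c x y \<and> edge c y q)"
    for c p q
  have edge: "edge c (a * N + u) (b * N + v) = layer_edge c a u b v" if "u < N" "v < N" for c a u b v
    unfolding edge_def pair_index(1,2)[OF that(1)] pair_index(1,2)[OF that(2)] ..
  have less: "a * N + u < W" if "a < 3" "u < N" for a u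
    unfolding W_def using that(2,1) by (rule pair_index(3))
  have two_nbrs: "\<not> leaf c x" if "edge c x y" "edge c x z" "y < W" "z < W" "y \<noteq> z" for c x y z
    using that unfolding leaf_def by blast
  have not_leaf0: "\<not> leaf c (0 * N + u)" if "u < N" for c u
  proof (rule two_nbrs)
    show "edge c (0 * N + u) (1 * N + u)" "edge c (0 * N + u) (2 * N + u)"
      unfolding edge[OF that that] layer_edge_def by simp_all
    show "1 * N + u < W" "2 * N + u < W" using that by (intro less; simp)+
    show "1 * N + u \<noteq> 2 * N + u" using that by simp
  qed
  \<comment> \<open>A middle vertex is next to the leaf (1, u). Conversely, a leaf adjacent to a
    vertex of layer 1 or 2 cannot be a middle vertex, so both lie in layer 2 and are joined by
    colour 2; but then, by symmetry of the colouring, the supposed leaf (2, v) has the two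
    neighbours (2, u) and (0, v).\<close>
  have hub: "hub c (a * N + u) \<longleftrightarrow> a = 0" if "valid_coloring N c" "a < 3" "u < N" for c a u
  proof
    assume a: "a = 0"
    have "z = 0 * N + u" if z: "z < W" "edge c (1 * N + u) z" for z
    proof -
      have z': "z mod N < N" "z = (z div N) * N + z mod N"
        using div_mod_less[of z 3 N] z(1) unfolding W_def by blast+
      then have "layer_edge c 1 u (z div N) (z mod N)"
        using z(2) edge[OF \<open>u < N\<close> z'(1), of c 1 "z div N"] by simp
      then have "z div N = 0" "z mod N = u" by (auto simp: layer_edge_def)
      with z' show ?thesis by simp
    qed
    moreover have "edge c (1 * N + u) (0 * N + u)" "edge c (0 * N + u) (1 * N + u)"
      unfolding edge[OF \<open>u < N\<close> \<open>u < N\<close>] layer_edge_def by simp_all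
    moreover have "0 * N + u < W" "1 * N + u < W" using that by (intro less; simp)+
    ultimately show "hub c (a * N + u)" unfolding hub_def leaf_def a by blast
  next
    assume "hub c (a * N + u)"
    then obtain x where x: "x < W" "edge c (a * N + u) x" "leaf c x" unfolding hub_def by blast
    define b v where "b = x div N" and "v = x mod N"
    have v: "v < N" "x = b * N + v"
      using div_mod_less[of x 3 N] x(1) unfolding W_def b_def v_def by blast+
    have e: "layer_edge c a u b v" using x(2) unfolding v(2) edge[OF \<open>u < N\<close> v(1)] .
    have b: "b \<noteq> 0"
    proof
      assume "b = 0"
      with x(3) v(2) have "leaf c (0 * N + v)" by simp
      with not_leaf0[OF v(1)] show False by blast
    qed
    show "a = 0"
    proof (rule ccontr)
      assume "a \<noteq> 0"
      with e b have ab: "a = 2" "b = 2" "c u v = 2" unfolding layer_edge_def by auto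
      have "c v u = 2" using ab(3) that(1,3) v(1) unfolding valid_coloring_def by auto
      then have "edge c (2 * N + v) (2 * N + u)" "edge c (2 * N + v) (0 * N + v)"
        unfolding edge[OF v(1) \<open>u < N\<close>] edge[OF v(1) v(1)] layer_edge_def by simp_all
      moreover have "2 * N + u < W" "0 * N + v < W" using that v by (intro less; simp)+
      moreover have "2 * N + u \<noteq> 0 * N + v" using v by simp
      ultimately have "\<not> leaf c (2 * N + v)" by (rule two_nbrs)
      then show False using x(3) v(2) ab(2) by simp
    qed
  qed
  have hub': "hub c p \<longleftrightarrow> p < N" if "valid_coloring N c" "p < W" for c p
  proof -
    have p: "p div N < 3" "p mod N < N" "p = (p div N) * N + p mod N"
      using div_mod_less[of p 3 N] that(2) unfolding W_def by blast+
    then have "hub c p \<longleftrightarrow> p div N = 0" using hub[OF that(1) p(1,2)] by simp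
    also have "\<dots> \<longleftrightarrow> p < N" using p(2) by (cases "N = 0") (simp_all only: div_eq_0_iff simp_thms less_zeroE)
    finally show ?thesis .
  qed
  have one: "edge c p q \<longleftrightarrow> c p q = 1" if "p < N" "q < N" for c p q
    using edge[OF that, of c 0 0] by (simp add: layer_edge_def)
  \<comment> \<open>Outside the hubs the vertex (1, p) has no neighbours, so the walk must be p, (2,
    p), (2, q), q, and its middle edge is a colour-2 edge.\<close>
  have two: "two c p q \<longleftrightarrow> c p q = 2" if "valid_coloring N c" "p < N" "q < N" for c p q
  proof
    assume "c p q = 2"
    then have "edge c (0 * N + p) (2 * N + p)" "edge c (2 * N + p) (2 * N + q)" "edge c (2 * N + q) (0 * N + q)"
      unfolding edge[OF that(2,2)] edge[OF that(2,3)] edge[OF that(3,3)] layer_edge_def by simp_all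
    moreover have "2 * N + p < W" "2 * N + q < W" using that by (intro less; simp)+
    moreover have "\<not> hub c (2 * N + p)" "\<not> hub c (2 * N + q)" using hub that by simp_all
    ultimately show "two c p q" unfolding two_def by auto
  next
    assume "two c p q"
    then obtain x y where xy: "x < W" "y < W" "\<not> hub c x" "\<not> hub c y" "edge c p x" "edge c x y" "edge c y q"
      unfolding two_def by blast
    define a u b v where "a = x div N" and "u = x mod N" and "b = y div N" and "v = y mod N"
    have x: "a < 3" "u < N" "x = a * N + u" and y: "b < 3" "v < N" "y = b * N + v"
      using div_mod_less[of x 3 N] div_mod_less[of y 3 N] xy(1,2)
      unfolding W_def a_def u_def b_def v_def by blast+
    have ab: "a \<noteq> 0" "b \<noteq> 0" using xy(3,4) hub[OF that(1) x(1,2)] hub[OF that(1) y(1,2)] x(3) y(3) by auto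
    have "layer_edge c 0 p a u" "layer_edge c a u b v" "layer_edge c b v 0 q"
      using xy(5-7) edge[OF that(2) x(2), of c 0 a] edge[OF x(2) y(2), of c a b] edge[OF y(2) that(3), of c b 0]
        x(3) y(3) by simp_all
    with ab show "c p q = 2" unfolding layer_edge_def by auto
  qed
  have leaf\<rho>: "leaf col' (\<rho> x) \<longleftrightarrow> leaf col x" if "x < W" for x
  proof -
    have "\<rho> z = \<rho> y \<longleftrightarrow> z = y" if "z < W" "y < W" for z y
      using that \<rho>(1) by (auto simp: bij_betw_def inj_on_def)
    then show ?thesis
      unfolding leaf_def using \<rho>(2)[OF that]
      by (subst ex_less_bij[OF \<rho>(1)], subst all_less_bij[OF \<rho>(1)]) (auto cong: conj_cong)
  qed
  have hub\<rho>: "hub col' (\<rho> x) \<longleftrightarrow> hub col x" if "x < W" for x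
    unfolding hub_def using \<rho>(2)[OF that] leaf\<rho>
    by (subst ex_less_bij[OF \<rho>(1)]) (auto cong: conj_cong)
  have two\<rho>: "two col' (\<rho> p) (\<rho> q) \<longleftrightarrow> two col p q" if "p < W" "q < W" for p q
  proof -
    have "two col' (\<rho> p) (\<rho> q) \<longleftrightarrow> (\<exists>x<W. \<exists>y<W. \<not> hub col' (\<rho> x) \<and> \<not> hub col' (\<rho> y) \<and>
        edge col' (\<rho> p) (\<rho> x) \<and> edge col' (\<rho> x) (\<rho> y) \<and> edge col' (\<rho> y) (\<rho> q))"
      unfolding two_def by (subst ex_less_bij[OF \<rho>(1)], subst (2) ex_less_bij[OF \<rho>(1)]) (rule refl)
    also have "\<dots> \<longleftrightarrow> two col p q"
      unfolding two_def using hub\<rho> \<rho>(2) that by (auto cong: conj_cong)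
    finally show ?thesis .
  qed
  have NW: "p < W" if "p < N" for p using that by (simp add: W_def)
  have \<rho>N: "\<rho> p < N" if "p < N" for p
    using hub\<rho>[OF NW[OF that]] hub'[OF valid(1) NW[OF that]] hub'[OF _ \<rho>W[OF NW[OF that]], of col']
      valid(2) that M by simp
  \<comment> \<open>The vertex (0, u) has number u, so the restriction of \<rho> to the hubs is
    already the isomorphism sought.\<close>
  have "bij_betw \<rho> {0..<N} {0..<N}"
    using \<rho>N inj_on_subset[of \<rho> "{0..<W}" "{0..<N}"] \<rho>(1)
    by (intro bij_betw_endo) (auto simp: bij_betw_def W_def)
  moreover have "col i j = col' (\<rho> i) (\<rho> j)" if "i < N" "j < N" for i j
  proof -
    have "col i j = 1 \<longleftrightarrow> col' (\<rho> i) (\<rho> j) = 1"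
      using one[OF that, of col] one[OF \<rho>N[OF that(1)] \<rho>N[OF that(2)], of col'] \<rho>(2) that NW by simp
    moreover have "col i j = 2 \<longleftrightarrow> col' (\<rho> i) (\<rho> j) = 2"
      using two[OF valid(1) that] two[OF _ \<rho>N[OF that(1)] \<rho>N[OF that(2)], of col'] valid(2) M
        two\<rho> that NW by simp
    moreover have "col i j \<le> 2" "col' (\<rho> i) (\<rho> j) \<le> 2"
      using valid that \<rho>N M unfolding valid_coloring_def by blast+
    ultimately show ?thesis by linarith
  qed
  ultimately show ?thesis unfolding cgraph_iso_def M by auto
qed

section \<open>A first-order description of literal-clause graphs\<close>

definition literal_vertex :: "nat \<Rightarrow> (nat \<Rightarrow> nat \<Rightarrow> nat) \<Rightarrow> nat \<Rightarrow> bool" where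
  "literal_vertex N col a \<longleftrightarrow> (\<exists>b<N. col a b = 2)"

text \<open>Only vertices and colours are quantified, so that \<open>lcn_fm\<close> can express it.
  Forbidding four neighbours in increasing order bounds the size of a clause without
  counting.\<close>

definition lcn_coloring :: "nat \<Rightarrow> (nat \<Rightarrow> nat \<Rightarrow> nat) \<Rightarrow> bool" where
  "lcn_coloring N col \<longleftrightarrow> valid_coloring N col \<and>
     (\<forall>a<N. \<forall>b<N. \<forall>c<N. col a b = 2 \<and> col a c = 2 \<longrightarrow> b = c) \<and>
     (\<forall>a<N. \<forall>b<N. col a b = 1 \<longrightarrow> literal_vertex N col a \<noteq> literal_vertex N col b) \<and>
     (\<forall>a<N. \<not> literal_vertex N col a \<longrightarrow> (\<forall>b<N. \<forall>c<N. \<forall>d<N. \<forall>e<N. b < c \<and> c < d \<and> d < e \<longrightarrow>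
        \<not> (col a b = 1 \<and> col a c = 1 \<and> col a d = 1 \<and> col a e = 1)))"

lemma in_LCN_class_imp_lcn_coloring:
  assumes "in_LCN_class (N, col)"
  shows "lcn_coloring N col"
proof -
  obtain n F \<pi> where F: "is_3sat n F" and \<pi>: "bij_betw \<pi> {0..<N} (lcn_vertices n F)"
    and col: "\<And>i j. i < N \<Longrightarrow> j < N \<Longrightarrow> col i j = lcn_color n F (\<pi> i) (\<pi> j)"
    using assms unfolding in_LCN_class_def by auto
  have inj: "\<pi> a = \<pi> b \<longleftrightarrow> a = b" if "a < N" "b < N" for a b
    using that \<pi> by (auto simp: bij_betw_def inj_on_def)
  have \<pi>V: "\<pi> a \<in> lcn_vertices n F" if "a < N" for a
    using that \<pi> by (auto simp: bij_betw_def)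
  \<comment> \<open>The complement of a literal is always a vertex too, so a literal vertex has a
    colour-2 edge even if it occurs in no clause.\<close>
  have lit: "literal_vertex N col a \<longleftrightarrow> (\<exists>i b. \<pi> a = LitV i b)" if a: "a < N" for a
  proof
    assume "literal_vertex N col a"
    then show "\<exists>i b. \<pi> a = LitV i b"
      using col a by (cases "\<pi> a") (auto simp: literal_vertex_def lcn_color_def split: lcn_vertex.splits if_splits)
  next
    assume "\<exists>i b. \<pi> a = LitV i b"
    then obtain i b where ib: "\<pi> a = LitV i b" by blast
    then have "LitV i (\<not> b) \<in> lcn_vertices n F"
      using \<pi>V[OF a] by (auto simp: lcn_vertices_def)
    then have "LitV i (\<not> b) \<in> \<pi> ` {0..<N}" using \<pi> by (simp add: bij_betw_def)
    then obtain c where c: "c < N" "\<pi> c = LitV i (\<not> b)"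
      by (elim imageE) auto
    then have "col a c = 2" using col[OF a c(1)] ib by (simp add: lcn_color_def)
    with c(1) show "literal_vertex N col a" by (auto simp: literal_vertex_def)
  qed
  have sym: "lcn_color n F u v = lcn_color n F v u" and le: "lcn_color n F u v \<le> 2"
    and diag: "lcn_color n F u u = 0" for u v
    by (auto simp: lcn_color_def split: lcn_vertex.splits)
  have "valid_coloring N col"
    unfolding valid_coloring_def using col sym le diag by simp
  moreover have "b = c" if "a < N" "b < N" "c < N" "col a b = 2" "col a c = 2" for a b c
  proof -
    have "\<pi> b = \<pi> c"
      using that col by (auto simp: lcn_color_def split: lcn_vertex.splits if_splits)
    then show ?thesis using inj that by blast
  qed
  moreover have "literal_vertex N col a \<noteq> literal_vertex N col b" if "a < N" "b < N" "col a b = 1" for a b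
    using that(3) unfolding lit[OF that(1)] lit[OF that(2)] col[OF that(1,2)]
    by (auto simp: lcn_color_def split: lcn_vertex.splits if_splits)
  moreover have False if a: "a < N" "\<not> literal_vertex N col a"
    and l: "b < N" "c < N" "d < N" "e < N" "b < c" "c < d" "d < e"
    and one: "col a b = 1" "col a c = 1" "col a d = 1" "col a e = 1" for a b c d e
  proof -
    \<comment> \<open>Reads the literal at a vertex; the default is never reached, as
      \<open>f\<close> is applied to neighbours of a clause vertex only. Four neighbours would give
      four distinct members of one clause.\<close>
    define f where "f v = (case \<pi> v of LitV i b \<Rightarrow> (i, b) | ClV j \<Rightarrow> undefined)" for v
    obtain j where j: "\<pi> a = ClV j" using a lit by (cases "\<pi> a") auto
    have "j < length F" using \<pi>V[OF a(1)] j by (auto simp: lcn_vertices_def)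
    then have Fj: "finite (F ! j)" "card (F ! j) \<le> 3" using F by (auto simp: is_3sat_def)
    have f: "f v \<in> F ! j \<and> \<pi> v = LitV (fst (f v)) (snd (f v))" if "v < N" "col a v = 1" for v
      using that(2) unfolding col[OF a(1) that(1)]
      by (auto simp: lcn_color_def j f_def split: lcn_vertex.splits if_splits)
    have "inj_on f {b, c, d, e}"
    proof (rule inj_onI)
      fix u v assume uv: "u \<in> {b, c, d, e}" "v \<in> {b, c, d, e}" "f u = f v"
      then have "u < N" "col a u = 1" "v < N" "col a v = 1" using l one by auto
      then have "\<pi> u = \<pi> v" using f uv(3) by metis
      then show "u = v" using inj \<open>u < N\<close> \<open>v < N\<close> by blast
    qed
    then have "card (f ` {b, c, d, e}) = 4" using l by (simp add: card_image)
    moreover have "f ` {b, c, d, e} \<subseteq> F ! j" using f l one by auto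
    ultimately have "4 \<le> card (F ! j)" using card_mono[OF Fj(1)] by metis
    with Fj(2) show False by simp
  qed
  ultimately show ?thesis unfolding lcn_coloring_def by blast
qed

lemma card_le_3I:
  fixes A :: "nat set"
  assumes "finite A" "\<And>b c d e. b \<in> A \<Longrightarrow> c \<in> A \<Longrightarrow> d \<in> A \<Longrightarrow> e \<in> A \<Longrightarrow> b < c \<Longrightarrow> c < d \<Longrightarrow> d < e \<Longrightarrow> False"
  shows "card A \<le> 3"
proof (rule ccontr)
  assume c: "\<not> card A \<le> 3"
  define l where "l = sorted_list_of_set A"
  have l: "length l = card A" "set l = A" "sorted_wrt (<) l"
    using assms(1) by (simp_all add: l_def)
  have nth: "l ! i \<in> A" if "i < 4" for i
    using that c nth_mem[of i l] unfolding l(1,2) by simp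
  have "l ! 0 < l ! 1" "l ! 1 < l ! 2" "l ! 2 < l ! 3"
    using c l(1) sorted_wrt_nth_less[OF l(3), of 0 1] sorted_wrt_nth_less[OF l(3), of 1 2]
      sorted_wrt_nth_less[OF l(3), of 2 3] by simp_all
  then show False using assms(2)[OF nth[of 0] nth[of 1] nth[of 2] nth[of 3]] by simp
qed

text \<open>The formula is reconstructed from the graph: one variable per matched pair and one
  clause per unmatched vertex, consisting of the literals at its colour-1 neighbours. Which end of a
  pair is the positive literal is arbitrary; the smaller one is taken.\<close>

lemma lcn_coloring_imp_in_LCN_class:
  assumes "lcn_coloring N col"
  shows "in_LCN_class (N, col)"
proof -
  let ?L = "literal_vertex N col"
  note parts = assms[unfolded lcn_coloring_def]
  note valid = conjunct1[OF parts, unfolded valid_coloring_def]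
  have diag: "col a a = 0" if "a < N" for a using valid that by blast
  have le2: "col a b \<le> 2" if "a < N" "b < N" for a b using valid that by blast
  have sym: "col a b = col b a" if "a < N" "b < N" for a b using valid that by blast
  have unique: "b = c" if "col a b = 2" "col a c = 2" "a < N" "b < N" "c < N" for a b c
    using conjunct1[OF conjunct2[OF parts]] that by blast
  have cross: "?L a \<noteq> ?L b" if "col a b = 1" "a < N" "b < N" for a b
    using conjunct1[OF conjunct2[OF conjunct2[OF parts]]] that by blast
  have deg: "card {b. b < N \<and> col a b = 1} \<le> 3" if a: "a < N" "\<not> ?L a" for a
  proof (rule card_le_3I)
    fix b c d e
    assume "b \<in> {b. b < N \<and> col a b = 1}" "c \<in> {b. b < N \<and> col a b = 1}"
      "d \<in> {b. b < N \<and> col a b = 1}" "e \<in> {b. b < N \<and> col a b = 1}" "b < c" "c < d" "d < e"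
    then show False
      using conjunct2[OF conjunct2[OF conjunct2[OF parts]]] a by blast
  qed simp
  define m where "m a = (SOME b. b < N \<and> col a b = 2)" for a
  have m: "m a < N" "col a (m a) = 2" if "?L a" for a
    using that someI_ex[of "\<lambda>b. b < N \<and> col a b = 2"] unfolding literal_vertex_def m_def by auto
  have mL: "?L (m a)" "m (m a) = a" "m a \<noteq> a" if "?L a" "a < N" for a
  proof -
    have ma: "col (m a) a = 2" using sym[OF m(1)[OF that(1)] that(2)] m(2)[OF that(1)] by simp
    then show L: "?L (m a)" using that(2) unfolding literal_vertex_def by blast
    show "m (m a) = a" using unique m(1)[OF L] m(2)[OF L] ma m(1)[OF that(1)] that(2) by blast
    show "m a \<noteq> a" using ma diag[OF that(2)] by auto
  qed
  define R where "R = {a. a < N \<and> ?L a \<and> a < m a}"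
  define Cl where "Cl = {a. a < N \<and> \<not> ?L a}"
  have fin: "finite R" "finite Cl" by (simp_all add: R_def Cl_def)
  obtain r where r: "bij_betw r {0..<card R} R" using ex_bij_betw_nat_finite[OF fin(1)] by blast
  obtain cl where cl: "bij_betw cl {0..<card Cl} Cl" using ex_bij_betw_nat_finite[OF fin(2)] by blast
  define n where "n = card R"
  define node where "node i b = (if b then r i else m (r i))" for i b
  define F where "F = map (\<lambda>j. {(i, b). i < n \<and> col (cl j) (node i b) = 1}) [0..<card Cl]"
  define \<tau> where "\<tau> v = (case v of LitV i b \<Rightarrow> node i b | ClV j \<Rightarrow> cl j)" for v
  have rR: "r i < N" "?L (r i)" "r i < m (r i)" if "i < n" for i
    using that r by (auto simp: bij_betw_def R_def n_def)
  have r_inj: "r i = r j \<longleftrightarrow> i = j" if "i < n" "j < n" for i j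
    using that r by (auto simp: bij_betw_def inj_on_def n_def)
  have node: "node i b < N" "?L (node i b)" "m (node i b) = node i (\<not> b)" if "i < n" for i b
    using rR(1,2)[OF that] m(1)[OF rR(2)[OF that]] mL(1,2)[OF rR(2,1)[OF that]]
    by (simp_all add: node_def)
  have node_inj: "node i b = node j c \<longleftrightarrow> i = j \<and> b = c" if "i < n" "j < n" for i b j c
  proof
    assume eq: "node i b = node j c"
    \<comment> \<open>The sign can be recovered from the order of the two ends of a matched
      pair.\<close>
    have lt: "node i b < m (node i b) \<longleftrightarrow> b" if "i < n" for i b
      using rR[OF that] mL[OF rR(2,1)[OF that]] by (simp add: node_def)
    have bc: "b = c" using lt[OF that(1), of b] lt[OF that(2), of c] eq by simp
    have "node i True = node j True"
      using eq bc node(3)[OF that(1), of b] node(3)[OF that(2), of c] by (cases b) auto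
    then show "i = j \<and> b = c" using bc r_inj that by (simp add: node_def)
  qed auto
  have clN: "cl j < N" "\<not> ?L (cl j)" if "j < card Cl" for j
    using that cl by (auto simp: bij_betw_def Cl_def)
  have cl_inj: "cl i = cl j \<longleftrightarrow> i = j" if "i < card Cl" "j < card Cl" for i j
    using that cl by (auto simp: bij_betw_def inj_on_def)
  have ex_r: "\<exists>i<n. r i = a" if "a \<in> R" for a
  proof -
    have "a \<in> r ` {0..<card R}" using r that by (simp add: bij_betw_def)
    then show ?thesis by (auto simp: n_def)
  qed
  have ex_cl: "\<exists>j<card Cl. cl j = a" if "a \<in> Cl" for a
  proof -
    have "a \<in> cl ` {0..<card Cl}" using cl that by (simp add: bij_betw_def)
    then show ?thesis by auto
  qed
  have len: "length F = card Cl" by (simp add: F_def)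
  have Fj: "F ! j = {(i, b). i < n \<and> col (cl j) (node i b) = 1}" if "j < card Cl" for j
    using that by (simp add: F_def)
  have "is_3sat n F"
    unfolding is_3sat_def
  proof
    fix c assume "c \<in> set F"
    then obtain j where "j < length F" "c = F ! j" unfolding in_set_conv_nth by blast
    then have j: "j < card Cl" and c: "c = {(i, b). i < n \<and> col (cl j) (node i b) = 1}"
      unfolding len using Fj by simp_all
    have inj: "inj_on (\<lambda>(i, b). node i b) c"
    proof (rule inj_onI)
      fix x y assume xy: "x \<in> c" "y \<in> c" "(case x of (i, b) \<Rightarrow> node i b) = (case y of (i, b) \<Rightarrow> node i b)"
      obtain i b k d where "x = (i, b)" "y = (k, d)" by (metis surj_pair)
      with xy node_inj[of i k b d] show "x = y" unfolding c by simp
    qed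
    have sub: "(\<lambda>(i, b). node i b) ` c \<subseteq> {b. b < N \<and> col (cl j) b = 1}"
      unfolding c using node(1) by auto
    have "finite ((\<lambda>(i, b). node i b) ` c)" by (rule finite_subset[OF sub]) simp
    then have "finite c" using inj finite_imageD by blast
    moreover have "card c \<le> 3"
      using card_mono[OF _ sub] card_image[OF inj] deg[OF clN[OF j]] by simp
    moreover have "\<forall>(i, b)\<in>c. i < n" unfolding c by auto
    ultimately show "finite c \<and> card c \<le> 3 \<and> (\<forall>(i, b)\<in>c. i < n)" by blast
  qed
  moreover have bij: "bij_betw \<tau> (lcn_vertices n F) {0..<N}"
    unfolding bij_betw_def
  proof
    show "inj_on \<tau> (lcn_vertices n F)"
    proof (rule inj_onI)
      fix u v assume uv: "u \<in> lcn_vertices n F" "v \<in> lcn_vertices n F" "\<tau> u = \<tau> v"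
      have ncl: "node i b \<noteq> cl j" if "i < n" "j < card Cl" for i b j
        using node(2)[OF that(1), of b] clN(2)[OF that(2)] by auto
      show "u = v"
      proof (cases u; cases v)
        fix i b k c assume "u = LitV i b" "v = LitV k c"
        then show ?thesis using uv node_inj[of i k b c] by (simp add: lcn_vertices_def \<tau>_def)
      next
        fix i b j assume "u = LitV i b" "v = ClV j"
        then show ?thesis using uv ncl[of i j b] by (simp add: lcn_vertices_def \<tau>_def len)
      next
        fix i b j assume "u = ClV j" "v = LitV i b"
        then show ?thesis using uv ncl[of i j b] by (simp add: lcn_vertices_def \<tau>_def len)
      next
        fix i j assume "u = ClV i" "v = ClV j"
        then show ?thesis using uv cl_inj[of i j] by (simp add: lcn_vertices_def \<tau>_def len)
      qed
    qed
    show "\<tau> ` lcn_vertices n F = {0..<N}"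
    proof
      show "\<tau> ` lcn_vertices n F \<subseteq> {0..<N}"
        using node(1) clN(1) by (auto simp: lcn_vertices_def len \<tau>_def)
      show "{0..<N} \<subseteq> \<tau> ` lcn_vertices n F"
      proof
        fix a assume "a \<in> {0..<N}"
        then have a: "a < N" by simp
        consider "a \<in> R" | "m a \<in> R" "?L a" | "a \<in> Cl"
        proof (cases "?L a")
          case True
          then have "a < m a \<or> m a < a" using mL(3)[OF True a] by linarith
          with True that(1,2) a m(1)[OF True] mL(1,2)[OF True a] show thesis by (auto simp: R_def)
        next
          case False
          with that(3) a show thesis by (simp add: Cl_def)
        qed
        then show "a \<in> \<tau> ` lcn_vertices n F"
        proof cases
          case 1
          then obtain i where "i < n" "r i = a" using ex_r by blast
          then show ?thesis
            by (intro image_eqI[of _ _ "LitV i True"]) (auto simp: \<tau>_def node_def lcn_vertices_def)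
        next
          case 2
          then obtain i where "i < n" "r i = m a" using ex_r by blast
          then show ?thesis using mL(2)[OF 2(2) a]
            by (intro image_eqI[of _ _ "LitV i False"]) (auto simp: \<tau>_def node_def lcn_vertices_def)
        next
          case 3
          then obtain j where "j < card Cl" "cl j = a" using ex_cl by blast
          then show ?thesis
            by (intro image_eqI[of _ _ "ClV j"]) (auto simp: \<tau>_def lcn_vertices_def len)
        qed
      qed
    qed
  qed
  moreover have color: "col (\<tau> u) (\<tau> v) = lcn_color n F u v"
    if "u \<in> lcn_vertices n F" "v \<in> lcn_vertices n F" for u v
  proof -
    have two: "col (node i b) (node j c) = (if i = j \<and> b \<noteq> c then 2 else 0)" if "i < n" "j < n" for i b j c
    proof -
      note N = node(1)[OF that(1), of b] node(1)[OF that(2), of c]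
      note L = node(2)[OF that(1), of b] node(2)[OF that(2), of c]
      have "col (node i b) (node j c) \<noteq> 1" using cross[OF _ N] L by blast
      moreover have "col (node i b) (node j c) = 2 \<longleftrightarrow> node j c = m (node i b)"
        using unique[of "node i b" "node j c" "m (node i b)"] m[OF L(1)] N by auto
      moreover have "node j c = m (node i b) \<longleftrightarrow> i = j \<and> b \<noteq> c"
        unfolding node(3)[OF that(1)] node_inj[OF that(2,1)] by auto
      ultimately show ?thesis using le2[OF N] by (cases "i = j \<and> b \<noteq> c") auto
    qed
    have lc: "col (cl j) (node i b) = (if (i, b) \<in> F ! j then 1 else 0)" if "i < n" "j < card Cl" for i b j
    proof -
      note N = node(1)[OF that(1), of b] clN(1)[OF that(2)]
      have "col (cl j) (node i b) \<noteq> 2"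
        using clN(2)[OF that(2)] N unfolding literal_vertex_def by blast
      then have "col (cl j) (node i b) = (if col (cl j) (node i b) = 1 then 1 else 0)"
        using le2[OF N(2,1)] by simp
      then show ?thesis using that(1) unfolding Fj[OF that(2)] by simp
    qed
    have cl': "col (node i b) (cl j) = col (cl j) (node i b)" if "i < n" "j < card Cl" for i b j
      by (rule sym[OF node(1)[OF that(1)] clN(1)[OF that(2)]])
    have cc: "col (cl i) (cl j) = 0" if "i < card Cl" "j < card Cl" for i j
    proof -
      note N = clN(1)[OF that(1)] clN(1)[OF that(2)]
      have "col (cl i) (cl j) \<noteq> 2"
        using clN(2)[OF that(1)] N unfolding literal_vertex_def by blast
      moreover have "col (cl i) (cl j) \<noteq> 1"
        using cross[OF _ N] clN(2)[OF that(1)] clN(2)[OF that(2)] by blast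
      ultimately show ?thesis using le2[OF N] by linarith
    qed
    show ?thesis
      using that two lc cl' cc by (cases u; cases v) (simp_all add: lcn_vertices_def len \<tau>_def lcn_color_def)
  qed
  let ?\<pi> = "the_inv_into (lcn_vertices n F) \<tau>"
  have "bij_betw ?\<pi> {0..<N} (lcn_vertices n F)"
    using bij by (rule bij_betw_the_inv_into)
  moreover have "col i j = lcn_color n F (?\<pi> i) (?\<pi> j)" if "i < N" "j < N" for i j
  proof -
    have \<pi>: "?\<pi> k \<in> lcn_vertices n F" "\<tau> (?\<pi> k) = k" if "k < N" for k
      using that bij_betw_apply[OF \<open>bij_betw ?\<pi> _ _\<close>, of k] f_the_inv_into_f_bij_betw[OF bij, of k] by simp_all
    show ?thesis
      using color[OF \<pi>(1)[OF that(1)] \<pi>(1)[OF that(2)]] unfolding \<pi>(2)[OF that(1)] \<pi>(2)[OF that(2)] .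
  qed
  ultimately show ?thesis unfolding in_LCN_class_def prod.case by blast
qed

section \<open>The two reductions\<close>

lemma concat_blocks:
  assumes "\<And>i. i < m \<Longrightarrow> length (f i) = l"
  shows "length (concat (map f [0..<m])) = m * l"
    and "a < m \<Longrightarrow> b < l \<Longrightarrow> concat (map f [0..<m]) ! (a * l + b) = f a ! b"
proof -
  have "length (concat (map f [0..<m])) = m * l \<and>
    (\<forall>a<m. \<forall>b<l. concat (map f [0..<m]) ! (a * l + b) = f a ! b)"
    using assms
  proof (induction m)
    case (Suc m)
    then have len: "length (concat (map f [0..<m])) = m * l" by auto
    have "concat (map f [0..<Suc m]) ! (a * l + b) = f a ! b" if "a < Suc m" "b < l" for a b
    proof (cases "a = m")
      case True
      then show ?thesis using len by (simp add: nth_append)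
    next
      case False
      then have "a < m" using that by simp
      then show ?thesis
        using Suc that pair_index(3)[OF that(2) \<open>a < m\<close>] len by (simp add: nth_append)
    qed
    then show ?case using len Suc.prems by simp
  qed simp
  then show "length (concat (map f [0..<m])) = m * l"
    and "a < m \<Longrightarrow> b < l \<Longrightarrow> concat (map f [0..<m]) ! (a * l + b) = f a ! b"
    by blast+
qed

definition graph_bits :: "nat \<Rightarrow> (nat \<Rightarrow> nat \<Rightarrow> bool) \<Rightarrow> bool list" where
  "graph_bits N E = concat (map (\<lambda>i. map (\<lambda>j. E i j) [0..<N]) [0..<N])"

definition cgraph_bits :: "nat \<Rightarrow> (nat \<Rightarrow> nat \<Rightarrow> nat) \<Rightarrow> bool list" where
  "cgraph_bits N col = concat (map (\<lambda>i. concat (map (\<lambda>j. enc_color (col i j)) [0..<N])) [0..<N])"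

lemma enc_graph_pack: "enc_graph (N, E) = pack N (graph_bits N E)"
  by (simp add: enc_graph_def pack_def graph_bits_def)

lemma enc_cgraph_pack: "enc_cgraph (N, col) = pack N (cgraph_bits N col)"
  by (simp add: enc_cgraph_def pack_def cgraph_bits_def)

lemma length_graph_bits: "length (graph_bits N E) = N * N"
  unfolding graph_bits_def by (rule concat_blocks) simp

lemma nth_graph_bits: "a < N \<Longrightarrow> b < N \<Longrightarrow> graph_bits N E ! (a * N + b) = E a b"
  unfolding graph_bits_def by (subst concat_blocks) auto

lemma length_enc_color: "length (enc_color c) = 2"
  by (simp add: enc_color_def)

lemma length_row: "length (concat (map (\<lambda>j. enc_color (col i j)) [0..<N])) = N * 2"
  by (rule concat_blocks) (rule length_enc_color)

lemma length_cgraph_bits: "length (cgraph_bits N col) = 2 * (N * N)"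
  unfolding cgraph_bits_def by (subst concat_blocks(1)[where l = "N * 2"]) (simp_all add: length_row)

lemma nth_cgraph_bits:
  assumes "a < N" "b < N" "k < 2"
  shows "cgraph_bits N col ! (2 * (a * N + b) + k) = enc_color (col a b) ! k"
proof -
  have "b * 2 + k < N * 2" using assms by linarith
  then have "cgraph_bits N col ! (a * (N * 2) + (b * 2 + k)) =
      concat (map (\<lambda>j. enc_color (col a j)) [0..<N]) ! (b * 2 + k)"
    unfolding cgraph_bits_def using assms(1) by (intro concat_blocks(2)) (auto simp: length_row)
  also have "\<dots> = enc_color (col a b) ! k"
    using assms by (intro concat_blocks(2)) (auto simp: length_enc_color)
  finally show ?thesis by (simp add: algebra_simps)
qed

section \<open>Reading graphs back from words\<close>

definition bits_graph :: "nat \<Rightarrow> bool list \<Rightarrow> nat \<Rightarrow> nat \<Rightarrow> bool" where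
  "bits_graph N z a b = z ! (a * N + b)"

text \<open>The bit pattern for colour 3 is decoded as such, which makes decoding an exact inverse
  on words of the right length; \<open>valid_fm\<close> rejects it later.\<close>

definition bits_cgraph :: "nat \<Rightarrow> bool list \<Rightarrow> nat \<Rightarrow> nat \<Rightarrow> nat" where
  "bits_cgraph N z a b = (if z ! (2 * (a * N + b)) then 2 else 0) + (if z ! (2 * (a * N + b) + 1) then 1 else 0)"

lemma graph_bits_bits_graph:
  assumes "length z = N * N"
  shows "graph_bits N (bits_graph N z) = z"
proof (rule nth_equalityI)
  fix i assume "i < length (graph_bits N (bits_graph N z))"
  then have i: "i < N * N" by (simp add: length_graph_bits)
  note dm = div_mod_less[OF i]
  have "graph_bits N (bits_graph N z) ! ((i div N) * N + i mod N) = z ! ((i div N) * N + i mod N)"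
    using nth_graph_bits[OF dm(1,2)] by (simp only: bits_graph_def)
  then show "graph_bits N (bits_graph N z) ! i = z ! i" using dm(3) by simp
qed (simp add: assms length_graph_bits)

lemma enc_color_bits_cgraph:
  "k < 2 \<Longrightarrow> enc_color (bits_cgraph N z a b) ! k = z ! (2 * (a * N + b) + k)"
  by (cases k) (auto simp: enc_color_def bits_cgraph_def)

lemma cgraph_bits_bits_cgraph:
  assumes "length z = 2 * (N * N)"
  shows "cgraph_bits N (bits_cgraph N z) = z"
proof (rule nth_equalityI)
  fix i assume "i < length (cgraph_bits N (bits_cgraph N z))"
  then have i: "i div 2 < N * N" by (simp add: length_cgraph_bits)
  define j where "j = i div 2"
  note dm = div_mod_less[OF i[folded j_def]]
  have "i = 2 * j + i mod 2" by (simp add: j_def)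
  then have ij: "i = 2 * ((j div N) * N + j mod N) + i mod 2" using dm(3) by simp
  have "cgraph_bits N (bits_cgraph N z) ! (2 * ((j div N) * N + j mod N) + i mod 2) =
      z ! (2 * ((j div N) * N + j mod N) + i mod 2)"
    using nth_cgraph_bits[OF dm(1,2), of "i mod 2"] by (simp add: enc_color_bits_cgraph)
  then show "cgraph_bits N (bits_cgraph N z) ! i = z ! i" using ij by simp
qed (simp add: assms length_cgraph_bits)

lemma bits_cgraph_le: "bits_cgraph N z a b \<le> 3"
  by (simp add: bits_cgraph_def)

lemma framed_graphs:
  "framed 1 w N z M y \<longleftrightarrow> length z = N * N \<and> length y = M * M \<and>
     w = enc_pair (enc_graph (N, bits_graph N z)) (enc_graph (M, bits_graph M y))"
  by (auto simp: framed_def enc_graph_pack graph_bits_bits_graph)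

lemma framed_cgraphs:
  "framed 2 w N z M y \<longleftrightarrow> length z = 2 * (N * N) \<and> length y = 2 * (M * M) \<and>
     w = enc_pair (enc_cgraph (N, bits_cgraph N z)) (enc_cgraph (M, bits_cgraph M y))"
  by (auto simp: framed_def enc_cgraph_pack cgraph_bits_bits_cgraph)

lemma framed_enc_graph:
  "framed 1 (enc_pair (enc_graph (N, E)) (enc_graph (M, F))) N (graph_bits N E) M (graph_bits M F)"
  by (simp add: framed_def enc_graph_pack length_graph_bits)

lemma framed_enc_cgraph:
  "framed 2 (enc_pair (enc_cgraph (N, c)) (enc_cgraph (M, d))) N (cgraph_bits N c) M (cgraph_bits M d)"
  by (simp add: framed_def enc_cgraph_pack length_cgraph_bits)

lemma enc_graph_eqD:
  assumes "enc_graph (N, E) = enc_graph (N', E')"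
  shows "N' = N" "a < N \<Longrightarrow> b < N \<Longrightarrow> E' a b = E a b"
proof -
  show N: "N' = N" using assms by (simp add: enc_graph_pack pack_inject)
  show "E' a b = E a b" if "a < N" "b < N"
    using assms nth_graph_bits[OF that] unfolding N enc_graph_pack pack_inject by metis
qed

text \<open>\<open>enc_color\<close> retains a colour modulo 4 only, so a colour can be recovered
  when it is at most 3.\<close>

lemma enc_cgraph_eqD:
  assumes "enc_cgraph (N, c) = enc_cgraph (N', c')"
  shows "N' = N" "a < N \<Longrightarrow> b < N \<Longrightarrow> c a b \<le> 3 \<Longrightarrow> c' a b \<le> 3 \<Longrightarrow> c' a b = c a b"
proof -
  show N: "N' = N" using assms by (simp add: enc_cgraph_pack pack_inject)
  show "c' a b = c a b" if "a < N" "b < N" "c a b \<le> 3" "c' a b \<le> 3"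
  proof -
    have "cgraph_bits N c = cgraph_bits N c'"
      using assms unfolding N enc_cgraph_pack pack_inject by blast
    then have "enc_color (c a b) ! k = enc_color (c' a b) ! k" if "k < 2" for k
      using nth_cgraph_bits[OF \<open>a < N\<close> \<open>b < N\<close> that] by metis
    from this[of 0] this[of 1]
    have eq: "(c a b div 2 mod 2 = 1) = (c' a b div 2 mod 2 = 1)" "(c a b mod 2 = 1) = (c' a b mod 2 = 1)"
      by (simp_all add: enc_color_def)
    have "c a b \<in> {0, 1, 2, 3}" "c' a b \<in> {0, 1, 2, 3}" using that by auto
    with eq show ?thesis by auto
  qed
qed

text \<open>A word belongs to \<open>GI\<close> if some pair of representatives does, and edge
  relations are arbitrary outside the vertex range. As all properties involved look only inside this
  range, they do not depend on the representatives.\<close>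

lemma enc_pair_in_GI:
  "enc_pair (enc_graph (N, E)) (enc_graph (M, F)) \<in> GI \<longleftrightarrow>
     simple_graph (N, E) \<and> simple_graph (M, F) \<and> graph_iso (N, E) (M, F)"
proof
  assume "enc_pair (enc_graph (N, E)) (enc_graph (M, F)) \<in> GI"
  then obtain N' E' M' F' where
    eq: "enc_graph (N, E) = enc_graph (N', E')" "enc_graph (M, F) = enc_graph (M', F')"
    and G: "simple_graph (N', E')" "simple_graph (M', F')" "graph_iso (N', E') (M', F')"
    unfolding GI_def by (auto simp: enc_pair_inject)
  note N = enc_graph_eqD(1)[OF eq(1)] enc_graph_eqD(1)[OF eq(2)]
  have E: "E' a b = E a b" if "a < N" "b < N" for a b using enc_graph_eqD(2)[OF eq(1) that] .
  have F: "F' a b = F a b" if "a < M" "b < M" for a b using enc_graph_eqD(2)[OF eq(2) that] .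
  obtain \<pi> where \<pi>: "bij_betw \<pi> {0..<N} {0..<M}" "\<forall>i<N. \<forall>j<N. E' i j = F' (\<pi> i) (\<pi> j)"
    using G(3) unfolding graph_iso_def N by auto
  have "\<pi> i < M" if "i < N" for i using \<pi>(1) that by (auto simp: bij_betw_def)
  then have "\<forall>i<N. \<forall>j<N. E i j = F (\<pi> i) (\<pi> j)" using \<pi>(2) E F by simp
  with \<pi>(1) have "graph_iso (N, E) (M, F)" unfolding graph_iso_def by blast
  moreover have "simple_graph (N, E)" "simple_graph (M, F)"
    using G(1,2) E F unfolding simple_graph_def N by simp_all
  ultimately show "simple_graph (N, E) \<and> simple_graph (M, F) \<and> graph_iso (N, E) (M, F)" by blast
qed (auto simp: GI_def)

lemma in_LCN_class_cong:
  assumes "\<And>a b. a < N \<Longrightarrow> b < N \<Longrightarrow> c' a b = c a b"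
  shows "in_LCN_class (N, c') \<longleftrightarrow> in_LCN_class (N, c)"
  using assms unfolding in_LCN_class_def by simp

lemma in_LCN_class_le: "in_LCN_class (N, c) \<Longrightarrow> a < N \<Longrightarrow> b < N \<Longrightarrow> c a b \<le> 3"
  using in_LCN_class_imp_lcn_coloring[of N c] unfolding lcn_coloring_def valid_coloring_def
  by (meson le_trans numeral_le_iff semiring_norm(68,69,72,73))

lemma enc_pair_in_GI_SAT:
  assumes c: "\<And>a b. a < N \<Longrightarrow> b < N \<Longrightarrow> c a b \<le> 3" and d: "\<And>a b. a < M \<Longrightarrow> b < M \<Longrightarrow> d a b \<le> 3"
  shows "enc_pair (enc_cgraph (N, c)) (enc_cgraph (M, d)) \<in> GI_SAT \<longleftrightarrow>
     in_LCN_class (N, c) \<and> in_LCN_class (M, d) \<and> cgraph_iso (N, c) (M, d)"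
proof
  assume "enc_pair (enc_cgraph (N, c)) (enc_cgraph (M, d)) \<in> GI_SAT"
  then obtain N' c' M' d' where
    eq: "enc_cgraph (N, c) = enc_cgraph (N', c')" "enc_cgraph (M, d) = enc_cgraph (M', d')"
    and G: "in_LCN_class (N', c')" "in_LCN_class (M', d')" "cgraph_iso (N', c') (M', d')"
    unfolding GI_SAT_def by (auto simp: enc_pair_inject)
  note N = enc_cgraph_eqD(1)[OF eq(1)] enc_cgraph_eqD(1)[OF eq(2)]
  have C: "c' a b = c a b" if "a < N" "b < N" for a b
    using enc_cgraph_eqD(2)[OF eq(1) that c[OF that]] in_LCN_class_le[OF G(1)] that N by blast
  have D: "d' a b = d a b" if "a < M" "b < M" for a b
    using enc_cgraph_eqD(2)[OF eq(2) that d[OF that]] in_LCN_class_le[OF G(2)] that N by blast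
  obtain \<pi> where \<pi>: "bij_betw \<pi> {0..<N} {0..<M}" "\<forall>i<N. \<forall>j<N. c' i j = d' (\<pi> i) (\<pi> j)"
    using G(3) unfolding cgraph_iso_def N by auto
  have "\<pi> i < M" if "i < N" for i using \<pi>(1) that by (auto simp: bij_betw_def)
  then have "\<forall>i<N. \<forall>j<N. c i j = d (\<pi> i) (\<pi> j)" using \<pi>(2) C D by simp
  with \<pi>(1) have "cgraph_iso (N, c) (M, d)" unfolding cgraph_iso_def by blast
  moreover have "in_LCN_class (N, c)" "in_LCN_class (M, d)"
    using G(1,2) in_LCN_class_cong[of N c' c, OF C] in_LCN_class_cong[of M d' d, OF D] unfolding N by blast+
  ultimately show "in_LCN_class (N, c) \<and> in_LCN_class (M, d) \<and> cgraph_iso (N, c) (M, d)" by blast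
qed (auto simp: GI_SAT_def)

lemma GI_framed:
  assumes "w \<in> GI"
  shows "\<exists>N z M y. framed 1 w N z M y"
  using assms framed_enc_graph unfolding GI_def by (auto, blast)

lemma GI_SAT_framed:
  assumes "w \<in> GI_SAT"
  shows "\<exists>N z M y. framed 2 w N z M y"
  using assms framed_enc_cgraph unfolding GI_SAT_def by (auto, blast)

lemma not_framed_Nil: "\<not> framed k [] N z M y"
  using framed_size[of k "[]" N z M y] by auto

lemma Nil_notin: "[] \<notin> GI" "[] \<notin> GI_SAT"
  using GI_framed[of "[]"] GI_SAT_framed[of "[]"] not_framed_Nil by blast+

text \<open>A reduction has to map every word. Those that are not framed or violate \<open>A\<close>
  are no members of \<open>X\<close>, and they go to the empty word, which is no member of
  \<open>Y\<close>.\<close>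

lemma poly_reducible_framed:
  assumes "wf_fm 4 A" "wf_prg 4 c"
    and frames: "\<And>w. w \<in> X \<Longrightarrow> \<exists>N z M y. framed k w N z M y" and "[] \<notin> Y"
    and main: "\<And>w N z M y. framed k w N z M y \<Longrightarrow>
      w \<in> X \<longleftrightarrow> holds w (start_env w N M) A \<and> prints w (start_env w N M) c \<in> Y"
  shows "poly_reducible X Y"
  unfolding poly_reducible_def
proof (intro exI conjI allI)
  show "poly_time_computable (run_prg (framed_prg k A c))"
    using assms(1,2) wf_frame by (intro poly_time_computable_run_prg) (simp add: framed_prg_def)
  fix w
  show "w \<in> X \<longleftrightarrow> run_prg (framed_prg k A c) w \<in> Y"
  proof (cases "\<exists>N z M y. framed k w N z M y")
    case True
    then obtain N z M y where f: "framed k w N z M y" by blast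
    show ?thesis using main[OF f] run_framed_prg[OF f] \<open>[] \<notin> Y\<close> by simp
  next
    case False
    then show ?thesis using frames run_framed_prg_unframed \<open>[] \<notin> Y\<close> by metis
  qed
qed

definition print_pair :: "(bool \<Rightarrow> prg) \<Rightarrow> prg" where
  "print_pair c = Cat (c True) (Cat (Out False) (Cat (Out True) (c False)))"

lemma prints_print_pair:
  assumes "\<And>f. prints w p (c f) = dbl f (if f then x else y)"
  shows "prints w p (print_pair c) = enc_pair x y"
  using assms[of True] assms[of False] by (simp add: print_pair_def enc_pair_def dbl_def)

definition input_edge :: "bool \<Rightarrow> trm \<Rightarrow> trm \<Rightarrow> fm" where
  "input_edge f s t = zbit 1 f (Plus (Times s (input_size f)) t)"

lemma holds_input_edge:
  assumes "framed 1 w (p 2) z (p 3) y" "tval p s < p (if f then 2 else 3)" "tval p t < p (if f then 2 else 3)"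
  shows "holds w p (input_edge f s t) \<longleftrightarrow>
    bits_graph (p (if f then 2 else 3)) (if f then z else y) (tval p s) (tval p t)"
proof -
  let ?N = "p (if f then 2 else 3)"
  have "tval p s * ?N + tval p t < ?N * ?N" using pair_index(3)[OF assms(3,2)] .
  then have "tval p (Plus (Times s (input_size f)) t) < length (if f then z else y)"
    using assms(1) unfolding framed_graphs by auto
  then show ?thesis
    unfolding input_edge_def using holds_zbit[where first = f, OF assms(1)]
    by (simp add: bits_graph_def)
qed

lemma wf_input_edge: "4 \<le> d \<Longrightarrow> wf_trm d s \<Longrightarrow> wf_trm d t \<Longrightarrow> wf_fm d (input_edge f s t)"
  unfolding input_edge_def by (rule wf_zbit) auto

definition simple_fm :: "bool \<Rightarrow> fm" where
  "simple_fm f = Allb 4 (input_size f) (Allb 5 (input_size f)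
     (And (Iff (input_edge f (V 4) (V 5)) (input_edge f (V 5) (V 4)))
       (Neg (input_edge f (V 4) (V 4)))))"

lemma holds_simple_fm:
  assumes fr: "framed 1 w (p 2) z (p 3) y"
  shows "holds w p (simple_fm f) \<longleftrightarrow>
    simple_graph (p (if f then 2 else 3), bits_graph (p (if f then 2 else 3)) (if f then z else y))"
proof -
  let ?N = "p (if f then 2 else 3)"
  have N: "?N \<le> length w" using framed_size[OF fr] by auto
  have 1: "holds w p (simple_fm f) \<longleftrightarrow> (\<forall>a<?N. \<forall>b<?N. holds w (p(4 := a, 5 := b))
     (And (Iff (input_edge f (V 4) (V 5)) (input_edge f (V 5) (V 4))) (Neg (input_edge f (V 4) (V 4)))))"
    unfolding simple_fm_def using N by (simp add: holds_Allb del: holds.simps holds_connectives)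
  have 2: "holds w (p(4 := a, 5 := b)) (input_edge f s t) \<longleftrightarrow>
      bits_graph ?N (if f then z else y) (tval (p(4 := a, 5 := b)) s) (tval (p(4 := a, 5 := b)) t)"
    if "tval (p(4 := a, 5 := b)) s < ?N" "tval (p(4 := a, 5 := b)) t < ?N" for a b s t
    using holds_input_edge[of w "p(4 := a, 5 := b)" z y s f t] fr that by simp
  show ?thesis
    unfolding 1 simple_graph_def prod.case by (auto simp: 2)
qed

definition clause_edge_fm :: "bool \<Rightarrow> fm" where
  "clause_edge_fm f =
     Or (And (Lt (V 4) (input_size f)) (And (input_edge f (V 4) (V 5))
          (And (Eq (V 6) (input_size f)) (Or (Eq (V 7) (V 4)) (Eq (V 7) (V 5))))))
        (And (Lt (V 6) (input_size f)) (And (input_edge f (V 6) (V 7))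
          (And (Eq (V 4) (input_size f)) (Or (Eq (V 5) (V 6)) (Eq (V 5) (V 7))))))"

definition negation_edge_fm :: "bool \<Rightarrow> fm" where
  "negation_edge_fm f = And (Neg (clause_edge_fm f)) (And (Eq (V 5) (V 7))
     (Or (And (Eq (V 4) (input_size f)) (Eq (V 6) (Plus (input_size f) (C 1))))
       (And (Eq (V 4) (Plus (input_size f) (C 1))) (Eq (V 6) (input_size f)))))"

text \<open>The bits follow the order of \<open>enc_color\<close>, the high bit first: it is set for
  colour 2, the low one for colour 1.\<close>

definition clause_graph_prg :: "bool \<Rightarrow> prg" where
  "clause_graph_prg f = print_graph f (Plus (input_size f) (C 2)) [negation_edge_fm f, clause_edge_fm f]"

lemma prints_clause_graph_prg:
  fixes f :: bool and p :: "nat \<Rightarrow> nat"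
  assumes fr: "framed 1 w (p 2) z (p 3) y" and p1: "p 1 = length w"
  defines "N \<equiv> p (if f then 2 else 3)"
  shows "prints w p (clause_graph_prg f) =
    dbl f (enc_cgraph (clause_graph (N, bits_graph N (if f then z else y))))"
proof -
  define E where "E = bits_graph N (if f then z else y)"
  have N: "N + 2 < length w" using framed_size[OF fr] by (auto simp: N_def)
  then have "w \<noteq> []" by auto
  have bits: "map (holds w (p(4 := a, 5 := b, 6 := c, 7 := d))) [negation_edge_fm f, clause_edge_fm f] =
      enc_color (clause_color N E ((a * N + b) div N) ((a * N + b) mod N) ((c * N + d) div N) ((c * N + d) mod N))"
    if "a < N + 2" "b < N" "c < N + 2" "d < N" for a b c d
  proof -
    let ?q = "p(4 := a, 5 := b, 6 := c, 7 := d)"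
    have q: "?q (if f then 2 else 3) = N" by (simp add: N_def)
    have edge: "holds w ?q (input_edge f s t) \<longleftrightarrow> E (tval ?q s) (tval ?q t)"
      if "tval ?q s < N" "tval ?q t < N" for s t
      using holds_input_edge[of w ?q z y s f t] fr that unfolding q E_def by simp
    have lt: "a < length w" "b < length w" "c < length w" "d < length w" using that N by linarith+
    have 1: "holds w ?q (clause_edge_fm f) \<longleftrightarrow>
        a < N \<and> E a b \<and> c = N \<and> (d = a \<or> d = b) \<or> c < N \<and> E c d \<and> a = N \<and> (b = c \<or> b = d)"
    proof -
      have "a < N \<Longrightarrow> holds w ?q (input_edge f (V 4) (V 5)) \<longleftrightarrow> E a b"
        "c < N \<Longrightarrow> holds w ?q (input_edge f (V 6) (V 7)) \<longleftrightarrow> E c d"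
        using edge[of "V 4" "V 5"] edge[of "V 6" "V 7"] that by simp_all
      then show ?thesis
        unfolding clause_edge_fm_def using lt q by (auto simp: holds_Eq)
    qed
    have 2: "holds w ?q (negation_edge_fm f) \<longleftrightarrow> \<not> holds w ?q (clause_edge_fm f) \<and>
        b = d \<and> (a = N \<and> c = N + 1 \<or> a = N + 1 \<and> c = N)"
      unfolding negation_edge_fm_def using lt q by (auto simp: holds_Eq)
    show ?thesis
      unfolding pair_index(1,2)[OF that(2)] pair_index(1,2)[OF that(4)] list.map 2 1 clause_color_def
      by (simp add: enc_color_def)
  qed
  have "prints w p (clause_graph_prg f) = dbl f (pack ((N + 2) * N)
    (concat (map (\<lambda>i. concat (map (\<lambda>j. enc_color (clause_color N E (i div N) (i mod N) (j div N) (j mod N)))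
      [0..<(N + 2) * N])) [0..<(N + 2) * N])))"
    unfolding clause_graph_prg_def
    by (rule prints_print_graph[where g = "\<lambda>i j. enc_color (clause_color N E (i div N) (i mod N) (j div N) (j mod N))"])
      (use N p1 bits \<open>w \<noteq> []\<close> in \<open>simp_all add: N_def\<close>)
  then show ?thesis
    by (simp add: clause_graph_def enc_cgraph_pack cgraph_bits_def E_def)
qed

theorem GI_reducible_GI_SAT: "poly_reducible GI GI_SAT"
proof (rule poly_reducible_framed[where k = 1 and A = "And (simple_fm True) (simple_fm False)"
      and c = "print_pair clause_graph_prg"])
  show "wf_fm 4 (And (simple_fm True) (simple_fm False))"
    by (simp add: simple_fm_def wf_input_edge)
  show "wf_prg 4 (print_pair clause_graph_prg)"
    by (simp add: print_pair_def clause_graph_prg_def wf_print_graph negation_edge_fm_def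
        clause_edge_fm_def wf_input_edge)
  fix w N z M y
  assume fr: "framed 1 w N z M y"
  let ?p = "start_env w N M" and ?E = "bits_graph N z" and ?F = "bits_graph M y"
  have w: "w = enc_pair (enc_graph (N, ?E)) (enc_graph (M, ?F))"
    using fr unfolding framed_graphs by blast
  have p: "framed 1 w (?p 2) z (?p 3) y" using fr by simp
  have check: "holds w ?p (And (simple_fm True) (simple_fm False)) \<longleftrightarrow>
      simple_graph (N, ?E) \<and> simple_graph (M, ?F)"
    using holds_simple_fm[OF p, of True] holds_simple_fm[OF p, of False] by simp
  have "prints w ?p (clause_graph_prg f) = dbl f (if f then enc_cgraph (clause_graph (N, ?E))
      else enc_cgraph (clause_graph (M, ?F)))" for f
    using prints_clause_graph_prg[OF p, of f] by (cases f) simp_all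
  then have out: "prints w ?p (print_pair clause_graph_prg) =
      enc_pair (enc_cgraph (clause_graph (N, ?E))) (enc_cgraph (clause_graph (M, ?F)))"
    by (rule prints_print_pair)
  have le: "clause_color n e a b c d \<le> 3" for n e a b c d by (simp add: clause_color_def)
  \<comment> \<open>The output graphs lie in the class for arbitrary edge relations, so membership
    of the output reduces to isomorphism.\<close>
  have iff: "prints w ?p (print_pair clause_graph_prg) \<in> GI_SAT \<longleftrightarrow>
      cgraph_iso (clause_graph (N, ?E)) (clause_graph (M, ?F))"
    unfolding out using clause_graph_in_LCN_class[of N ?E] clause_graph_in_LCN_class[of M ?F]
    by (simp add: clause_graph_def enc_pair_in_GI_SAT le)
  have "graph_iso (N, ?E) (M, ?F) \<longleftrightarrow> cgraph_iso (clause_graph (N, ?E)) (clause_graph (M, ?F))"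
    if "simple_graph (N, ?E)" "simple_graph (M, ?F)"
    using graph_iso_imp_clause_graph_iso clause_graph_iso_imp_graph_iso[OF that] by blast
  then show "w \<in> GI \<longleftrightarrow> holds w ?p (And (simple_fm True) (simple_fm False)) \<and>
      prints w ?p (print_pair clause_graph_prg) \<in> GI_SAT"
    unfolding check iff using enc_pair_in_GI[of N ?E M ?F] w by metis
qed (use GI_framed Nil_notin in auto)

text \<open>The entry with index i occupies the bits 2 i and 2 i + 1. As \<open>k\<close> is fixed
  when the formula is built, each bit of \<open>k\<close> just decides whether the test is
  negated.\<close>

definition input_color :: "bool \<Rightarrow> nat \<Rightarrow> trm \<Rightarrow> trm \<Rightarrow> fm" where
  "input_color f k s t = And
     (let A = zbit 2 f (Times (C 2) (Plus (Times s (input_size f)) t)) in if k div 2 = 1 then A else Neg A)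
     (let A = zbit 2 f (Plus (Times (C 2) (Plus (Times s (input_size f)) t)) (C 1)) in
        if k mod 2 = 1 then A else Neg A)"

lemma holds_input_color:
  assumes "framed 2 w (p 2) z (p 3) y" "tval p s < p (if f then 2 else 3)" "tval p t < p (if f then 2 else 3)"
    "k \<le> 3"
  shows "holds w p (input_color f k s t) \<longleftrightarrow>
    bits_cgraph (p (if f then 2 else 3)) (if f then z else y) (tval p s) (tval p t) = k"
proof -
  let ?N = "p (if f then 2 else 3)"
  let ?i = "tval p s * ?N + tval p t"
  have "?i < ?N * ?N" using pair_index(3)[OF assms(3,2)] .
  then have lt: "2 * ?i + 1 < length (if f then z else y)"
    using assms(1) by (auto simp: framed_cgraphs)
  have "holds w p (zbit 2 f (Times (C 2) (Plus (Times s (input_size f)) t))) \<longleftrightarrow> (if f then z else y) ! (2 * ?i)"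
    "holds w p (zbit 2 f (Plus (Times (C 2) (Plus (Times s (input_size f)) t)) (C 1))) \<longleftrightarrow>
      (if f then z else y) ! (2 * ?i + 1)"
    using lt by (subst holds_zbit[OF assms(1)]; simp)+
  moreover have "k = 0 \<or> k = 1 \<or> k = 2 \<or> k = 3" using assms(4) by linarith
  ultimately show ?thesis
    unfolding input_color_def Let_def holds.simps bits_cgraph_def
    by (elim disjE) simp_all
qed

lemma wf_input_color: "4 \<le> d \<Longrightarrow> wf_trm d s \<Longrightarrow> wf_trm d t \<Longrightarrow> wf_fm d (input_color f k s t)"
  by (simp add: input_color_def Let_def wf_zbit)

definition literal_fm :: "bool \<Rightarrow> nat \<Rightarrow> trm \<Rightarrow> fm" where
  "literal_fm f r t = Exb r (input_size f) (input_color f 2 t (V r))"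

text \<open>Decoded colours are at most 3, so excluding 3 gives the bound 2; symmetry then follows
  from agreement on colours 1 and 2.\<close>

definition valid_fm :: "bool \<Rightarrow> fm" where
  "valid_fm f = Allb 4 (input_size f) (And (input_color f 0 (V 4) (V 4)) (Allb 5 (input_size f)
     (And (Neg (input_color f 3 (V 4) (V 5)))
     (And (Iff (input_color f 1 (V 4) (V 5)) (input_color f 1 (V 5) (V 4)))
       (Iff (input_color f 2 (V 4) (V 5)) (input_color f 2 (V 5) (V 4)))))))"

definition matching_fm :: "bool \<Rightarrow> fm" where
  "matching_fm f = Allb 4 (input_size f) (Allb 5 (input_size f) (Allb 6 (input_size f)
     (Imp (And (input_color f 2 (V 4) (V 5)) (input_color f 2 (V 4) (V 6))) (Eq (V 5) (V 6)))))"

definition bipartite_fm :: "bool \<Rightarrow> fm" where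
  "bipartite_fm f = Allb 4 (input_size f) (Allb 5 (input_size f) (Imp (input_color f 1 (V 4) (V 5))
     (Neg (Iff (literal_fm f 6 (V 4)) (literal_fm f 6 (V 5))))))"

definition degree_fm :: "bool \<Rightarrow> fm" where
  "degree_fm f = Allb 4 (input_size f) (Imp (Neg (literal_fm f 5 (V 4)))
     (Allb 5 (input_size f) (Allb 6 (input_size f) (Allb 7 (input_size f) (Allb 8 (input_size f)
       (Imp (And (Lt (V 5) (V 6)) (And (Lt (V 6) (V 7)) (Lt (V 7) (V 8))))
         (Neg (And (input_color f 1 (V 4) (V 5)) (And (input_color f 1 (V 4) (V 6))
           (And (input_color f 1 (V 4) (V 7)) (input_color f 1 (V 4) (V 8))))))))))))"

definition lcn_fm :: "bool \<Rightarrow> fm" where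
  "lcn_fm f = And (valid_fm f) (And (matching_fm f) (And (bipartite_fm f) (degree_fm f)))"

lemma holds_lcn_fm:
  fixes f :: bool and p :: "nat \<Rightarrow> nat"
  assumes fr: "framed 2 w (p 2) z (p 3) y"
  defines "N \<equiv> p (if f then 2 else 3)"
  shows "holds w p (lcn_fm f) \<longleftrightarrow> lcn_coloring N (bits_cgraph N (if f then z else y))"
proof -
  define col where "col = bits_cgraph N (if f then z else y)"
  have N: "N < length w" using framed_size[OF fr] by (auto simp: N_def)
  have ok: "q (if f then 2 else 3) = N" "framed 2 w (q 2) z (q 3) y" if "q 2 = p 2" "q 3 = p 3" for q
    using fr by (simp_all add: N_def that)
  have c: "holds w q (input_color f k (V r) (V s)) \<longleftrightarrow> col (q r) (q s) = k"
    if "q 2 = p 2" "q 3 = p 3" "q r < N" "q s < N" "k \<le> 3" for q r s k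
    using holds_input_color[of w q z y "V r" f "V s" k] ok[OF that(1,2)] that(3-) by (simp add: col_def)
  have all: "holds w q (Allb r (input_size f) A) \<longleftrightarrow> (\<forall>i<N. holds w (q(r := i)) A)"
    and ex: "holds w q (Exb r (input_size f) A) \<longleftrightarrow> (\<exists>i<N. holds w (q(r := i)) A)"
    if "q 2 = p 2" "q 3 = p 3" "3 < r" for q r A
    using ok(1)[OF that(1,2)] N that(3) by (subst holds_Allb holds_Exb; simp)+
  have lit: "holds w q (literal_fm f r (V s)) \<longleftrightarrow> literal_vertex N col (q s)"
    if "q 2 = p 2" "q 3 = p 3" "3 < r" "s \<noteq> r" "q s < N" for q r s
  proof -
    have "r \<noteq> 2" "r \<noteq> 3" using that(3) by auto
    then have "holds w (q(r := i)) (input_color f 2 (V s) (V r)) \<longleftrightarrow> col (q s) i = 2" if "i < N" for i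
      using c[of "q(r := i)" s r 2] \<open>q 2 = p 2\<close> \<open>q 3 = p 3\<close> \<open>s \<noteq> r\<close> \<open>q s < N\<close> that by simp
    then show ?thesis unfolding literal_fm_def ex[OF that(1-3)] literal_vertex_def by blast
  qed
  have le: "col a b \<le> 2 \<longleftrightarrow> col a b \<noteq> 3" for a b
    using bits_cgraph_le[of N "if f then z else y" a b] unfolding col_def by linarith
  have "holds w p (valid_fm f) \<longleftrightarrow> valid_coloring N col"
  proof -
    have eq: "col a b = col b a \<longleftrightarrow> (col a b = 1 \<longleftrightarrow> col b a = 1) \<and> (col a b = 2 \<longleftrightarrow> col b a = 2)"
      if "col a b \<noteq> 3" "col b a \<noteq> 3" for a b
      using that le[of a b] le[of b a] by linarith
    show ?thesis
      unfolding valid_coloring_def valid_fm_def using eq by (simp add: all c le) blast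
  qed
  moreover have "holds w p (matching_fm f) \<longleftrightarrow>
     (\<forall>a<N. \<forall>b<N. \<forall>c<N. col a b = 2 \<and> col a c = 2 \<longrightarrow> b = c)"
    unfolding matching_fm_def using N by (simp add: all c holds_Eq)
  moreover have "holds w p (bipartite_fm f) \<longleftrightarrow>
     (\<forall>a<N. \<forall>b<N. col a b = 1 \<longrightarrow> literal_vertex N col a \<noteq> literal_vertex N col b)"
    unfolding bipartite_fm_def by (simp add: all c lit)
  moreover have "holds w p (degree_fm f) \<longleftrightarrow>
     (\<forall>a<N. \<not> literal_vertex N col a \<longrightarrow> (\<forall>b<N. \<forall>c<N. \<forall>d<N. \<forall>e<N. b < c \<and> c < d \<and> d < e \<longrightarrow>
        \<not> (col a b = 1 \<and> col a c = 1 \<and> col a d = 1 \<and> col a e = 1)))"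
    unfolding degree_fm_def using N by (simp add: all c lit)
  ultimately show ?thesis
    unfolding lcn_fm_def holds.simps(4) lcn_coloring_def col_def[symmetric] by (simp only:)
qed

definition layer_edge_fm :: "bool \<Rightarrow> fm" where
  "layer_edge_fm f = Or (And (Eq (V 4) (C 0)) (And (Eq (V 6) (C 0)) (input_color f 1 (V 5) (V 7))))
     (Or (And (Eq (V 4) (C 2)) (And (Eq (V 6) (C 2)) (input_color f 2 (V 5) (V 7))))
       (And (Eq (V 5) (V 7)) (Neg (Iff (Eq (V 4) (C 0)) (Eq (V 6) (C 0))))))"

definition layered_graph_prg :: "bool \<Rightarrow> prg" where
  "layered_graph_prg f = print_graph f (C 3) [layer_edge_fm f]"

lemma prints_layered_graph_prg:
  fixes f :: bool and p :: "nat \<Rightarrow> nat"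
  assumes fr: "framed 2 w (p 2) z (p 3) y" and p1: "p 1 = length w"
  defines "N \<equiv> p (if f then 2 else 3)"
  shows "prints w p (layered_graph_prg f) =
    dbl f (enc_graph (layered_graph (N, bits_cgraph N (if f then z else y))))"
proof -
  define col where "col = bits_cgraph N (if f then z else y)"
  have N: "N + 4 < length w" using framed_size[OF fr] by (auto simp: N_def)
  then have "w \<noteq> []" by auto
  have bits: "map (holds w (p(4 := a, 5 := b, 6 := c, 7 := d))) [layer_edge_fm f] =
      [layer_edge col ((a * N + b) div N) ((a * N + b) mod N) ((c * N + d) div N) ((c * N + d) mod N)]"
    if "a < 3" "b < N" "c < 3" "d < N" for a b c d
  proof -
    let ?q = "p(4 := a, 5 := b, 6 := c, 7 := d)"
    have q: "?q (if f then 2 else 3) = N" by (simp add: N_def)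
    have color: "holds w ?q (input_color f k (V 5) (V 7)) \<longleftrightarrow> col b d = k" if "k \<le> 3" for k
      using holds_input_color[of w ?q z y "V 5" f "V 7" k] fr that \<open>b < N\<close> \<open>d < N\<close> unfolding q col_def by simp
    have lt: "a < length w" "b < length w" "c < length w" "d < length w" using that N by linarith+
    have "holds w ?q (layer_edge_fm f) \<longleftrightarrow> layer_edge col a b c d"
      unfolding layer_edge_fm_def layer_edge_def using lt by (simp add: holds_Eq color)
    then show ?thesis
      unfolding pair_index(1,2)[OF that(2)] pair_index(1,2)[OF that(4)] by simp
  qed
  have "prints w p (layered_graph_prg f) = dbl f (pack (3 * N)
    (concat (map (\<lambda>i. concat (map (\<lambda>j. [layer_edge col (i div N) (i mod N) (j div N) (j mod N)])
      [0..<3 * N])) [0..<3 * N])))"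
    unfolding layered_graph_prg_def
    by (rule prints_print_graph[where g = "\<lambda>i j. [layer_edge col (i div N) (i mod N) (j div N) (j mod N)]"])
      (use N p1 bits \<open>w \<noteq> []\<close> in \<open>simp_all add: N_def\<close>)
  then show ?thesis
    by (simp add: layered_graph_def enc_graph_pack graph_bits_def col_def)
qed

theorem GI_SAT_reducible_GI: "poly_reducible GI_SAT GI"
proof (rule poly_reducible_framed[where k = 2 and A = "And (lcn_fm True) (lcn_fm False)"
      and c = "print_pair layered_graph_prg"])
  show "wf_fm 4 (And (lcn_fm True) (lcn_fm False))"
    by (simp add: lcn_fm_def valid_fm_def matching_fm_def bipartite_fm_def degree_fm_def
        literal_fm_def wf_input_color)
  show "wf_prg 4 (print_pair layered_graph_prg)"
    by (simp add: print_pair_def layered_graph_prg_def wf_print_graph layer_edge_fm_def wf_input_color)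
  fix w N z M y
  assume fr: "framed 2 w N z M y"
  let ?p = "start_env w N M" and ?c = "bits_cgraph N z" and ?d = "bits_cgraph M y"
  have w: "w = enc_pair (enc_cgraph (N, ?c)) (enc_cgraph (M, ?d))"
    using fr unfolding framed_cgraphs by blast
  have p: "framed 2 w (?p 2) z (?p 3) y" using fr by simp
  have "holds w ?p (And (lcn_fm True) (lcn_fm False)) \<longleftrightarrow> lcn_coloring N ?c \<and> lcn_coloring M ?d"
    using holds_lcn_fm[OF p, of True] holds_lcn_fm[OF p, of False] by simp
  moreover have lcn_iff: "lcn_coloring n c \<longleftrightarrow> in_LCN_class (n, c)" for n c
    using in_LCN_class_imp_lcn_coloring lcn_coloring_imp_in_LCN_class by blast
  ultimately have check: "holds w ?p (And (lcn_fm True) (lcn_fm False)) \<longleftrightarrow>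
      in_LCN_class (N, ?c) \<and> in_LCN_class (M, ?d)"
    by blast
  have "prints w ?p (layered_graph_prg f) = dbl f (if f then enc_graph (layered_graph (N, ?c))
      else enc_graph (layered_graph (M, ?d)))" for f
    using prints_layered_graph_prg[OF p, of f] by (cases f) simp_all
  then have out: "prints w ?p (print_pair layered_graph_prg) =
      enc_pair (enc_graph (layered_graph (N, ?c))) (enc_graph (layered_graph (M, ?d)))"
    by (rule prints_print_pair)
  have "prints w ?p (print_pair layered_graph_prg) \<in> GI \<longleftrightarrow> cgraph_iso (N, ?c) (M, ?d)"
    if "in_LCN_class (N, ?c)" "in_LCN_class (M, ?d)"
  proof -
    have valid: "valid_coloring N ?c" "valid_coloring M ?d"
      using that unfolding lcn_iff[symmetric] lcn_coloring_def by blast+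
    have "enc_pair (enc_graph (layered_graph (N, ?c))) (enc_graph (layered_graph (M, ?d))) \<in> GI \<longleftrightarrow>
        graph_iso (layered_graph (N, ?c)) (layered_graph (M, ?d))"
      using simple_layered_graph[OF valid(1)] simple_layered_graph[OF valid(2)]
      by (simp add: layered_graph_def enc_pair_in_GI)
    also have "\<dots> \<longleftrightarrow> cgraph_iso (N, ?c) (M, ?d)"
      using cgraph_iso_imp_layered_graph_iso layered_graph_iso_imp_cgraph_iso[OF valid] by blast
    finally show ?thesis unfolding out .
  qed
  moreover have "w \<in> GI_SAT \<longleftrightarrow> in_LCN_class (N, ?c) \<and> in_LCN_class (M, ?d) \<and> cgraph_iso (N, ?c) (M, ?d)"
    using enc_pair_in_GI_SAT[of N ?c M ?d, OF bits_cgraph_le bits_cgraph_le] w by simp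
  ultimately show "w \<in> GI_SAT \<longleftrightarrow> holds w ?p (And (lcn_fm True) (lcn_fm False)) \<and>
      prints w ?p (print_pair layered_graph_prg) \<in> GI"
    unfolding check by blast
qed (use GI_SAT_framed Nil_notin in auto)

theorem theorem6:
  shows "poly_reducible GI GI_SAT \<and> poly_reducible GI_SAT GI"
  using GI_reducible_GI_SAT GI_SAT_reducible_GI by blast

end
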